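(* Let $\nu\ge2$, let $0$ be a critical point of a smooth function $f:\mathbb R^\nu\to\mathbb R$ in variables $k=(k_1,\dots,k_\nu)$, and suppose that the kernel of the second differential of $f$ at the origin coincides with the coordinate plane $Ok_1k_2$. Suppose that $\frac{\partial^3f(0)}{\partial k_1^3}=\frac{\partial^3f(0)}{\partial k_1\partial k_2^2}=0$ and $\frac{\partial^3f(0)}{\partial k_1^2\partial k_2}=1$. Then there exists a sequence of real numbers $d_\mu$, $\mu=4,5,\dots$, depending on the partial derivatives of $f$ at the origin, with the following properties. 1. $d_\mu=\frac{\partial^{\mu-1}f(0)}{\partial k_2^{\mu-1}}+P_\mu$, where $P_\mu$ is a polynomial (depending only on $\mu$ and $\nu$), with rational coefficients and vanishing free term, in the values of the partial derivatives $\frac{\partial^{i_1+\dots+i_\nu}f(0)}{\partial k_1^{i_1}\cdots\partial k_\nu^{i_\nu}}$, $3\le i_1+\dots+i_\nu\le\mu-2$ (except the derivatives with respect to $k_2$ only), and the components of the inverse of the matrix $\left\|\frac{\partial^2f(0)}{\partial k_i\partial k_j}\right\|_{i,j=3,\dots,\nu}$. For $\mu=4,\dots,8$, with the numbers $a_{i,j}$ given in the context, $$d_4=a_{0,3},\quad d_5=a_{0,4},\quad d_6=a_{0,5}-\tfrac53a_{1,3}^2,\quad d_7=a_{0,6}-5a_{1,3}a_{1,4}+5a_{1,3}^2a_{2,2},$$ $$d_8=a_{0,7}-7a_{1,3}a_{1,5}+\tfrac{35}3a_{1,3}^2a_{2,3}-\tfrac{35}9a_{1,3}^3a_{3,1}-\tfrac{35}8(a_{1,4}-2a_{1,3}a_{2,2})^2.$$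 2. For $\mu\ge4$, the germ of $f$ at the origin has a singularity of type $D_\mu^{\pm}$ (for one of the signs) if and only if $d_4=\dots=d_{\mu-1}=0$ and $d_\mu\ne0$. Moreover, if $d_4=\dots=d_{\mu-1}=0$ and $d_\mu\ne0$, then in some neighbourhood of the origin $f$ reduces to the form $$f=d+\tilde k_1^2\tilde k_2+d_\mu\tilde k_2^{\mu-1}+Q(\tilde k_3,\dots,\tilde k_\nu)$$ by a regular smooth change of variables $k\to\tilde k$ leaving the origin fixed, where $d$ is a constant and $Q$ is a nondegenerate quadratic form in $\nu-2$ variables. In particular, $f\in D_\mu^+$ if $d_\mu>0$ and $f\in D_\mu^-$ if $d_\mu<0$.
   Context: A germ $f$ at a critical point $0\in\mathbb R^\nu$ has a singularity of type $D_\mu^{\pm}$ ($\mu\ge4$) if there is a germ of diffeomorphism fixing $0$ after which $f=\mathrm{const}+x_1^2x_2\pm x_2^{\mu-1}+Q(x_3,\dots,x_\nu)$ with $Q$ a nondegenerate quadratic form. Notation: $x=k_1$, $y=k_2$, $z=(k_3,\dots,k_\nu)$; subscripts of $f$ denote partial derivatives at $0$. Let $z=z(x,y)$ be the unique smooth solution near $0$ of $\frac{\partial f}{\partial z}(x,y,z)=0$ with $z(0,0)=0$, put $\psi(x,y)=f(x,y,z(x,y))$ and $a_{i,j}=\frac{\partial^{i+j}\psi}{\partial x^i\partial y^j}(0,0)$. Let $G$ be the inverse of $\|\partial^2f(0)/\partial z_p\partial z_q\|$, $b_{ij}=f_{x^iy^jz}$ (the vector with components $\partial^{i+j+1}f(0)/\partial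 x^i\partial y^j\partial z_p$), $M_{ij}=f_{x^iy^jz^2}$ (the symmetric matrix $\|\partial^{i+j+2}f(0)/\partial x^i\partial y^j\partial z_p\partial z_q\|$), and $T=f_{z^3}$ (the symmetric trilinear form of third derivatives in $z$). Then explicitly: $a_{0,3}=f_{y^3}$, $a_{0,4}=f_{y^4}-3b_{02}^TGb_{02}$, $a_{0,5}=f_{y^5}-10b_{02}^TGb_{03}+15b_{02}^TGM_{01}Gb_{02}$, $a_{0,6}=f_{y^6}-15b_{02}^TGb_{04}+60b_{02}^TGM_{01}Gb_{03}-90b_{02}^TGM_{01}GM_{01}Gb_{02}-10b_{03}^TGb_{03}+45b_{02}^TGM_{02}Gb_{02}-15T(Gb_{02},Gb_{02},Gb_{02})$, $a_{1,3}=f_{xy^3}-3b_{11}^TGb_{02}$, and $a_{3,1}=f_{x^3y}-3b_{11}^TGb_{20}$, $a_{2,2}=f_{x^2y^2}-2b_{11}^TGb_{11}-b_{20}^TGb_{02}$, $a_{1,4}=f_{xy^4}-6b_{12}^TGb_{02}-4b_{03}^TGb_{11}+3b_{02}^TGM_{10}Gb_{02}+12b_{02}^TGM_{01}Gb_{11}$, $a_{2,3}=f_{x^2y^3}-b_{20}^TGb_{03}-3b_{21}^TGb_{02}+3b_{20}^TGM_{01}Gb_{02}+6b_{11}^TGM_{10}Gb_{02}-6b_{11}^TGb_{12}+6b_{11}^TGM_{01}Gb_{11}$, $a_{1,5}=f_{xy^5}-10b_{03}^TGb_{12}-30b_{02}^TGM_{10}GM_{01}Gb_{02}-60b_{11}^TGM_{01}GM_{01}Gb_{02}-5b_{04}^TGb_{11}-10b_{13}^TGb_{02}-15T(Gb_{11},Gb_{02},Gb_{02})+15b_{02}^TGM_{11}Gb_{02}+30b_{11}^TGM_{02}Gb_{02}+10b_{02}^TGM_{10}Gb_{03}+20b_{11}^TGM_{01}Gb_{03}+30b_{02}^TGM_{01}Gb_{12}$.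 If $\nu=2$ all terms involving $z$ are absent. *)

theory Defs
  imports "HOL-Analysis.Analysis" "HOL-Library.Poly_Mapping"
begin

section \<open>Iterated derivatives and smooth maps\<close>

text \<open>\<open>iter_deriv [v\<^sub>1, \<dots>, v\<^sub>m] f\<close> is \<open>\<partial>\<^sub>v\<^sub>1 (\<dots> (\<partial>\<^sub>v\<^sub>m f))\<close>; vectors may repeat.\<close>

fun iter_deriv :: "'a list \<Rightarrow> ('a \<Rightarrow> 'b) \<Rightarrow> 'a::euclidean_space \<Rightarrow> 'b::euclidean_space" where
  "iter_deriv [] f = f"
| "iter_deriv (v # vs) f = (\<lambda>x. frechet_derivative (iter_deriv vs f) (at x) v)"

text \<open>For open \<open>U\<close> this is \<open>C\<^sup>\<infinity>\<close> on \<open>U\<close>: all iterated derivatives exist there and, being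
  differentiable themselves, are continuous.\<close>

definition smooth_on :: "'a::euclidean_space set \<Rightarrow> ('a \<Rightarrow> 'b::euclidean_space) \<Rightarrow> bool" where
  "smooth_on U f \<longleftrightarrow> (\<forall>vs. \<forall>x\<in>U. iter_deriv vs f differentiable (at x))"

text \<open>The coordinates of \<open>\<real>\<^sup>\<nu>\<close> are indexed by a finite type \<open>'n\<close> with \<open>\<nu> = CARD('n)\<close>.
  \<open>partial [p\<^sub>1, \<dots>, p\<^sub>m] f\<close> is \<open>\<partial>\<^sup>m f / \<partial>k\<^bsub>p1\<^esub> \<dots> \<partial>k\<^bsub>pm\<^esub>\<close>. For smooth \<open>f\<close> the order of the list
  is irrelevant, so such a list plays the role of the multi-index \<open>(i\<^sub>1, \<dots>, i\<^sub>\<nu>)\<close> with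
  \<open>i\<^sub>1 + \<dots> + i\<^sub>\<nu> = m\<close>.\<close>

definition partial :: "'n list \<Rightarrow> (real^'n::finite \<Rightarrow> real) \<Rightarrow> real^'n \<Rightarrow> real" where
  "partial ps f = iter_deriv (map (\<lambda>p. axis p 1) ps) f"

definition critical_point :: "(real^'n::finite \<Rightarrow> real) \<Rightarrow> real^'n \<Rightarrow> bool" where
  "critical_point f x \<longleftrightarrow> (f has_derivative (\<lambda>_. 0)) (at x)"

definition hessian_kernel :: "(real^'n::finite \<Rightarrow> real) \<Rightarrow> real^'n \<Rightarrow> (real^'n) set" where
  "hessian_kernel f x = {u. \<forall>v. iter_deriv [u, v] f x = 0}"

section \<open>The singularities \<open>D\<^sub>\<mu>\<close>\<close>

text \<open>In the following \<open>k1\<close>, \<open>k2\<close> are two distinct indices; all the remaining ones are the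
  indices of the variables \<open>z = (k\<^sub>3, \<dots>, k\<^sub>\<nu>)\<close>. If \<open>\<nu> = 2\<close> the only form below is \<open>0\<close>.\<close>

definition nondeg_quadratic_form :: "'n \<Rightarrow> 'n \<Rightarrow> (real^'n::finite \<Rightarrow> real) \<Rightarrow> bool" where
  "nondeg_quadratic_form k1 k2 Q \<longleftrightarrow>
     (\<exists>A :: 'n \<Rightarrow> 'n \<Rightarrow> real.
        (\<forall>p q. A p q = A q p) \<and>
        Q = (\<lambda>x. \<Sum>p\<in>-{k1, k2}. \<Sum>q\<in>-{k1, k2}. A p q * x $ p * x $ q) \<and>
        (\<forall>u :: 'n \<Rightarrow> real. (\<forall>p\<in>-{k1, k2}. (\<Sum>q\<in>-{k1, k2}. A p q * u q) = 0)
              \<longrightarrow> (\<forall>p\<in>-{k1, k2}. u p = 0)))"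

definition diffeo_germ :: "(real^'n::finite \<Rightarrow> real^'n) \<Rightarrow> bool" where
  "diffeo_germ \<phi> \<longleftrightarrow> \<phi> 0 = 0 \<and>
     (\<exists>U V \<theta>. open U \<and> open V \<and> 0 \<in> U \<and> homeomorphism U V \<phi> \<theta> \<and> smooth_on U \<phi> \<and> smooth_on V \<theta>)"

definition germ_reducible :: "(real^'n::finite \<Rightarrow> real) \<Rightarrow> (real^'n \<Rightarrow> real) \<Rightarrow> bool" where
  "germ_reducible f g \<longleftrightarrow> (\<exists>\<phi>. diffeo_germ \<phi> \<and> (\<forall>\<^sub>F x in nhds 0. f (\<phi> x) = g x))"

definition reducible_to_D :: "'n \<Rightarrow> 'n \<Rightarrow> nat \<Rightarrow> real \<Rightarrow> (real^'n::finite \<Rightarrow> real) \<Rightarrow> bool" where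
  "reducible_to_D k1 k2 \<mu> c f \<longleftrightarrow>
     (\<exists>d Q. nondeg_quadratic_form k1 k2 Q \<and>
        germ_reducible f (\<lambda>x. d + (x $ k1)^2 * x $ k2 + c * (x $ k2)^(\<mu> - 1) + Q x))"

definition D_plus :: "'n \<Rightarrow> 'n \<Rightarrow> nat \<Rightarrow> (real^'n::finite \<Rightarrow> real) \<Rightarrow> bool" where
  "D_plus k1 k2 \<mu> f \<longleftrightarrow> critical_point f 0 \<and> reducible_to_D k1 k2 \<mu> 1 f"

definition D_minus :: "'n \<Rightarrow> 'n \<Rightarrow> nat \<Rightarrow> (real^'n::finite \<Rightarrow> real) \<Rightarrow> bool" where
  "D_minus k1 k2 \<mu> f \<longleftrightarrow> critical_point f 0 \<and> reducible_to_D k1 k2 \<mu> (-1) f"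

section \<open>The numbers \<open>a\<^sub>i\<^sub>,\<^sub>j\<close>\<close>

text \<open>\<open>s\<close> is the graph map \<open>(x, y) \<mapsto> (x, y, z(x, y))\<close> of a smooth local solution of
  \<open>\<partial>f/\<partial>z = 0\<close> with \<open>z(0, 0) = 0\<close>.\<close>

definition critical_graph ::
    "'n \<Rightarrow> 'n \<Rightarrow> (real^'n::finite \<Rightarrow> real) \<Rightarrow> (real \<times> real \<Rightarrow> real^'n) \<Rightarrow> bool" where
  "critical_graph k1 k2 f s \<longleftrightarrow> s (0, 0) = 0 \<and>
     (\<exists>U. open U \<and> (0, 0) \<in> U \<and> smooth_on U s \<and>
        (\<forall>(x, y)\<in>U. s (x, y) $ k1 = x \<and> s (x, y) $ k2 = y \<and>
           (\<forall>p\<in>-{k1, k2}. partial [p] f (s (x, y)) = 0)))"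

text \<open>When the second differential of \<open>f\<close> at the critical point \<open>0\<close> is nondegenerate in \<open>z\<close>,
  such a map exists and its germ is unique, so that \<open>a_coeff\<close>, which depends only on the germ,
  does not depend on the choice made here.\<close>

definition psi :: "'n \<Rightarrow> 'n \<Rightarrow> (real^'n::finite \<Rightarrow> real) \<Rightarrow> real \<times> real \<Rightarrow> real" where
  "psi k1 k2 f = f \<circ> (SOME s. critical_graph k1 k2 f s)"

definition a_coeff :: "'n \<Rightarrow> 'n \<Rightarrow> (real^'n::finite \<Rightarrow> real) \<Rightarrow> nat \<Rightarrow> nat \<Rightarrow> real" where
  "a_coeff k1 k2 f i j = iter_deriv (replicate i (1, 0) @ replicate j (0, 1)) (psi k1 k2 f) (0, 0)"

section \<open>Rational polynomials in the derivatives of \<open>f\<close>\<close>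

text \<open>The matrix of second derivatives in \<open>z\<close> is completed by the identity block for \<open>k1\<close>, \<open>k2\<close>;
  the inverse of the completed matrix is then block diagonal as well, and its \<open>z\<close>-block is the
  inverse of the matrix of second derivatives in \<open>z\<close>.\<close>

definition hess_z_inv :: "'n \<Rightarrow> 'n \<Rightarrow> (real^'n::finite \<Rightarrow> real) \<Rightarrow> 'n \<Rightarrow> 'n \<Rightarrow> real" where
  "hess_z_inv k1 k2 f p q =
     matrix_inv (\<chi> i j. if i \<notin> {k1, k2} \<and> j \<notin> {k1, k2} then partial [i, j] f 0
                        else if i = j then 1 else 0) $ p $ q"

datatype 'n jet_var = Deriv "'n list" | HessInv 'n 'n

text \<open>A polynomial maps monomials to coefficients; a monomial maps variables to exponents.\<close>

type_synonym 'v rat_mpoly = "('v \<Rightarrow>\<^sub>0 nat) \<Rightarrow>\<^sub>0 rat"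

definition mpoly_vars :: "'v rat_mpoly \<Rightarrow> 'v set" where
  "mpoly_vars P = (\<Union>m\<in>Poly_Mapping.keys P. Poly_Mapping.keys m)"

definition free_term :: "'v rat_mpoly \<Rightarrow> rat" where
  "free_term P = Poly_Mapping.lookup P 0"

definition mpoly_eval :: "('v \<Rightarrow> real) \<Rightarrow> 'v rat_mpoly \<Rightarrow> real" where
  "mpoly_eval \<rho> P = (\<Sum>m\<in>Poly_Mapping.keys P.
     of_rat (Poly_Mapping.lookup P m) * (\<Prod>v\<in>Poly_Mapping.keys m. \<rho> v ^ Poly_Mapping.lookup m v))"

fun jet_value :: "'n \<Rightarrow> 'n \<Rightarrow> (real^'n::finite \<Rightarrow> real) \<Rightarrow> 'n jet_var \<Rightarrow> real" where
  "jet_value k1 k2 f (Deriv ps) = partial ps f 0"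
| "jet_value k1 k2 f (HessInv p q) = hess_z_inv k1 k2 f p q"

definition admissible_vars :: "'n \<Rightarrow> 'n \<Rightarrow> nat \<Rightarrow> 'n jet_var set" where
  "admissible_vars k1 k2 \<mu> =
     {Deriv ps | ps. 3 \<le> length ps \<and> length ps \<le> \<mu> - 2 \<and> \<not> set ps \<subseteq> {k2}} \<union>
     {HessInv p q | p q. p \<notin> {k1, k2} \<and> q \<notin> {k1, k2}}"

end

theory Submission
  imports Defs "HOL-Library.Landau_Symbols" "HOL-Computational_Algebra.Polynomial"
begin

text \<open>Write \<open>x = k1\<close>, \<open>y = k2\<close>. Along a formal curve \<open>t \<mapsto> (x(t), t, z(t))\<close> on which
  \<open>\<partial>f/\<partial>x\<close> and \<open>\<partial>f/\<partial>z\<close> vanish to high order, \<open>f\<close> expands as \<open>\<Sum> d\<^bsub>j+1\<^esub> t\<^sup>j / j!\<close>. The coefficients of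
  the curve are found recursively, since \<open>\<partial>\<^sup>2f/\<partial>z\<^sup>2\<close> is invertible and \<open>\<partial>\<^sup>3f/\<partial>x\<^sup>2\<partial>y = 1\<close>; this makes
  \<open>d\<^sub>\<mu>\<close> a rational polynomial in the jet. If \<open>d\<^sub>4, \<dots>, d\<^bsub>\<mu>-1\<^esub>\<close> vanish, shearing \<open>x\<close> along the curve puts
  the reduced function \<open>\<psi>(x, y)\<close> into the shape \<open>x\<^sup>2 A + y\<^bsup>\<mu>-1\<^esup> K\<close>, which the implicit function theorem
  turns into \<open>X\<^sup>2 Y + c Y\<^bsup>\<mu>-1\<^esup>\<close>; the remaining variables split off by a Morse lemma with parameters.
  Conversely, a germ of type \<open>D\<^sub>\<mu>\<close> admits no regular curve along which the gradient vanishes to order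
  \<open>\<mu> - 1\<close>, whereas the curve above is one as soon as \<open>d\<^sub>4, \<dots>, d\<^sub>\<mu>\<close> all vanish.\<close>

section \<open>Calculus of smooth maps\<close>

text \<open>For a merely smooth function no power series can be substituted, so the curve is kept as
  a polynomial truncation and its quality is measured by orders O(t^n). What makes truncations
  harmless is stationarity: an error in the curve enters \<open>f\<close> only through the small
  gradient and through quadratic terms, so a truncation of modest degree already fixes many
  coefficients. This is also how the bound \<mu> - 2 on the orders of the derivatives is met: the
  coefficient of t^m is computed on a short truncation that suffices, and only afterwards compared
  with longer ones. The recursion runs in two half steps, since z enters its equations linearly
  through the Hessian, whereas x enters the equation \<partial>f/\<partial>x = 0 through the product
  x y, one degree later. Defining the numbers from \<open>f\<close> itself rather than from
  \<open>\<psi>\<close> keeps them polynomial in the jet of \<open>f\<close>. In the converse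
  direction, the gradient of the normal form does attain order \<mu> - 2, along the y-axis; the best
  possible order is a diffeomorphism invariant, so it determines \<mu>.\<close>

lemma iter_deriv_append: "iter_deriv (us @ vs) f = iter_deriv us (iter_deriv vs f)"
  by (induction us) auto

lemma frechet_derivative_cong_open:
  assumes "open U" "x \<in> U" "\<And>y. y \<in> U \<Longrightarrow> f y = g y"
  shows "frechet_derivative f (at x) = frechet_derivative g (at x)"
proof -
  have "(f has_derivative D) (at x) = (g has_derivative D) (at x)" for D
    using has_derivative_transform_within_open[OF _ assms(1,2)] assms(3) by metis
  then show ?thesis unfolding frechet_derivative_def by presburger
qed

lemma iter_deriv_cong:
  assumes "open U" "\<And>y. y \<in> U \<Longrightarrow> f y = g y" "x \<in> U"
  shows "iter_deriv vs f x = iter_deriv vs g x"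
  using assms(3)
proof (induction vs arbitrary: x)
  case (Cons v vs)
  have "frechet_derivative (iter_deriv vs f) (at x) = frechet_derivative (iter_deriv vs g) (at x)"
    by (rule frechet_derivative_cong_open[OF assms(1) Cons.prems]) (rule Cons.IH)
  then show ?case by simp
qed (use assms in auto)

lemma differentiable_cong_open:
  assumes "open U" "\<And>y. y \<in> U \<Longrightarrow> f y = g y" "x \<in> U" "f differentiable (at x)"
  shows "g differentiable (at x)"
  using assms has_derivative_transform_within_open unfolding differentiable_def by metis

text \<open>Finite-order stages of smoothness, so that closure properties can be proved by
  induction: differentiating a product, a composite or an inverse leads to the same construction
  with one derivative less. The index counts the orders up to which iterated derivatives are still
  differentiable, so \<open>Ck 0\<close> already means differentiability.\<close>

definition Ck :: "nat \<Rightarrow> 'a::euclidean_space set \<Rightarrow> ('a \<Rightarrow> 'b::euclidean_space) \<Rightarrow> bool" where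
  "Ck k U f \<longleftrightarrow> (\<forall>vs. length vs \<le> k \<longrightarrow> (\<forall>x\<in>U. iter_deriv vs f differentiable (at x)))"

lemma smooth_on_Ck: "smooth_on U f \<longleftrightarrow> (\<forall>k. Ck k U f)"
  unfolding smooth_on_def Ck_def by blast

lemma Ck_mono: "Ck k U f \<Longrightarrow> j \<le> k \<Longrightarrow> Ck j U f"
  unfolding Ck_def by auto

lemma Ck_0: "Ck 0 U f \<longleftrightarrow> (\<forall>x\<in>U. f differentiable (at x))"
  unfolding Ck_def by simp

lemma Ck_differentiable: "Ck k U f \<Longrightarrow> x \<in> U \<Longrightarrow> f differentiable (at x)"
  unfolding Ck_def by (metis iter_deriv.simps(1) le0 list.size(3))

text \<open>\<open>iter_deriv\<close> unfolds from the outermost derivative, whereas the inductions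
  need the innermost one split off; hence the case distinction on the last list element.\<close>

lemma Ck_Suc:
  "Ck (Suc k) U f \<longleftrightarrow> (\<forall>x\<in>U. f differentiable (at x)) \<and> (\<forall>v. Ck k U (\<lambda>x. frechet_derivative f (at x) v))"
    (is "?l \<longleftrightarrow> ?r")
proof
  assume l: ?l
  have "iter_deriv vs (\<lambda>x. frechet_derivative f (at x) v) differentiable (at x)"
    if "length vs \<le> k" "x \<in> U" for vs x v
  proof -
    have "iter_deriv (vs @ [v]) f differentiable (at x)"
      using l that unfolding Ck_def by (metis length_append_singleton Suc_le_mono)
    then show ?thesis by (simp add: iter_deriv_append)
  qed
  then show ?r using l Ck_differentiable unfolding Ck_def by blast
next
  assume r: ?r
  have "iter_deriv vs f differentiable (at x)" if "length vs \<le> Suc k" "x \<in> U" for vs x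
  proof (cases vs rule: rev_cases)
    case Nil then show ?thesis using r that by simp
  next
    case (snoc ws v)
    then show ?thesis using r that unfolding Ck_def by (simp add: iter_deriv_append)
  qed
  then show ?l unfolding Ck_def by blast
qed

lemma Ck_cong:
  assumes "open U" "\<And>y. y \<in> U \<Longrightarrow> f y = g y" "Ck k U f"
  shows "Ck k U g"
  unfolding Ck_def
proof (intro allI impI ballI)
  fix vs :: "'a list" and x assume *: "length vs \<le> k" "x \<in> U"
  show "iter_deriv vs g differentiable (at x)"
  proof (rule differentiable_cong_open[OF assms(1) _ *(2)])
    show "iter_deriv vs f y = iter_deriv vs g y" if "y \<in> U" for y
      using iter_deriv_cong[OF assms(1,2) that] .
  qed (use * assms(3) in \<open>auto simp: Ck_def\<close>)
qed

lemma Ck_SucI: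
  assumes "open U" "\<And>x. x \<in> U \<Longrightarrow> (f has_derivative D x) (at x)" "\<And>v. Ck k U (\<lambda>x. D x v)"
  shows "Ck (Suc k) U f"
  unfolding Ck_Suc
proof (intro conjI ballI allI)
  fix v
  show "Ck k U (\<lambda>x. frechet_derivative f (at x) v)"
    by (rule Ck_cong[OF assms(1) _ assms(3)[of v]]) (metis assms(2) frechet_derivative_at)
qed (use assms(2) differentiable_def in blast)

lemma Ck_has_derivative:
  "Ck k U f \<Longrightarrow> x \<in> U \<Longrightarrow> (f has_derivative frechet_derivative f (at x)) (at x)"
  using Ck_differentiable frechet_derivative_works by blast

lemma Ck_deriv: "Ck (Suc k) U f \<Longrightarrow> Ck k U (\<lambda>x. frechet_derivative f (at x) v)"
  unfolding Ck_Suc by blast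

lemma Ck_subset: "Ck k U f \<Longrightarrow> V \<subseteq> U \<Longrightarrow> Ck k V f"
  unfolding Ck_def by blast

lemma Ck_const: "open U \<Longrightarrow> Ck k U (\<lambda>x. c)"
proof (induction k arbitrary: c)
  case (Suc k) then show ?case by (intro Ck_SucI[where D = "\<lambda>x v. 0"]) auto
qed (simp add: Ck_0)

lemma Ck_linear:
  assumes "bounded_linear L" "open U" "Ck k U f" shows "Ck k U (\<lambda>x. L (f x))"
  using assms(3)
proof (induction k arbitrary: f)
  case 0 then show ?case
    unfolding Ck_0 using assms(1) bounded_linear.has_derivative unfolding differentiable_def by blast
next
  case (Suc k)
  show ?case
    by (rule Ck_SucI[OF assms(2) bounded_linear.has_derivative[OF assms(1)]])
      (use Suc Ck_has_derivative Ck_deriv in blast)+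
qed

lemma Ck_add:
  assumes "open U" "Ck k U f" "Ck k U g" shows "Ck k U (\<lambda>x. f x + g x)"
  using assms(2,3)
proof (induction k arbitrary: f g)
  case 0 then show ?case unfolding Ck_0 by auto
next
  case (Suc k)
  show ?case
    by (rule Ck_SucI[OF assms(1) has_derivative_add])
      (use Suc Ck_has_derivative Ck_deriv in blast)+
qed

lemma Ck_bilinear:
  assumes "bounded_bilinear B" "open U" "Ck k U f" "Ck k U g" shows "Ck k U (\<lambda>x. B (f x) (g x))"
  using assms(3,4)
proof (induction k arbitrary: f g)
  case 0
  then show ?case unfolding Ck_0 differentiable_def using bounded_bilinear.FDERIV[OF assms(1)] by blast
next
  case (Suc k)
  have k: "Ck k U f" "Ck k U g" by (rule Ck_mono, rule Suc.prems, simp)+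
  show ?case
    by (rule Ck_SucI[OF assms(2) bounded_bilinear.FDERIV[OF assms(1)
        Ck_has_derivative[OF Suc.prems(1)] Ck_has_derivative[OF Suc.prems(2)]]])
      (auto intro!: Ck_add[OF assms(2)] Suc.IH k Ck_deriv Suc.prems)
qed

lemma Ck_sum:
  assumes "open U" "\<And>i. i \<in> I \<Longrightarrow> Ck k U (f i)" shows "Ck k U (\<lambda>x. \<Sum>i\<in>I. f i x)"
  using assms(2)
  by (induction I rule: infinite_finite_induct) (auto intro!: Ck_const Ck_add assms(1))

text \<open>The chain rule evaluates the derivative of \<open>f\<close> in a direction that varies
  with the point. Expanding that direction in the basis leaves derivatives in fixed directions, to
  which the induction hypothesis applies, multiplied by coordinates of the derivative of
  \<open>g\<close>.\<close>

lemma Ck_compose: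
  assumes "open U" "open V" "g ` U \<subseteq> V" "Ck k V f" "Ck k U g" shows "Ck k U (\<lambda>x. f (g x))"
  using assms(4,5)
proof (induction k arbitrary: f)
  case 0
  show ?case unfolding Ck_0
  proof
    fix x assume "x \<in> U"
    then have "(f has_derivative frechet_derivative f (at (g x))) (at (g x))"
      "(g has_derivative frechet_derivative g (at x)) (at x)"
      using 0 assms(3) Ck_has_derivative by blast+
    then show "(\<lambda>x. f (g x)) differentiable (at x)"
      unfolding differentiable_def using has_derivative_compose by blast
  qed
next
  case (Suc k)
  have k: "Ck k U g" by (rule Ck_mono, rule Suc.prems, simp)
  show ?case
  proof (rule Ck_SucI[OF assms(1)])
    fix x assume x: "x \<in> U"
    show "((\<lambda>x. f (g x)) has_derivative
        (\<lambda>v. \<Sum>b\<in>Basis. (frechet_derivative g (at x) v \<bullet> b) *\<^sub>R frechet_derivative f (at (g x)) b)) (at x)"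
    proof (rule has_derivative_eq_rhs)
      show "((\<lambda>x. f (g x)) has_derivative
          (\<lambda>v. frechet_derivative f (at (g x)) (frechet_derivative g (at x) v))) (at x)"
        by (rule has_derivative_compose[OF Ck_has_derivative[OF Suc.prems(2) x] Ck_has_derivative[OF Suc.prems(1)]])
          (use x assms(3) in blast)
      have "linear (frechet_derivative f (at (g x)))"
        using Ck_has_derivative[OF Suc.prems(1)] x assms(3) has_derivative_linear by blast
      then have "frechet_derivative f (at (g x)) (\<Sum>b\<in>Basis. (u \<bullet> b) *\<^sub>R b)
          = (\<Sum>b\<in>Basis. (u \<bullet> b) *\<^sub>R frechet_derivative f (at (g x)) b)" for u
        by (simp add: linear_sum linear_scale)
      then show "(\<lambda>v. frechet_derivative f (at (g x)) (frechet_derivative g (at x) v)) =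
         (\<lambda>v. \<Sum>b\<in>Basis. (frechet_derivative g (at x) v \<bullet> b) *\<^sub>R frechet_derivative f (at (g x)) b)"
        unfolding euclidean_representation by blast
    qed
  next
    fix v
    show "Ck k U (\<lambda>x. \<Sum>b\<in>Basis. (frechet_derivative g (at x) v \<bullet> b) *\<^sub>R frechet_derivative f (at (g x)) b)"
      by (intro Ck_sum assms(1) Ck_bilinear[OF bounded_bilinear_scaleR] Suc.IH Ck_deriv Suc.prems(1) k
          Ck_linear[OF bounded_linear_inner_left] Suc.prems(2))
  qed
qed

text \<open>For inverse operators N' = - N M' N. Once differentiability is established by an
  estimate, the right-hand side contains \<open>N\<close> itself and first derivatives of
  \<open>M\<close>, so every derivative gained by \<open>N\<close> yields the next one. Operators
  are handled through their values on vectors.\<close>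

lemma Ck_inverse_family:
  fixes M N :: "'a::euclidean_space \<Rightarrow> 'b::euclidean_space \<Rightarrow> 'b"
  assumes V: "open V"
    and linM: "\<And>y. y \<in> V \<Longrightarrow> linear (M y)" and linN: "\<And>y. y \<in> V \<Longrightarrow> linear (N y)"
    and MN: "\<And>y v. y \<in> V \<Longrightarrow> M y (N y v) = v" and NM: "\<And>y v. y \<in> V \<Longrightarrow> N y (M y v) = v"
    and Ck: "\<And>b. Ck k V (\<lambda>y. M y b)"
  shows "Ck k V (\<lambda>y. N y v)"
proof -
  have main: "((\<lambda>y. N y v) has_derivative
      (\<lambda>w. - N y0 (frechet_derivative (\<lambda>y. M y (N y0 v)) (at y0) w))) (at y0)"
    if y0: "y0 \<in> V" and diff: "\<And>b. (\<lambda>y. M y b) differentiable (at y0)" for y0 v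
  proof -
    define n0 where "n0 = N y0 v"
    define h' where "h' = frechet_derivative (\<lambda>y. M y n0) (at y0)"
    have h: "((\<lambda>y. M y n0) has_derivative h') (at y0)"
      using diff frechet_derivative_works unfolding h'_def by blast
    \<comment> \<open>Basis sum in place of an operator norm: it bounds \<open>M y - M y0\<close>
      uniformly on unit vectors and tends to 0.\<close>
    define m where "m y = (\<Sum>b\<in>Basis. norm (M y b - M y0 b))" for y
    have "isCont (\<lambda>y. M y b) y0" for b
      using diff differentiable_imp_continuous_within by blast
    then have "((\<lambda>y. M y b) \<longlongrightarrow> M y0 b) (at y0)" for b by (simp add: isCont_def)
    then have m0: "(m \<longlongrightarrow> 0) (at y0)"
      unfolding m_def by (auto intro!: tendsto_eq_intros)
    have Mdiff: "norm (M y u - M y0 u) \<le> m y * norm u" if y: "y \<in> V" for y u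
    proof -
      have e: "M y u = (\<Sum>b\<in>Basis. (u \<bullet> b) *\<^sub>R M y b)" if "y \<in> V" for y
      proof -
        have "M y (\<Sum>b\<in>Basis. (u \<bullet> b) *\<^sub>R b) = (\<Sum>b\<in>Basis. (u \<bullet> b) *\<^sub>R M y b)"
          by (simp add: linear_sum[OF linM[OF that]] linear_scale[OF linM[OF that]])
        then show ?thesis by (simp add: euclidean_representation)
      qed
      have "norm (M y u - M y0 u) = norm (\<Sum>b\<in>Basis. (u \<bullet> b) *\<^sub>R (M y b - M y0 b))"
        using e[OF y] e[OF y0] by (simp add: scaleR_diff_right sum_subtractf)
      also have "\<dots> \<le> (\<Sum>b\<in>Basis. norm u * norm (M y b - M y0 b))"
        by (intro sum_norm_le) (auto intro!: mult_right_mono Basis_le_norm)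
      finally show ?thesis by (simp add: m_def sum_distrib_left mult.commute)
    qed
    have "inj (M y0)" by (metis NM injI y0)
    then obtain B where B: "B > 0" "\<And>u. B * norm u \<le> norm (M y0 u)"
      using linear_inj_bounded_below_pos[OF linM[OF y0]] by metis
    have bl: "bounded_linear h'" using h has_derivative_bounded_linear by blast
    obtain C1 where C1: "C1 > 0" "\<And>w. norm (h' w) \<le> C1 * norm w"
      using bounded_linear.pos_bounded[OF bl] by (metis mult.commute)
    have blN: "bounded_linear (N y0)" using linN[OF y0] linear_conv_bounded_linear by blast
    obtain C2 where C2: "C2 > 0" "\<And>w. norm (N y0 w) \<le> C2 * norm w"
      using bounded_linear.pos_bounded[OF blN] by (metis mult.commute)
    have evm: "\<forall>\<^sub>F y in at y0. m y < B / 2"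
      using m0 B(1) by (intro order_tendstoD(2)[of m 0]) auto
    have evV: "\<forall>\<^sub>F y in at y0. y \<in> V" using V y0 eventually_at_topological by blast
    \<comment> \<open>Uniform bound on the inverses near \<open>y0\<close>: \<open>M y0\<close>
      stretches vectors by at least \<open>B\<close>, and \<open>M y\<close> differs from it by less
      than \<open>B / 2\<close>.\<close>
    have Nb: "norm (N y w) \<le> 2 / B * norm w" if "m y < B / 2" "y \<in> V" for y w
    proof -
      let ?u = "N y w"
      have "B * norm ?u \<le> norm (M y0 ?u)" by (rule B)
      also have "\<dots> \<le> norm (M y ?u) + norm (M y ?u - M y0 ?u)"
        by (metis norm_triangle_sub norm_minus_commute)
      also have "\<dots> \<le> norm w + B / 2 * norm ?u"
        using Mdiff[OF that(2), of ?u] that(1) MN[OF that(2)]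
        by (smt (verit) mult_right_mono norm_ge_zero)
      finally show ?thesis using B(1) by (simp add: field_simps)
    qed
    let ?e = "\<lambda>y. norm (N y v - N y0 v - - N y0 (h' (y - y0))) / norm (y - y0)"
    have bound: "?e y \<le> 2 / B * (norm (M y n0 - M y0 n0 - h' (y - y0)) / norm (y - y0)) + 2 / B * (m y * (C2 * C1))"
      if my: "m y < B / 2" and y: "y \<in> V" for y
    proof -
      let ?d = "y - y0"
      have lN: "linear (N y)" using linN y by blast
      have e1: "N y v - n0 = - N y (M y n0 - M y0 n0)"
        using MN[OF y0, of v] NM[OF y, of n0] by (simp add: linear_diff[OF lN] n0_def)
      have e2: "N y w - N y0 w = - N y (M y (N y0 w) - M y0 (N y0 w))" for w
        using MN[OF y0, of w] NM[OF y, of "N y0 w"] by (simp add: linear_diff[OF lN])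
      have "N y v - N y0 v - - N y0 (h' ?d)
          = - N y (M y n0 - M y0 n0 - h' ?d) - (N y (h' ?d) - N y0 (h' ?d))"
        using e1 by (simp add: linear_diff[OF lN] n0_def)
      also have "norm \<dots> \<le> norm (N y (M y n0 - M y0 n0 - h' ?d)) + norm (N y (h' ?d) - N y0 (h' ?d))"
        by (metis norm_minus_cancel norm_triangle_ineq4)
      also have "\<dots> \<le> 2 / B * norm (M y n0 - M y0 n0 - h' ?d) + 2 / B * (m y * (C2 * (C1 * norm ?d)))"
      proof (intro add_mono Nb[OF my y])
        have m_nn: "m y \<ge> 0" unfolding m_def by (intro sum_nonneg) auto
        have "norm (N y (h' ?d) - N y0 (h' ?d)) \<le> 2 / B * norm (M y (N y0 (h' ?d)) - M y0 (N y0 (h' ?d)))"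
          unfolding e2 norm_minus_cancel by (rule Nb[OF my y])
        also have "\<dots> \<le> 2 / B * (m y * norm (N y0 (h' ?d)))"
          using Mdiff[OF y] B(1) by (intro mult_left_mono) auto
        also have "\<dots> \<le> 2 / B * (m y * (C2 * (C1 * norm ?d)))"
          using C1(2)[of ?d] C2 B(1) m_nn
          by (intro mult_left_mono) (auto intro: order_trans[OF C2(2)] mult_left_mono)
        finally show "norm (N y (h' ?d) - N y0 (h' ?d)) \<le> 2 / B * (m y * (C2 * (C1 * norm ?d)))" .
      qed
      finally have "norm (N y v - N y0 v - - N y0 (h' ?d)) \<le>
        2 / B * norm (M y n0 - M y0 n0 - h' ?d) + 2 / B * (m y * (C2 * C1)) * norm ?d" by (simp add: mult_ac)
      then show ?thesis
        by (cases "y = y0") (use B(1) m_def in \<open>auto simp: field_simps\<close>)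
    qed
    have "((\<lambda>y. 2 / B * (norm (M y n0 - M y0 n0 - h' (y - y0)) / norm (y - y0)) + 2 / B * (m y * (C2 * C1)))
        \<longlongrightarrow> 2 / B * 0 + 2 / B * (0 * (C2 * C1))) (at y0)"
      using h m0 unfolding has_derivative_iff_norm by (intro tendsto_intros) auto
    moreover have "\<forall>\<^sub>F y in at y0. 0 \<le> ?e y" by simp
    moreover have "\<forall>\<^sub>F y in at y0. ?e y \<le> 2 / B * (norm (M y n0 - M y0 n0 - h' (y - y0)) / norm (y - y0)) + 2 / B * (m y * (C2 * C1))"
      using evm evV by eventually_elim (rule bound)
    ultimately have "(?e \<longlongrightarrow> 0) (at y0)"
      using tendsto_sandwich[of "\<lambda>y. 0" ?e "at y0"] by simp
    then show ?thesis
      unfolding has_derivative_iff_norm n0_def[symmetric] h'_def[symmetric]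
      using bounded_linear_minus[OF bounded_linear_compose[OF blN bl]] by (simp add: n0_def)
  qed
  show ?thesis using Ck
  proof (induction k arbitrary: v)
    case 0
    then show ?case unfolding Ck_0 differentiable_def using main unfolding differentiable_def by blast
  next
    case (Suc k)
    have k: "Ck k V (\<lambda>y. M y b)" for b by (rule Ck_mono, rule Suc.prems, simp)
    let ?D = "\<lambda>b y w. frechet_derivative (\<lambda>y. M y b) (at y) w"
    have eq: "frechet_derivative (\<lambda>y. M y (\<Sum>b\<in>Basis. (u \<bullet> b) *\<^sub>R b)) (at y) w = (\<Sum>b\<in>Basis. (u \<bullet> b) *\<^sub>R ?D b y w)"
      if y: "y \<in> V" for u y w
    proof -
      have "((\<lambda>y. \<Sum>b\<in>Basis. (u \<bullet> b) *\<^sub>R M y b) has_derivative (\<lambda>w. \<Sum>b\<in>Basis. (u \<bullet> b) *\<^sub>R ?D b y w)) (at y)"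
        by (intro has_derivative_sum has_derivative_scaleR_right Ck_has_derivative[OF k y])
      from fun_cong[OF frechet_derivative_at[OF this], of w]
      have "frechet_derivative (\<lambda>y. \<Sum>b\<in>Basis. (u \<bullet> b) *\<^sub>R M y b) (at y) w = (\<Sum>b\<in>Basis. (u \<bullet> b) *\<^sub>R ?D b y w)"
        by simp
      moreover have "frechet_derivative (\<lambda>y. M y (\<Sum>b\<in>Basis. (u \<bullet> b) *\<^sub>R b)) (at y)
          = frechet_derivative (\<lambda>y. \<Sum>b\<in>Basis. (u \<bullet> b) *\<^sub>R M y b) (at y)"
        by (rule frechet_derivative_cong_open[OF V y])
          (simp add: linear_sum[OF linM] linear_scale[OF linM])
      ultimately show ?thesis by simp
    qed
    have eqN: "- N y u = - (\<Sum>c\<in>Basis. (u \<bullet> c) *\<^sub>R N y c)" if "y \<in> V" for y u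
    proof -
      have "N y (\<Sum>c\<in>Basis. (u \<bullet> c) *\<^sub>R c) = (\<Sum>c\<in>Basis. (u \<bullet> c) *\<^sub>R N y c)"
        using that by (simp add: linear_sum[OF linN] linear_scale[OF linN])
      then show ?thesis by (simp add: euclidean_representation)
    qed
    show ?case
    proof (rule Ck_SucI[OF V])
      fix y assume y: "y \<in> V"
      show "((\<lambda>y. N y v) has_derivative (\<lambda>w. - (\<Sum>c\<in>Basis.
            ((\<Sum>b\<in>Basis. (N y v \<bullet> b) *\<^sub>R ?D b y w) \<bullet> c) *\<^sub>R N y c))) (at y)"
        using main[OF y Ck_differentiable[OF k y], of v]
        unfolding eqN[OF y] eq[OF y, of "N y v", unfolded euclidean_representation] .
    next
      fix w
      show "Ck k V (\<lambda>y. - (\<Sum>c\<in>Basis. ((\<Sum>b\<in>Basis. (N y v \<bullet> b) *\<^sub>R ?D b y w) \<bullet> c) *\<^sub>R N y c))"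
        by (intro Ck_linear[OF bounded_linear_minus[OF bounded_linear_ident]] V Ck_sum
            Ck_bilinear[OF bounded_bilinear_scaleR] Ck_linear[OF bounded_linear_inner_left] Suc.IH k Ck_deriv Suc.prems)
    qed
  qed
qed

text \<open>The inverse function theorem gives a differentiable inverse whose derivative at y is the
  inverse of the derivative of \<open>\<phi>\<close> at \<open>\<theta> y\<close>. If
  \<open>\<theta>\<close> is of class \<open>Ck k\<close>, so is this expression by composition and
  inversion, hence \<open>\<theta>\<close> is of class \<open>Ck (Suc k)\<close>.\<close>

theorem smooth_local_inverse:
  fixes \<phi> :: "'a::euclidean_space \<Rightarrow> 'a"
  assumes "open U" "x0 \<in> U" and sm: "smooth_on U \<phi>"
    and inj: "\<And>v. frechet_derivative \<phi> (at x0) v = 0 \<Longrightarrow> v = 0"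
  obtains U' V \<theta> where "open U'" "U' \<subseteq> U" "x0 \<in> U'" "open V" "\<phi> x0 \<in> V"
    "homeomorphism U' V \<phi> \<theta>" "smooth_on V \<theta>"
proof -
  define f' where "f' x = Blinfun (frechet_derivative \<phi> (at x))" for x
  have Ck: "Ck k U \<phi>" for k using sm smooth_on_Ck by blast
  have der: "(\<phi> has_derivative frechet_derivative \<phi> (at x)) (at x)" if "x \<in> U" for x
    using Ck_has_derivative[OF Ck that] .
  have f': "blinfun_apply (f' x) = frechet_derivative \<phi> (at x)" if "x \<in> U" for x
    unfolding f'_def by (rule bounded_linear_Blinfun_apply) (use der[OF that] has_derivative_bounded_linear in blast)
  have cont: "continuous_on U f'"
  proof (rule continuous_on_blinfun_componentwise)
    fix i :: 'a
    have "\<forall>x\<in>U. (\<lambda>x. frechet_derivative \<phi> (at x) i) differentiable (at x)"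
      using Ck_deriv[OF Ck] Ck_differentiable by blast
    then have "continuous_on U (\<lambda>x. frechet_derivative \<phi> (at x) i)"
      by (meson continuous_at_imp_continuous_on differentiable_imp_continuous_within)
    then show "continuous_on U (\<lambda>x. blinfun_apply (f' x) i)"
      by (rule continuous_on_cong[THEN iffD1, rotated -1]) (auto simp: f')
  qed
  have lin: "linear (frechet_derivative \<phi> (at x0))"
    using der[OF assms(2)] has_derivative_linear by blast
  have "inj (frechet_derivative \<phi> (at x0))"
    using inj linear_injective_0[OF lin] by blast
  then obtain g where g: "linear g" "g \<circ> frechet_derivative \<phi> (at x0) = id"
    using linear_injective_left_inverse[OF lin] by blast
  have "Blinfun g o\<^sub>L f' x0 = id_blinfun"
    using g by (intro blinfun_eqI)
      (simp add: f' assms(2) bounded_linear_Blinfun_apply linear_conv_bounded_linear o_def id_def fun_eq_iff)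
  from inverse_function_theorem[OF assms(1) _ cont assms(2) this] der f'
  obtain U' V \<theta> g' where *: "open U'" "U' \<subseteq> U" "x0 \<in> U'" "open V" "\<phi> x0 \<in> V" "homeomorphism U' V \<phi> \<theta>"
    "\<And>y. y \<in> V \<Longrightarrow> (\<theta> has_derivative (g' y)) (at y)"
    "\<And>y. y \<in> V \<Longrightarrow> g' y = inv (blinfun_apply (f'(\<theta> y)))"
    "\<And>y. y \<in> V \<Longrightarrow> bij (blinfun_apply (f'(\<theta> y)))"
    by metis
  have thU: "\<theta> y \<in> U" if "y \<in> V" for y
    using that *(2,6) unfolding homeomorphism_def by blast
  have "Ck k V \<theta>" for k
  proof (induction k)
    case 0 then show ?case using *(7) unfolding Ck_0 differentiable_def by blast
  next
    case (Suc k)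
    show ?case
    proof (rule Ck_SucI[OF *(4) *(7)])
      fix v
      have b: "bij (frechet_derivative \<phi> (at (\<theta> y)))" "g' y = inv (frechet_derivative \<phi> (at (\<theta> y)))"
        if "y \<in> V" for y using *(8,9)[OF that] f'[OF thU[OF that]] by auto
      show "Ck k V (\<lambda>y. g' y v)"
      proof (rule Ck_inverse_family[where M = "\<lambda>y. frechet_derivative \<phi> (at (\<theta> y))"])
        show "Ck k V (\<lambda>y. frechet_derivative \<phi> (at (\<theta> y)) b)" for b
          by (rule Ck_compose[OF *(4) assms(1) _ Ck_deriv[OF Ck] Suc]) (use thU in blast)
        show "linear (frechet_derivative \<phi> (at (\<theta> y)))" if "y \<in> V" for y
          using der[OF thU[OF that]] has_derivative_linear by blast
        show "linear (g' y)" if "y \<in> V" for y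
          using *(7)[OF that] has_derivative_linear by blast
      qed (use b *(4) in \<open>auto simp: bij_is_surj bij_is_inj surj_f_inv_f\<close>)
    qed
  qed
  then show ?thesis using * that smooth_on_Ck by blast
qed

text \<open>Smoothness of the germ at a point: the neighbourhood stays unnamed, so that sums,
  products and composites need no bookkeeping of domains.\<close>

definition smooth_near :: "('a::euclidean_space \<Rightarrow> 'b::euclidean_space) \<Rightarrow> 'a \<Rightarrow> bool" where
  "smooth_near f x \<longleftrightarrow> (\<exists>U. open U \<and> x \<in> U \<and> smooth_on U f)"

lemma smooth_near_Ck: "smooth_near f x \<longleftrightarrow> (\<exists>U. open U \<and> x \<in> U \<and> (\<forall>k. Ck k U f))"
  unfolding smooth_near_def smooth_on_Ck by blast

lemma smooth_near_obtain2:
  assumes "smooth_near f x" "smooth_near g x"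
  obtains U where "open U" "x \<in> U" "\<And>k. Ck k U f" "\<And>k. Ck k U g"
proof -
  obtain U V where "open U" "x \<in> U" "\<And>k. Ck k U f" "open V" "x \<in> V" "\<And>k. Ck k V g"
    using assms unfolding smooth_near_Ck by blast
  then show ?thesis using that[of "U \<inter> V"] by (auto intro: Ck_subset)
qed

lemma smooth_on_imp_near: "open U \<Longrightarrow> smooth_on U f \<Longrightarrow> x \<in> U \<Longrightarrow> smooth_near f x"
  unfolding smooth_near_def by blast

lemma smooth_near_eventually: "smooth_near f x \<Longrightarrow> \<forall>\<^sub>F y in nhds x. smooth_near f y"
  unfolding smooth_near_def eventually_nhds by blast

lemma smooth_near_const: "smooth_near (\<lambda>x. c) x"
  unfolding smooth_near_Ck using Ck_const[of UNIV] by blast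

lemma smooth_near_linear: "bounded_linear L \<Longrightarrow> smooth_near f x \<Longrightarrow> smooth_near (\<lambda>x. L (f x)) x"
  unfolding smooth_near_Ck using Ck_linear by blast

lemma smooth_near_bilinear:
  "bounded_bilinear B \<Longrightarrow> smooth_near f x \<Longrightarrow> smooth_near g x \<Longrightarrow> smooth_near (\<lambda>x. B (f x) (g x)) x"
  by (erule (1) smooth_near_obtain2) (auto simp: smooth_near_Ck intro!: exI intro: Ck_bilinear)

lemma smooth_near_add: "smooth_near f x \<Longrightarrow> smooth_near g x \<Longrightarrow> smooth_near (\<lambda>x. f x + g x) x"
  by (erule (1) smooth_near_obtain2) (auto simp: smooth_near_Ck intro!: exI intro: Ck_add)

lemma smooth_near_ident: "smooth_near (\<lambda>x. x) x"
proof -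
  have "Ck k UNIV (\<lambda>x::'a. x)" for k
  proof (cases k)
    case 0 then show ?thesis by (simp add: Ck_0)
  next
    case (Suc j)
    show ?thesis unfolding Suc
      by (rule Ck_SucI[where D = "\<lambda>x v. v"]) (auto intro: Ck_const)
  qed
  then show ?thesis unfolding smooth_near_Ck by blast
qed

lemma smooth_near_minus: "smooth_near f x \<Longrightarrow> smooth_near (\<lambda>x. - f x) x"
  by (rule smooth_near_linear[OF bounded_linear_minus[OF bounded_linear_ident]])

lemma smooth_near_diff: "smooth_near f x \<Longrightarrow> smooth_near g x \<Longrightarrow> smooth_near (\<lambda>x. f x - g x) x"
  using smooth_near_add[OF _ smooth_near_minus] by fastforce

lemma smooth_near_mult:
  fixes f g :: "'a::euclidean_space \<Rightarrow> real"
  shows "smooth_near f x \<Longrightarrow> smooth_near g x \<Longrightarrow> smooth_near (\<lambda>x. f x * g x) x"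
  by (rule smooth_near_bilinear[OF bounded_bilinear_mult])

lemma smooth_near_scaleR:
  "smooth_near f x \<Longrightarrow> smooth_near g x \<Longrightarrow> smooth_near (\<lambda>x. f x *\<^sub>R g x) x"
  by (rule smooth_near_bilinear[OF bounded_bilinear_scaleR])

lemma smooth_near_sum: "(\<And>i. i \<in> I \<Longrightarrow> smooth_near (f i) x) \<Longrightarrow> smooth_near (\<lambda>x. \<Sum>i\<in>I. f i x) x"
  by (induction I rule: infinite_finite_induct) (auto intro: smooth_near_const smooth_near_add)

lemma smooth_near_power:
  fixes f :: "'a::euclidean_space \<Rightarrow> real"
  shows "smooth_near f x \<Longrightarrow> smooth_near (\<lambda>x. f x ^ n) x"
  by (induction n) (auto intro: smooth_near_const smooth_near_mult)

lemma smooth_near_fst: "smooth_near f x \<Longrightarrow> smooth_near (\<lambda>x. fst (f x)) x"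
  by (rule smooth_near_linear[OF bounded_linear_fst])

lemma smooth_near_snd: "smooth_near f x \<Longrightarrow> smooth_near (\<lambda>x. snd (f x)) x"
  by (rule smooth_near_linear[OF bounded_linear_snd])

lemma smooth_near_Pair:
  assumes "smooth_near f x" "smooth_near g x" shows "smooth_near (\<lambda>x. (f x, g x)) x"
proof -
  have "bounded_linear (\<lambda>a. (a, 0))" "bounded_linear (\<lambda>b. (0, b))"
    using bounded_linear_Pair[OF bounded_linear_ident bounded_linear_zero]
      bounded_linear_Pair[OF bounded_linear_zero bounded_linear_ident] by auto
  from smooth_near_add[OF smooth_near_linear[OF this(1) assms(1)] smooth_near_linear[OF this(2) assms(2)]]
  show ?thesis by simp
qed

lemma smooth_near_vec_nth: "smooth_near f x \<Longrightarrow> smooth_near (\<lambda>x. f x $ i) x"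
  by (rule smooth_near_linear[OF bounded_linear_vec_nth])

lemma smooth_near_vec_lambda:
  fixes f :: "'i::finite \<Rightarrow> 'a::euclidean_space \<Rightarrow> 'b::euclidean_space"
  assumes "\<And>i. smooth_near (f i) x" shows "smooth_near (\<lambda>x. \<chi> i. f i x) x"
proof -
  have bl: "bounded_linear (\<lambda>c::'b. \<chi> j. if j = i then c else 0)" for i :: 'i
    unfolding linear_conv_bounded_linear[symmetric] by (rule linearI) (auto simp: vec_eq_iff)
  have "smooth_near (\<lambda>x. \<Sum>i\<in>UNIV. (\<chi> j. if j = i then f i x else 0)) x"
    by (intro smooth_near_sum smooth_near_linear[OF bl] assms)
  moreover have "(\<Sum>i\<in>UNIV. (\<chi> j. if j = i then f i y else 0)) = (\<chi> i. f i y)" for y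
    by (simp add: vec_eq_iff)
  ultimately show ?thesis by simp
qed

lemma smooth_near_differentiable: "smooth_near f x \<Longrightarrow> f differentiable (at x)"
  unfolding smooth_near_Ck using Ck_differentiable by blast

lemma smooth_near_has_derivative:
  "smooth_near f x \<Longrightarrow> (f has_derivative frechet_derivative f (at x)) (at x)"
  using smooth_near_differentiable frechet_derivative_works by blast

lemma smooth_near_isCont: "smooth_near f x \<Longrightarrow> isCont f x"
  using smooth_near_differentiable differentiable_imp_continuous_within by blast

lemma smooth_near_deriv: "smooth_near f x \<Longrightarrow> smooth_near (\<lambda>x. frechet_derivative f (at x) v) x"
  unfolding smooth_near_Ck using Ck_deriv by blast

lemma smooth_near_iter_deriv: "smooth_near f x \<Longrightarrow> smooth_near (iter_deriv vs f) x"
  by (induction vs) (auto intro: smooth_near_deriv)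

lemma smooth_near_compose:
  assumes "smooth_near f (g x)" "smooth_near g x" shows "smooth_near (\<lambda>x. f (g x)) x"
proof -
  obtain V U where V: "open V" "g x \<in> V" "\<And>k. Ck k V f" and U: "open U" "x \<in> U" "\<And>k. Ck k U g"
    using assms unfolding smooth_near_Ck by blast
  have "continuous_on U g"
    using Ck_differentiable[OF U(3)] continuous_at_imp_continuous_on differentiable_imp_continuous_within by metis
  then have o: "open (g -` V \<inter> U)" using V U continuous_on_open_vimage by metis
  have "Ck k (g -` V \<inter> U) (\<lambda>x. f (g x))" for k
    by (rule Ck_compose[OF o V(1) _ V(3)]) (use U in \<open>auto intro: Ck_subset\<close>)
  then show ?thesis unfolding smooth_near_Ck using o U V by blast
qed

text \<open>All exponents are treated together in the induction, because differentiation lowers the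
  exponent by 1.\<close>

lemma smooth_near_powr:
  fixes f :: "'a::euclidean_space \<Rightarrow> real"
  assumes "smooth_near f x" "f x > 0" shows "smooth_near (\<lambda>x. f x powr a) x"
proof -
  have "Ck k {0<..} (\<lambda>x::real. x powr a)" for k a
  proof (induction k arbitrary: a)
    case 0
    have "((\<lambda>x. x powr a) has_real_derivative a * x powr (a - 1)) (at x)" if "x > 0" for x
      using that has_real_derivative_powr by blast
    then show ?case unfolding Ck_0 using has_field_derivative_imp_has_derivative differentiable_def by blast
  next
    case (Suc k)
    show ?case
    proof (rule Ck_SucI)
      show "((\<lambda>x. x powr a) has_derivative (\<lambda>v. (a * x powr (a - 1)) * v)) (at x)" if "x \<in> {0<..}" for x
        using has_real_derivative_powr[of x a] that unfolding has_field_derivative_def by simp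
      show "Ck k {0<..} (\<lambda>x. a * x powr (a - 1) * v)" for v
        using Ck_linear[OF bounded_linear_mult_right[of "a * v"] _ Suc[of "a - 1"]] by (simp add: mult_ac)
    qed simp
  qed
  then have "smooth_near (\<lambda>x. x powr a) (f x)"
    unfolding smooth_near_Ck using assms(2) by (intro exI[of _ "{0<..}"]) auto
  from smooth_near_compose[OF this assms(1)] show ?thesis .
qed

lemmas smooth_intros = smooth_near_const smooth_near_add smooth_near_ident smooth_near_minus smooth_near_diff
  smooth_near_mult smooth_near_scaleR smooth_near_sum smooth_near_power smooth_near_fst smooth_near_snd
  smooth_near_Pair smooth_near_vec_nth smooth_near_vec_lambda

text \<open>Compactness of the parameter interval provides one neighbourhood of \<open>x0\<close>
  that works for all t. There the derivative of the integral is the integral of the partial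
  derivative, which has the same form, so the induction on the order runs over all integrands at
  once.\<close>

lemma smooth_near_integral:
  fixes G :: "'a::euclidean_space \<times> real \<Rightarrow> 'b::euclidean_space"
  assumes "\<And>t. t \<in> {0..1} \<Longrightarrow> smooth_near G (x0, t)"
  shows "smooth_near (\<lambda>x. integral {0..1} (\<lambda>t. G (x, t))) x0"
proof -
  define W where "W = \<Union>{U. open U \<and> smooth_on U G}"
  have W: "open W" "{x0} \<times> {0..1} \<subseteq> W"
    using assms unfolding W_def smooth_near_def by blast+
  obtain U where U: "x0 \<in> U" "open U" "U \<times> {0..1} \<subseteq> W"
  proof -
    let ?W = "({0..1} \<times> UNIV) \<inter> prod.swap -` W"
    have "open (prod.swap -` W)" by (intro open_vimage W continuous_on_swap)
    then have "openin (top_of_set ({0..1} \<times> UNIV)) ?W" by (rule openin_open_Int)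
    moreover have "(\<lambda>t. (t, x0)) ` {0..1} \<subseteq> ?W" using W(2) by auto
    moreover have "{0..1::real} \<noteq> {}" by simp
    ultimately obtain V where "openin (top_of_set UNIV) V" "x0 \<in> V" "{0..1} \<times> V \<subseteq> ?W"
      using tube_lemma[OF compact_Icc] by metis
    moreover from this(3) have "V \<times> {0..1} \<subseteq> W" by (fastforce dest: subsetD)
    ultimately show ?thesis using that[of V] by auto
  qed
  have CkW: "Ck k W G" for k
    unfolding W_def Ck_def smooth_on_def by blast
  have main: "((\<lambda>x. integral {0..1} (\<lambda>t. H (x, t))) has_derivative
        (\<lambda>v. integral {0..1} (\<lambda>t. frechet_derivative H (at (x, t)) (v, 0)))) (at x)"
    if H: "\<And>k. Ck k W H" and x: "x \<in> U" for x and H :: "'a \<times> real \<Rightarrow> 'b"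
  proof -
    obtain e where e: "e > 0" "ball x e \<subseteq> U" using U x openE by blast
    have sub: "ball x e \<times> {0..1} \<subseteq> W" using e U by blast
    define h' where "h' y t = Blinfun (\<lambda>v. frechet_derivative H (at (y, t)) (v, 0))" for y t
    have bl: "blinfun_apply (h' y t) = (\<lambda>v. frechet_derivative H (at (y, t)) (v, 0))"
      if "y \<in> U" "t \<in> {0..1}" for y t
    proof -
      have "bounded_linear (frechet_derivative H (at (y, t)))"
        using Ck_has_derivative[OF H] that U has_derivative_bounded_linear by blast
      then have "bounded_linear (\<lambda>v. frechet_derivative H (at (y, t)) (v, 0))"
        using bounded_linear_compose bounded_linear_Pair[OF bounded_linear_ident bounded_linear_zero] by blast
      then show ?thesis unfolding h'_def by (rule bounded_linear_Blinfun_apply)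
    qed
    have contH: "continuous_on W H'" if "\<And>k. Ck k W H'" for H' :: "'a \<times> real \<Rightarrow> 'b"
      using Ck_differentiable[OF that] continuous_at_imp_continuous_on differentiable_imp_continuous_within by metis
    have cont: "continuous_on (ball x e \<times> cbox 0 1) (\<lambda>(y, t). h' y t)"
    proof (rule continuous_on_blinfun_componentwise)
      fix i :: 'a
      have "continuous_on (ball x e \<times> {0..1}) (\<lambda>p. frechet_derivative H (at p) (i, 0))"
        by (rule continuous_on_subset[OF contH[OF Ck_deriv[OF H]]]) (use U e in auto)
      then show "continuous_on (ball x e \<times> cbox 0 1) (\<lambda>p. blinfun_apply (case p of (y, t) \<Rightarrow> h' y t) i)"
        by (rule continuous_on_cong[THEN iffD1, rotated -1]) (use bl e in auto)
    qed
    have xb: "x \<in> ball x e" using e by simp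
    have hd: "((\<lambda>y. H (y, t)) has_derivative blinfun_apply (h' y t)) (at y within ball x e)"
      if "y \<in> ball x e" "t \<in> cbox 0 1" for y t
    proof -
      have "(y, t) \<in> ball x e \<times> {0..1}" using that by simp
      then have yt: "(y, t) \<in> W" "y \<in> U" using sub e by blast+
      have "((\<lambda>y. (y, t)) has_derivative (\<lambda>v. (v, 0))) (at y)"
        by (auto intro!: derivative_eq_intros)
      from has_derivative_compose[OF this Ck_has_derivative[OF H yt(1)]]
      show ?thesis using bl[OF yt(2)] that has_derivative_at_withinI by (metis box_real(2))
    qed
    have int: "(\<lambda>t. H (y, t)) integrable_on cbox 0 1" if "y \<in> ball x e" for y
    proof (rule integrable_continuous)
      show "continuous_on (cbox 0 1) (\<lambda>t. H (y, t))"
        by (rule continuous_on_compose2[OF contH[OF H]]) (use that sub in \<open>auto intro!: continuous_intros subsetD[OF sub]\<close>)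
    qed
    from leibniz_rule[OF hd int cont xb convex_ball]
    have 1: "((\<lambda>x. integral (cbox 0 1) (\<lambda>t. H (x, t))) has_derivative blinfun_apply (integral (cbox 0 1) (h' x))) (at x)"
      using at_within_open[OF xb open_ball] by simp
    have cp: "continuous_on (cbox 0 1) (\<lambda>t::real. (x, t))" by (intro continuous_intros)
    have "(\<lambda>t. (x, t)) ` cbox 0 1 \<subseteq> ball x e \<times> cbox 0 1" using xb by blast
    from continuous_on_compose2[OF cont cp this] have "continuous_on (cbox 0 1) (h' x)" by simp
    then have i: "h' x integrable_on cbox 0 1" by (rule integrable_continuous)
    have "blinfun_apply (integral (cbox 0 1) (h' x)) v = integral {0..1} (\<lambda>t. frechet_derivative H (at (x, t)) (v, 0))" for v
      unfolding blinfun_apply_integral[OF i] using bl[OF x] by (auto intro!: integral_cong)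
    then have "blinfun_apply (integral (cbox 0 1) (h' x)) = (\<lambda>v. integral {0..1} (\<lambda>t. frechet_derivative H (at (x, t)) (v, 0)))"
      by blast
    with 1 show ?thesis by simp
  qed
  have "Ck k U (\<lambda>x. integral {0..1} (\<lambda>t. H (x, t)))" if "\<And>k. Ck k W H" for k and H :: "'a \<times> real \<Rightarrow> 'b"
    using that
  proof (induction k arbitrary: H)
    case 0
    then show ?case unfolding Ck_0 differentiable_def using main by blast
  next
    case (Suc k)
    show ?case
      by (rule Ck_SucI[OF U(2) main[OF Suc.prems] Suc.IH[OF Ck_deriv[OF Suc.prems]]])
  qed
  then show ?thesis unfolding smooth_near_Ck using U CkW by blast
qed

section \<open>Taylor expansion along lines and symmetry of second derivatives\<close>

lemma has_derivative_along_line: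
  fixes F :: "'a::real_normed_vector \<Rightarrow> real"
  assumes "F differentiable (at (b + t *\<^sub>R v))"
  shows "((\<lambda>t. F (b + t *\<^sub>R v)) has_real_derivative frechet_derivative F (at (b + t *\<^sub>R v)) v) (at t)"
proof -
  have F: "(F has_derivative frechet_derivative F (at (b + t *\<^sub>R v))) (at (b + t *\<^sub>R v))"
    using assms frechet_derivative_works by blast
  have "((\<lambda>t. b + t *\<^sub>R v) has_derivative (\<lambda>s. s *\<^sub>R v)) (at t)"
    by (auto intro!: derivative_eq_intros)
  from has_derivative_compose[OF this F]
  have "((\<lambda>t. F (b + t *\<^sub>R v)) has_derivative (\<lambda>s. frechet_derivative F (at (b + t *\<^sub>R v)) (s *\<^sub>R v))) (at t)" .
  moreover have "(\<lambda>s. frechet_derivative F (at (b + t *\<^sub>R v)) (s *\<^sub>R v)) = (*) (frechet_derivative F (at (b + t *\<^sub>R v)) v)"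
    using linear_scale[OF has_derivative_linear[OF F]] by (auto simp: fun_eq_iff)
  ultimately show ?thesis unfolding has_field_derivative_def by simp
qed

lemma directional_taylor:
  fixes F :: "'a::euclidean_space \<Rightarrow> real"
  assumes "\<And>s. \<bar>s\<bar> \<le> \<bar>t\<bar> \<Longrightarrow> smooth_near F (b + s *\<^sub>R v)"
  obtains s where "\<bar>s\<bar> \<le> \<bar>t\<bar>" "F (b + t *\<^sub>R v) =
    (\<Sum>r<R. iter_deriv (replicate r v) F b / fact r * t ^ r) + iter_deriv (replicate R v) F (b + s *\<^sub>R v) / fact R * t ^ R"
proof -
  have "\<forall>m s. m < R \<and> \<bar>s\<bar> \<le> \<bar>t\<bar> \<longrightarrow> ((\<lambda>s. iter_deriv (replicate m v) F (b + s *\<^sub>R v)) has_real_derivative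
      iter_deriv (replicate (Suc m) v) F (b + s *\<^sub>R v)) (at s)"
    using has_derivative_along_line[OF smooth_near_differentiable[OF smooth_near_iter_deriv[OF assms]]] by simp
  from Maclaurin_bi_le[where diff = "\<lambda>m s. iter_deriv (replicate m v) F (b + s *\<^sub>R v)" and f = "\<lambda>s. F (b + s *\<^sub>R v)", OF _ this]
  show ?thesis using that by auto
qed

text \<open>Mean value theorem applied twice, in direction \<open>v\<close> and then in direction
  \<open>w\<close>. The second difference is symmetric in the two directions while the derivative on
  the right is not visibly so, which is what yields the symmetry of second derivatives.\<close>

lemma double_difference:
  fixes f :: "'a::euclidean_space \<Rightarrow> real"
  assumes sm: "\<And>y. norm (y - x) \<le> s * (norm v + norm w) \<Longrightarrow> smooth_near f y" and s: "s > 0"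
  obtains y where "norm (y - x) \<le> s * (norm v + norm w)"
    "f (x + s *\<^sub>R v + s *\<^sub>R w) - f (x + s *\<^sub>R v) - f (x + s *\<^sub>R w) + f x = s\<^sup>2 * iter_deriv [w, v] f y"
proof -
  have near: "norm ((x + a *\<^sub>R v + b *\<^sub>R w) - x) \<le> s * (norm v + norm w)"
    if "0 \<le> a" "a \<le> s" "0 \<le> b" "b \<le> s" for a b
  proof -
    have "norm (a *\<^sub>R v + b *\<^sub>R w) \<le> a * norm v + b * norm w"
      using that norm_triangle_ineq[of "a *\<^sub>R v" "b *\<^sub>R w"] by simp
    also have "\<dots> \<le> s * norm v + s * norm w" using that by (intro add_mono mult_right_mono) auto
    finally show ?thesis by (simp add: distrib_left add.assoc)
  qed
  have "\<exists>a>0. a < s \<and> (f (x + s *\<^sub>R w + s *\<^sub>R v) - f (x + s *\<^sub>R v)) - (f (x + s *\<^sub>R w + 0 *\<^sub>R v) - f (x + 0 *\<^sub>R v))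
      = (s - 0) * (iter_deriv [v] f (x + s *\<^sub>R w + a *\<^sub>R v) - iter_deriv [v] f (x + a *\<^sub>R v))"
  proof (rule MVT2[OF s])
    fix a assume "0 \<le> a" "a \<le> s"
    then have "f differentiable (at (x + s *\<^sub>R w + a *\<^sub>R v))" "f differentiable (at (x + a *\<^sub>R v))"
      using sm[OF near[of a s]] sm[OF near[of a 0]] s
      by (auto intro!: smooth_near_differentiable simp: add_ac)
    from has_derivative_along_line[OF this(1)] has_derivative_along_line[OF this(2)]
    show "((\<lambda>a. f (x + s *\<^sub>R w + a *\<^sub>R v) - f (x + a *\<^sub>R v)) has_real_derivative
        iter_deriv [v] f (x + s *\<^sub>R w + a *\<^sub>R v) - iter_deriv [v] f (x + a *\<^sub>R v)) (at a)"
      by (auto intro!: derivative_eq_intros)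
  qed
  then obtain a where a: "0 < a" "a < s"
    "f (x + s *\<^sub>R v + s *\<^sub>R w) - f (x + s *\<^sub>R v) - f (x + s *\<^sub>R w) + f x
      = s * (iter_deriv [v] f (x + a *\<^sub>R v + s *\<^sub>R w) - iter_deriv [v] f (x + a *\<^sub>R v))"
    by (auto simp: add_ac)
  have "\<exists>b>0. b < s \<and> iter_deriv [v] f (x + a *\<^sub>R v + s *\<^sub>R w) - iter_deriv [v] f (x + a *\<^sub>R v + 0 *\<^sub>R w)
      = (s - 0) * (iter_deriv [w, v] f (x + a *\<^sub>R v + b *\<^sub>R w))"
  proof (rule MVT2[OF s])
    fix b assume "0 \<le> b" "b \<le> s"
    then have "iter_deriv [v] f differentiable (at (x + a *\<^sub>R v + b *\<^sub>R w))"
      using sm[OF near[of a b]] a by (intro smooth_near_differentiable smooth_near_iter_deriv) auto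
    from has_derivative_along_line[OF this]
    show "((\<lambda>b. iter_deriv [v] f (x + a *\<^sub>R v + b *\<^sub>R w)) has_real_derivative
        iter_deriv [w, v] f (x + a *\<^sub>R v + b *\<^sub>R w)) (at b)" by simp
  qed
  then obtain b where "0 < b" "b < s"
    "iter_deriv [v] f (x + a *\<^sub>R v + s *\<^sub>R w) - iter_deriv [v] f (x + a *\<^sub>R v) = s * iter_deriv [w, v] f (x + a *\<^sub>R v + b *\<^sub>R w)"
    by auto
  then show ?thesis
    using that[of "x + a *\<^sub>R v + b *\<^sub>R w"] near[of a b] a by (auto simp: power2_eq_square)
qed

lemma iter_deriv_swap2:
  fixes f :: "'a::euclidean_space \<Rightarrow> real"
  assumes "smooth_near f x" shows "iter_deriv [v, w] f x = iter_deriv [w, v] f x"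
proof (rule ccontr)
  let ?P = "iter_deriv [v, w] f" and ?Q = "iter_deriv [w, v] f"
  assume ne: "?P x \<noteq> ?Q x"
  define e where "e = \<bar>?P x - ?Q x\<bar> / 2"
  have e: "e > 0" using ne by (simp add: e_def)
  have "\<forall>\<^sub>F y in nhds x. dist (iter_deriv vs f y) (iter_deriv vs f x) < e" for vs
    using smooth_near_isCont[OF smooth_near_iter_deriv[OF assms]] e
    unfolding continuous_at_eps_delta eventually_nhds_metric by blast
  then have "\<forall>\<^sub>F y in nhds x. dist (?P y) (?P x) < e \<and> dist (?Q y) (?Q x) < e \<and> smooth_near f y"
    using smooth_near_eventually[OF assms] by (intro eventually_conj)
  then obtain d where d: "d > 0" "\<And>y. dist y x < d \<Longrightarrow> dist (?P y) (?P x) < e \<and> dist (?Q y) (?Q x) < e \<and> smooth_near f y"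
    unfolding eventually_nhds_metric by blast
  \<comment> \<open>Small enough for the parallelogram spanned by \<open>s *\<^sub>R v\<close> and
    \<open>s *\<^sub>R w\<close> to stay in the ball of radius \<open>d\<close>.\<close>
  define s where "s = d / (2 * (norm v + norm w + 1))"
  have s: "s > 0" using d by (simp add: s_def add_nonneg_pos)
  have "s * (norm v + norm w) < s * (2 * (norm v + norm w + 1))"
    using s by (intro mult_strict_left_mono) (auto simp: add_nonneg_pos)
  also have "\<dots> = d"
  proof -
    have "norm v + norm w + 1 > 0" by (simp add: add_nonneg_pos)
    then show ?thesis unfolding s_def by simp
  qed
  finally have sd: "s * (norm v + norm w) < d" .
  obtain y where y: "norm (y - x) \<le> s * (norm v + norm w)"
    "f (x + s *\<^sub>R v + s *\<^sub>R w) - f (x + s *\<^sub>R v) - f (x + s *\<^sub>R w) + f x = s\<^sup>2 * ?Q y"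
    by (rule double_difference[of x s v w f]) (use d(2) sd s in \<open>auto simp: dist_norm\<close>)
  obtain z where z: "norm (z - x) \<le> s * (norm w + norm v)"
    "f (x + s *\<^sub>R w + s *\<^sub>R v) - f (x + s *\<^sub>R w) - f (x + s *\<^sub>R v) + f x = s\<^sup>2 * ?P z"
    by (rule double_difference[of x s w v f]) (use d(2) sd s in \<open>auto simp: dist_norm add.commute\<close>)
  have "s\<^sup>2 * ?Q y = s\<^sup>2 * ?P z" using y(2) z(2) by (simp add: algebra_simps)
  then have "?Q y = ?P z" using s by simp
  moreover have "dist (?Q y) (?Q x) < e" "dist (?P z) (?P x) < e"
    using d(2)[of y] d(2)[of z] y z sd by (auto simp: dist_norm add.commute)
  ultimately have "\<bar>?P x - ?Q x\<bar> < 2 * e" unfolding dist_real_def by argo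
  then show False unfolding e_def by simp
qed

lemma iter_deriv_swap:
  fixes f :: "'a::euclidean_space \<Rightarrow> real"
  assumes "smooth_near f x" shows "iter_deriv (us @ v # w # vs) f x = iter_deriv (us @ w # v # vs) f x"
proof -
  obtain U where U: "open U" "x \<in> U" "\<And>y. y \<in> U \<Longrightarrow> smooth_near f y"
    using smooth_near_eventually[OF assms] unfolding eventually_nhds by blast
  have "iter_deriv [v, w] (iter_deriv vs f) y = iter_deriv [w, v] (iter_deriv vs f) y" if "y \<in> U" for y
    by (rule iter_deriv_swap2[OF smooth_near_iter_deriv[OF U(3)[OF that]]])
  from iter_deriv_cong[OF U(1) this U(2), where vs = us]
  show ?thesis by (simp add: iter_deriv_append)
qed

section \<open>Rational polynomials and the polar curve\<close>

inductive_set ratpoly :: "'v set \<Rightarrow> (('v \<Rightarrow> real) \<Rightarrow> real) set" for V where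
  const: "(\<lambda>\<rho>. of_rat c) \<in> ratpoly V"
| var: "v \<in> V \<Longrightarrow> (\<lambda>\<rho>. \<rho> v) \<in> ratpoly V"
| add: "F \<in> ratpoly V \<Longrightarrow> F' \<in> ratpoly V \<Longrightarrow> (\<lambda>\<rho>. F \<rho> + F' \<rho>) \<in> ratpoly V"
| mult: "F \<in> ratpoly V \<Longrightarrow> F' \<in> ratpoly V \<Longrightarrow> (\<lambda>\<rho>. F \<rho> * F' \<rho>) \<in> ratpoly V"

lemma ratpoly_mono: "F \<in> ratpoly V \<Longrightarrow> V \<subseteq> W \<Longrightarrow> F \<in> ratpoly W"
  by (induction rule: ratpoly.induct) (auto intro: ratpoly.intros)

lemma ratpoly_0: "(\<lambda>\<rho>. 0) \<in> ratpoly V" and ratpoly_1: "(\<lambda>\<rho>. 1) \<in> ratpoly V"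
  using ratpoly.const[of 0 V] ratpoly.const[of 1 V] by simp_all

lemma ratpoly_minus: "F \<in> ratpoly V \<Longrightarrow> (\<lambda>\<rho>. - F \<rho>) \<in> ratpoly V"
  using ratpoly.mult[OF ratpoly.const[of "-1" V]] by fastforce

lemma ratpoly_diff: "F \<in> ratpoly V \<Longrightarrow> F' \<in> ratpoly V \<Longrightarrow> (\<lambda>\<rho>. F \<rho> - F' \<rho>) \<in> ratpoly V"
  using ratpoly.add[OF _ ratpoly_minus] by fastforce

lemma ratpoly_sum: "(\<And>i. i \<in> I \<Longrightarrow> F i \<in> ratpoly V) \<Longrightarrow> (\<lambda>\<rho>. \<Sum>i\<in>I. F i \<rho>) \<in> ratpoly V"
  by (induction I rule: infinite_finite_induct) (auto intro: ratpoly.intros ratpoly_0)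

lemma ratpoly_fact: "(\<lambda>\<rho>. fact n) \<in> ratpoly V" "(\<lambda>\<rho>. 1 / fact n) \<in> ratpoly V" "(\<lambda>\<rho>. 1 / 2) \<in> ratpoly V"
proof -
  have f: "of_rat (fact n) = (fact n :: real)" by (metis of_nat_fact of_rat_of_nat_eq)
  show "(\<lambda>\<rho>. fact n) \<in> ratpoly V" "(\<lambda>\<rho>. 1 / fact n) \<in> ratpoly V" "(\<lambda>\<rho>. 1 / 2) \<in> ratpoly V"
    using ratpoly.const[of "fact n" V] ratpoly.const[of "1 / fact n" V] ratpoly.const[of "1/2" V]
    by (simp_all only: f of_rat_divide of_rat_1 of_rat_numeral_eq)
qed

section \<open>Evaluation of polynomials given as coefficient maps\<close>

abbreviation monom_eval :: "('v \<Rightarrow> real) \<Rightarrow> ('v \<Rightarrow>\<^sub>0 nat) \<Rightarrow> real" where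
  "monom_eval \<rho> m \<equiv> \<Prod>v\<in>Poly_Mapping.keys m. \<rho> v ^ Poly_Mapping.lookup m v"

lemma monom_eval_superset:
  assumes "finite S" "Poly_Mapping.keys m \<subseteq> S"
  shows "monom_eval \<rho> m = (\<Prod>v\<in>S. \<rho> v ^ Poly_Mapping.lookup m v)"
  by (rule prod.mono_neutral_left) (use assms in \<open>auto simp: in_keys_iff\<close>)

lemma monom_eval_add: "monom_eval \<rho> (m + n) = monom_eval \<rho> m * monom_eval \<rho> n"
proof -
  let ?S = "Poly_Mapping.keys m \<union> Poly_Mapping.keys n"
  have S: "finite ?S" "Poly_Mapping.keys (m + n) \<subseteq> ?S" "Poly_Mapping.keys m \<subseteq> ?S" "Poly_Mapping.keys n \<subseteq> ?S"
    using Poly_Mapping.keys_add[of m n] by auto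
  show ?thesis unfolding monom_eval_superset[OF S(1,2)] monom_eval_superset[OF S(1,3)] monom_eval_superset[OF S(1,4)]
    by (simp add: lookup_add power_add prod.distrib)
qed

lemma mpoly_eval_superset:
  assumes "finite S" "Poly_Mapping.keys P \<subseteq> S"
  shows "mpoly_eval \<rho> P = (\<Sum>m\<in>S. of_rat (Poly_Mapping.lookup P m) * monom_eval \<rho> m)"
  unfolding mpoly_eval_def by (rule sum.mono_neutral_left) (use assms in \<open>auto simp: in_keys_iff\<close>)

lemma mpoly_eval_add: "mpoly_eval \<rho> (P + Q) = mpoly_eval \<rho> P + mpoly_eval \<rho> Q"
proof -
  let ?S = "Poly_Mapping.keys P \<union> Poly_Mapping.keys Q"
  have S: "finite ?S" "Poly_Mapping.keys (P + Q) \<subseteq> ?S" "Poly_Mapping.keys P \<subseteq> ?S" "Poly_Mapping.keys Q \<subseteq> ?S"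
    using Poly_Mapping.keys_add[of P Q] by auto
  show ?thesis
    unfolding mpoly_eval_superset[OF S(1,2)] mpoly_eval_superset[OF S(1,3)] mpoly_eval_superset[OF S(1,4)]
    by (simp add: lookup_add of_rat_add sum.distrib distrib_right)
qed

lemma mpoly_eval_0: "mpoly_eval \<rho> 0 = 0"
  by (simp add: mpoly_eval_def)

lemma mpoly_eval_sum: "mpoly_eval \<rho> (\<Sum>i\<in>I. P i) = (\<Sum>i\<in>I. mpoly_eval \<rho> (P i))"
  by (induction I rule: infinite_finite_induct) (auto simp: mpoly_eval_add mpoly_eval_0)

lemma mpoly_eval_single: "mpoly_eval \<rho> (Poly_Mapping.single m c) = of_rat c * monom_eval \<rho> m"
  using mpoly_eval_superset[of "{m}" "Poly_Mapping.single m c" \<rho>] by (simp add: keys_single)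

lemma mpoly_eval_mult: "mpoly_eval \<rho> (P * Q) = mpoly_eval \<rho> P * mpoly_eval \<rho> Q"
proof -
  have dec: "(\<Sum>m\<in>Poly_Mapping.keys P. Poly_Mapping.single m (Poly_Mapping.lookup P m)) = P" for P :: "'a rat_mpoly"
    by (rule poly_mapping_eqI) (auto simp: lookup_sum lookup_single when_def in_keys_iff)
  have "mpoly_eval \<rho> (P * Q) = mpoly_eval \<rho> (\<Sum>m\<in>Poly_Mapping.keys P. \<Sum>n\<in>Poly_Mapping.keys Q.
      Poly_Mapping.single (m + n) (Poly_Mapping.lookup P m * Poly_Mapping.lookup Q n))"
    by (subst dec[of P, symmetric], subst dec[of Q, symmetric]) (simp only: sum_product mult_single)
  also have "\<dots> = mpoly_eval \<rho> P * mpoly_eval \<rho> Q"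
    unfolding mpoly_eval_sum mpoly_eval_single monom_eval_add of_rat_mult
    by (simp only: mpoly_eval_def sum_product) (simp only: mult_ac)
  finally show ?thesis .
qed

lemma ratpoly_imp_mpoly:
  assumes "F \<in> ratpoly V"
  obtains P where "mpoly_vars P \<subseteq> V" "\<And>\<rho>. mpoly_eval \<rho> P = F \<rho>"
proof -
  have "\<exists>P. mpoly_vars P \<subseteq> V \<and> (\<forall>\<rho>. mpoly_eval \<rho> P = F \<rho>)" using assms
  proof (induction rule: ratpoly.induct)
    case (const c)
    show ?case by (rule exI[of _ "Poly_Mapping.single 0 c"]) (auto simp: mpoly_vars_def mpoly_eval_single)
  next
    case (var v)
    then show ?case
      by (intro exI[of _ "Poly_Mapping.single (Poly_Mapping.single v 1) 1"])
        (auto simp: mpoly_vars_def mpoly_eval_single keys_single split: if_splits)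
  next
    case (add F F')
    then obtain P Q where "mpoly_vars P \<subseteq> V" "mpoly_vars Q \<subseteq> V"
      "\<forall>\<rho>. mpoly_eval \<rho> P = F \<rho>" "\<forall>\<rho>. mpoly_eval \<rho> Q = F' \<rho>" by blast
    moreover have "mpoly_vars (P + Q) \<subseteq> mpoly_vars P \<union> mpoly_vars Q"
      unfolding mpoly_vars_def using Poly_Mapping.keys_add[of P Q] by blast
    ultimately show ?case by (intro exI[of _ "P + Q"]) (auto simp: mpoly_eval_add)
  next
    case (mult F F')
    then obtain P Q where "mpoly_vars P \<subseteq> V" "mpoly_vars Q \<subseteq> V"
      "\<forall>\<rho>. mpoly_eval \<rho> P = F \<rho>" "\<forall>\<rho>. mpoly_eval \<rho> Q = F' \<rho>" by blast
    moreover have "mpoly_vars (P * Q) \<subseteq> mpoly_vars P \<union> mpoly_vars Q"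
    proof
      fix v assume "v \<in> mpoly_vars (P * Q)"
      then obtain m where "m \<in> Poly_Mapping.keys (P * Q)" "v \<in> Poly_Mapping.keys m"
        unfolding mpoly_vars_def by blast
      moreover from this obtain a b where "m = a + b" "a \<in> Poly_Mapping.keys P" "b \<in> Poly_Mapping.keys Q"
        using keys_mult[of P Q] by blast
      ultimately show "v \<in> mpoly_vars P \<union> mpoly_vars Q"
        unfolding mpoly_vars_def using Poly_Mapping.keys_add[of a b] by blast
    qed
    ultimately show ?case by (intro exI[of _ "P * Q"]) (auto simp: mpoly_eval_mult)
  qed
  then show ?thesis using that by blast
qed

text \<open>At the zero assignment every nonconstant monomial vanishes, so the free term is
  determined by the function that the polynomial represents.\<close>

lemma mpoly_eval_zero: "mpoly_eval (\<lambda>_. 0) P = of_rat (free_term P)"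
proof -
  have me: "monom_eval (\<lambda>_. 0) m = (if m = 0 then 1 else 0)" for m :: "'a \<Rightarrow>\<^sub>0 nat"
  proof (cases "m = 0")
    case False
    then obtain v where "v \<in> Poly_Mapping.keys m" by (metis all_not_in_conv keys_eq_empty)
    then show ?thesis using False by (intro trans[OF prod_zero]) (auto simp: in_keys_iff)
  qed simp
  show ?thesis unfolding mpoly_eval_def free_term_def me
    by (simp add: if_distrib in_keys_iff cong: if_cong)
qed

section \<open>Recursive construction of the polar curve\<close>

abbreviation words :: "nat \<Rightarrow> 'n::finite list set" where
  "words r \<equiv> {ps. length ps = r}"

lemma finite_words: "finite (words r)"
  using finite_lists_length_eq[of "UNIV :: 'n::finite set" r] by simp

definition curve_monom :: "('n \<Rightarrow> real poly) \<Rightarrow> 'n list \<Rightarrow> real poly" where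
  "curve_monom K ps = prod_list (map K ps)"

lemma curve_monom_simps [simp]: "curve_monom K [] = 1" "curve_monom K (p # ps) = K p * curve_monom K ps"
  by (simp_all add: curve_monom_def)

text \<open>\<open>grad_coeff \<rho> K p n\<close> is the coefficient of \<open>t\<^sup>n\<close> in \<open>\<partial>f/\<partial>k\<^sub>p\<close> along the curve \<open>K\<close>, without the
  contribution of the second derivatives of \<open>f\<close>.\<close>

definition grad_coeff :: "('n::finite jet_var \<Rightarrow> real) \<Rightarrow> ('n \<Rightarrow> real poly) \<Rightarrow> 'n \<Rightarrow> nat \<Rightarrow> real" where
  "grad_coeff \<rho> K p n = (\<Sum>r=2..n. 1 / fact r * (\<Sum>ps\<in>words r. \<rho> (Deriv (ps @ [p])) * coeff (curve_monom K ps) n))"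

text \<open>As the third derivative of \<open>f\<close> in \<open>k1\<close>, \<open>k1\<close>,
  \<open>k2\<close> equals 1, adding c t^n to the \<open>k1\<close>-component changes the
  coefficient of t^(n+1) in \<partial>f/\<partial>k1 by exactly c; the value chosen here cancels
  that coefficient.\<close>

definition extend_k1 :: "'n::finite \<Rightarrow> nat \<Rightarrow> ('n jet_var \<Rightarrow> real) \<Rightarrow> ('n \<Rightarrow> real poly) \<Rightarrow> 'n \<Rightarrow> real poly" where
  "extend_k1 k1 n \<rho> K = K(k1 := K k1 + monom (- grad_coeff \<rho> K k1 (Suc n)) n)"

text \<open>Solves \<partial>f/\<partial>z = 0 in degree n + 1, where the new coefficients enter
  only linearly through the Hessian; its inverse is available as the variables
  \<open>HessInv\<close>.\<close>

definition extend_z :: "'n::finite \<Rightarrow> 'n \<Rightarrow> nat \<Rightarrow> ('n jet_var \<Rightarrow> real) \<Rightarrow> ('n \<Rightarrow> real poly) \<Rightarrow> 'n \<Rightarrow> real poly" where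
  "extend_z k1 k2 n \<rho> K p = (if p \<in> {k1, k2} then K p
     else K p + monom (- (\<Sum>q\<in>-{k1, k2}. \<rho> (HessInv p q) * grad_coeff \<rho> K q (Suc n))) (Suc n))"

text \<open>In \<open>polar k1 k2 \<rho> i\<close> the \<open>k1\<close>-component has degree at most \<open>i + 1\<close> and the \<open>z\<close>-components have
  degree at most \<open>i + 2\<close>: the next \<open>k1\<close>-coefficient involves \<open>z\<close>-coefficients of the same degree.\<close>

primrec polar :: "'n::finite \<Rightarrow> 'n \<Rightarrow> ('n jet_var \<Rightarrow> real) \<Rightarrow> nat \<Rightarrow> 'n \<Rightarrow> real poly" where
  "polar k1 k2 \<rho> 0 = extend_z k1 k2 1 \<rho> (\<lambda>p. if p = k2 then monom 1 1 else 0)"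
| "polar k1 k2 \<rho> (Suc i) = extend_z k1 k2 (i + 2) \<rho> (extend_k1 k1 (i + 2) \<rho> (polar k1 k2 \<rho> i))"

text \<open>The last sum is the contribution \<open>z\<^sup>T H z / 2\<close> of the second derivatives, rewritten by means of
  \<open>H z = - grad_coeff\<close>, which holds along the polar curve.\<close>

definition d_rest :: "'n::finite \<Rightarrow> 'n \<Rightarrow> nat \<Rightarrow> ('n jet_var \<Rightarrow> real) \<Rightarrow> real" where
  "d_rest k1 k2 m \<rho> = (let K = polar k1 k2 \<rho> (m - 4) in
     fact m * ((\<Sum>r=3..<m. 1 / fact r * (\<Sum>ps\<in>{ps \<in> words r. \<not> set ps \<subseteq> {k2}}. \<rho> (Deriv ps) * coeff (curve_monom K ps) m))
       - 1 / 2 * (\<Sum>p\<in>-{k1, k2}. \<Sum>i=2..m. coeff (K p) i * grad_coeff \<rho> K p (m - i))))"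

lemma ratpoly_curve_monom:
  assumes "\<And>q i. (\<lambda>\<rho>. coeff (K \<rho> q) i) \<in> ratpoly V"
  shows "(\<lambda>\<rho>. coeff (curve_monom (K \<rho>) ps) n) \<in> ratpoly V"
proof (induction ps arbitrary: n)
  case Nil
  show ?case by (cases n) (auto intro: ratpoly_0 ratpoly_1)
next
  case (Cons p ps)
  then show ?case by (auto simp: coeff_mult intro!: ratpoly_sum ratpoly.mult assms)
qed

text \<open>A word of length r contributes a derivative of order r + 1 with 2 \<le> r \<le> n, so
  the orders 3 to n + 1 occur. As the last index differs from \<open>k2\<close>, none of these
  derivatives is with respect to \<open>k2\<close> alone.\<close>

lemma ratpoly_grad_coeff:
  assumes "\<And>q i. (\<lambda>\<rho>. coeff (K \<rho> q) i) \<in> ratpoly (admissible_vars k1 k2 l)" "n + 3 \<le> l" "p \<noteq> k2"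
  shows "(\<lambda>\<rho>. grad_coeff \<rho> (K \<rho>) p n) \<in> ratpoly (admissible_vars k1 k2 l)"
  unfolding grad_coeff_def
proof (intro ratpoly_sum ratpoly.mult ratpoly_fact ratpoly_curve_monom assms(1) ratpoly.var)
  fix r and ps :: "'a list" assume "r \<in> {2..n}" "ps \<in> {ps. length ps = r}"
  then show "Deriv (ps @ [p]) \<in> admissible_vars k1 k2 l"
    using assms(2,3) unfolding admissible_vars_def by auto
qed

lemma admissible_vars_mono: "l \<le> l' \<Longrightarrow> admissible_vars k1 k2 l \<subseteq> admissible_vars k1 k2 l'"
  unfolding admissible_vars_def by auto

lemma ratpoly_extend_z:
  assumes "\<And>q i. (\<lambda>\<rho>. coeff (K \<rho> q) i) \<in> ratpoly (admissible_vars k1 k2 l)" "n + 4 \<le> l"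
  shows "(\<lambda>\<rho>. coeff (extend_z k1 k2 n \<rho> (K \<rho>) p) i) \<in> ratpoly (admissible_vars k1 k2 l)"
proof (cases "p \<in> {k1, k2} \<or> i \<noteq> Suc n")
  case True
  then have "coeff (extend_z k1 k2 n \<rho> (K \<rho>) p) i = coeff (K \<rho> p) i" for \<rho> by (auto simp: extend_z_def)
  then show ?thesis using assms(1)[of p i] by simp
next
  case False
  have "(\<lambda>\<rho>. coeff (K \<rho> p) i + - (\<Sum>q\<in>-{k1, k2}. \<rho> (HessInv p q) * grad_coeff \<rho> (K \<rho>) q (Suc n)))
      \<in> ratpoly (admissible_vars k1 k2 l)"
    by (intro ratpoly.add ratpoly_minus ratpoly_sum ratpoly.mult ratpoly_grad_coeff ratpoly.var assms)
      (use False assms(2) in \<open>auto simp: admissible_vars_def\<close>)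
  then show ?thesis using False by (simp add: extend_z_def)
qed

lemma ratpoly_extend_k1:
  assumes "\<And>q i. (\<lambda>\<rho>. coeff (K \<rho> q) i) \<in> ratpoly (admissible_vars k1 k2 l)" "n + 4 \<le> l" "k1 \<noteq> k2"
  shows "(\<lambda>\<rho>. coeff (extend_k1 k1 n \<rho> (K \<rho>) p) i) \<in> ratpoly (admissible_vars k1 k2 l)"
proof (cases "p \<noteq> k1 \<or> i \<noteq> n")
  case True
  then have "coeff (extend_k1 k1 n \<rho> (K \<rho>) p) i = coeff (K \<rho> p) i" for \<rho> by (auto simp: extend_k1_def)
  then show ?thesis using assms(1)[of p i] by simp
next
  case False
  have "(\<lambda>\<rho>. coeff (K \<rho> p) i + - grad_coeff \<rho> (K \<rho>) k1 (Suc n)) \<in> ratpoly (admissible_vars k1 k2 l)"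
    by (intro ratpoly.add ratpoly_minus ratpoly_grad_coeff assms) (use assms(2) in simp)
  then show ?thesis using False by (simp add: extend_k1_def)
qed

text \<open>Stage i looks at gradient coefficients up to degree i + 2, hence at derivatives of order
  at most i + 3, two less than the index of \<open>admissible_vars\<close>.\<close>

lemma ratpoly_polar:
  assumes "k1 \<noteq> k2"
  shows "(\<lambda>\<rho>. coeff (polar k1 k2 \<rho> i p) j) \<in> ratpoly (admissible_vars k1 k2 (i + 5))"
proof (induction i arbitrary: p j)
  case 0
  have "(\<lambda>\<rho>. coeff (if q = k2 then monom 1 1 else 0) j) \<in> ratpoly (admissible_vars k1 k2 5)" for q :: 'a and j
    by (auto simp: coeff_monom intro: ratpoly_0 ratpoly_1)
  from ratpoly_extend_z[where K = "\<lambda>\<rho> p. if p = k2 then monom 1 1 else 0", OF this, of 1 p j]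
  show ?case by simp
next
  case (Suc i)
  have "(\<lambda>\<rho>. coeff (polar k1 k2 \<rho> i q) j) \<in> ratpoly (admissible_vars k1 k2 (Suc i + 5))" for q j
    by (rule ratpoly_mono[OF Suc admissible_vars_mono]) simp
  then have "(\<lambda>\<rho>. coeff (extend_k1 k1 (i + 2) \<rho> (polar k1 k2 \<rho> i) q) j) \<in> ratpoly (admissible_vars k1 k2 (Suc i + 5))" for q j
    by (rule ratpoly_extend_k1) (use assms in auto)
  then show ?case unfolding polar.simps by (rule ratpoly_extend_z) simp
qed

text \<open>With m = \<mu> - 1, both the curve of stage m - 4 and the words of length below m
  involve only derivatives of order at most \<mu> - 2.\<close>

lemma ratpoly_d_rest:
  assumes "k1 \<noteq> k2" "m \<ge> 4"
  shows "d_rest k1 k2 m \<in> ratpoly (admissible_vars k1 k2 (Suc m))"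
proof -
  have K: "(\<lambda>\<rho>. coeff (polar k1 k2 \<rho> (m - 4) q) j) \<in> ratpoly (admissible_vars k1 k2 (Suc m))" for q j
    using ratpoly_polar[OF assms(1), of "m - 4" q j] assms(2) by simp
  have "(\<lambda>\<rho>. d_rest k1 k2 m \<rho>) \<in> ratpoly (admissible_vars k1 k2 (Suc m))"
    unfolding d_rest_def Let_def
    by (intro ratpoly.mult ratpoly_diff ratpoly_sum ratpoly_fact ratpoly.var ratpoly_curve_monom
        ratpoly_grad_coeff K) (use assms in \<open>auto simp: admissible_vars_def\<close>)
  then show ?thesis by simp
qed

lemma grad_coeff_zero: "grad_coeff (\<lambda>_. 0) K p n = 0"
  by (simp add: grad_coeff_def)

text \<open>Every summand has a value of the assignment as a factor, directly or inside
  \<open>grad_coeff\<close>. Through \<open>mpoly_eval_zero\<close> this becomes the vanishing of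
  the free term.\<close>

lemma d_rest_zero: "d_rest k1 k2 m (\<lambda>_. 0) = 0"
  by (simp add: d_rest_def Let_def grad_coeff_zero)

section \<open>How changes of the curve affect the coefficients\<close>

lemma curve_monom_dvd:
  assumes "\<And>p. coeff (K p) 0 = 0" shows "monom 1 (length ps) dvd curve_monom K ps"
proof (induction ps)
  case (Cons p ps)
  have "monom 1 1 dvd K p" unfolding monom_1_dvd_iff' using assms by simp
  from mult_dvd_mono[OF this Cons] show ?case by (simp add: mult_monom)
qed (simp add: monom_0 pCons_one)

text \<open>Telescoping over the factors: one factor changes by a multiple of t^n, while each of the
  others is divisible by t.\<close>

lemma curve_monom_diff_dvd:
  assumes "\<And>p. coeff (K p) 0 = 0" "\<And>p. coeff (K' p) 0 = 0" "\<And>p. monom 1 n dvd K' p - K p" "ps \<noteq> []"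
  shows "monom 1 (n + length ps - 1) dvd curve_monom K' ps - curve_monom K ps"
  using assms(4)
proof (induction ps rule: list_nonempty_induct)
  case (single p) then show ?case using assms(3) by simp
next
  case (cons p ps)
  have "monom 1 1 dvd K p" unfolding monom_1_dvd_iff' using assms by simp
  from mult_dvd_mono[OF this cons(2)] mult_dvd_mono[OF assms(3) curve_monom_dvd[of K' ps, OF assms(2)]]
  have "monom 1 (n + length (p # ps) - 1) dvd K p * (curve_monom K' ps - curve_monom K ps) + (K' p - K p) * curve_monom K' ps"
    using cons(1) by (intro dvd_add) (auto simp: mult_monom add_ac intro: dvd_trans[rotated] Suc_leI)
  then show ?case by (simp add: algebra_simps)
qed

lemma curve_monom_coeff_eq:
  assumes "\<And>p. coeff (K p) 0 = 0" "\<And>p. coeff (K' p) 0 = 0" "\<And>p. monom 1 n dvd K' p - K p" "ps \<noteq> []"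
    and "j < n + length ps - 1"
  shows "coeff (curve_monom K' ps) j = coeff (curve_monom K ps) j"
  using curve_monom_diff_dvd[OF assms(1-4)] assms(5) unfolding monom_1_dvd_iff' by simp

text \<open>\<open>grad_coeff\<close> contains only products of at least two components, so a change
  of the curve in degree n is first felt in degree n + 1. This makes the recursion for the
  coefficients triangular.\<close>

lemma grad_coeff_eq:
  assumes "\<And>p. coeff (K p) 0 = 0" "\<And>p. coeff (K' p) 0 = 0" "\<And>p. monom 1 n dvd K' p - K p" "j \<le> n"
  shows "grad_coeff \<rho> K' p j = grad_coeff \<rho> K p j"
  unfolding grad_coeff_def
proof (intro sum.cong refl arg_cong2[where f = "(*)"])
  fix r and ps :: "'a list" assume "r \<in> {2..j}" "ps \<in> {ps. length ps = r}"
  then show "coeff (curve_monom K' ps) j = coeff (curve_monom K ps) j"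
    using assms by (intro curve_monom_coeff_eq[of K K' n]) auto
qed

lemma sum_words_Suc: "(\<Sum>ps\<in>words (Suc r). g ps) = (\<Sum>p\<in>UNIV. \<Sum>ps\<in>words r. g (p # ps))"
proof -
  have "(\<Sum>ps\<in>words (Suc r). g ps) = (\<Sum>(p, ps)\<in>UNIV \<times> words r. g (p # ps))"
    by (rule sum.reindex_bij_witness[of _ "\<lambda>(p, ps). p # ps" "\<lambda>ps. (hd ps, tl ps)"])
      (auto simp: length_Suc_conv)
  then show ?thesis by (simp add: sum.cartesian_product)
qed

lemma sum_words_2: "(\<Sum>ps\<in>words 2. g ps) = (\<Sum>p\<in>UNIV. \<Sum>q\<in>UNIV. g [p, q])"
  by (simp add: numeral_2_eq_2 sum_words_Suc)

text \<open>State of the recursion: the z-equations hold up to degree \<open>m\<close>, the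
  \<open>k1\<close>-equation up to degree \<open>n\<close>, and the two half steps raise these
  bounds in turn. The z-components stop at degree \<open>m\<close>, which leaves the next slot
  empty. The Hessian is passed as \<open>H\<close>, apart from the assignment, so that no function
  \<open>f\<close> is involved yet.\<close>

definition polar_inv ::
  "'n::finite \<Rightarrow> 'n \<Rightarrow> ('n \<Rightarrow> 'n \<Rightarrow> real) \<Rightarrow> ('n jet_var \<Rightarrow> real) \<Rightarrow> nat \<Rightarrow> nat \<Rightarrow> ('n \<Rightarrow> real poly) \<Rightarrow> bool" where
  "polar_inv k1 k2 H \<rho> m n K \<longleftrightarrow>
     (\<forall>p. coeff (K p) 0 = 0) \<and> K k2 = monom 1 1 \<and> (\<forall>p. p \<noteq> k2 \<longrightarrow> coeff (K p) 1 = 0) \<and>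
     (\<forall>p\<in>-{k1, k2}. \<forall>j\<le>m. (\<Sum>q\<in>-{k1, k2}. H p q * coeff (K q) j) + grad_coeff \<rho> K p j = 0) \<and>
     (\<forall>p\<in>-{k1, k2}. \<forall>j>m. coeff (K p) j = 0) \<and>
     (\<forall>j\<le>n. grad_coeff \<rho> K k1 j = 0)"

lemma polar_inv_extend_z:
  assumes "polar_inv k1 k2 H \<rho> n (Suc n) K" "n \<ge> 1"
    and HG: "\<And>p r. p \<notin> {k1, k2} \<Longrightarrow> r \<notin> {k1, k2} \<Longrightarrow>
      (\<Sum>q\<in>-{k1, k2}. H p q * \<rho> (HessInv q r)) = (if p = r then 1 else 0)"
  shows "polar_inv k1 k2 H \<rho> (Suc n) (Suc n) (extend_z k1 k2 n \<rho> K)"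
proof -
  let ?K = "extend_z k1 k2 n \<rho> K"
  note I = assms(1)[unfolded polar_inv_def]
  have d: "monom 1 (Suc n) dvd ?K p - K p" for p
    by (auto simp: extend_z_def monom_1_dvd_iff')
  have c0: "coeff (?K p) 0 = 0" and c1: "p \<noteq> k2 \<Longrightarrow> coeff (?K p) 1 = 0" for p
    using I assms(2) by (auto simp: extend_z_def)
  have E: "grad_coeff \<rho> ?K p j = grad_coeff \<rho> K p j" if "j \<le> Suc n" for p j
    by (rule grad_coeff_eq[OF _ c0 d that]) (use I in blast)
  have "(\<Sum>q\<in>-{k1, k2}. H p q * coeff (?K q) j) + grad_coeff \<rho> ?K p j = 0"
    if p: "p \<in> -{k1, k2}" and j: "j \<le> Suc n" for p j
  proof (cases "j = Suc n")
    case False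
    then have "(\<Sum>q\<in>-{k1, k2}. H p q * coeff (?K q) j) = (\<Sum>q\<in>-{k1, k2}. H p q * coeff (K q) j)"
      by (intro sum.cong) (auto simp: extend_z_def)
    then show ?thesis using I E[OF j] p j False by auto
  next
    case True
    \<comment> \<open>The new coefficients are minus the inverse Hessian applied to
      \<open>grad_coeff\<close>; exchanging the sums brings out the product of the Hessian and its
      inverse.\<close>
    have "(\<Sum>q\<in>-{k1, k2}. H p q * coeff (?K q) j)
        = (\<Sum>q\<in>-{k1, k2}. H p q * coeff (K q) j - (\<Sum>r\<in>-{k1, k2}. H p q * \<rho> (HessInv q r) * grad_coeff \<rho> K r j))"
      using True by (intro sum.cong) (auto simp: extend_z_def sum_distrib_left right_diff_distrib mult_ac)
    also have "\<dots> = (\<Sum>q\<in>-{k1, k2}. H p q * coeff (K q) j)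
        - (\<Sum>r\<in>-{k1, k2}. (\<Sum>q\<in>-{k1, k2}. H p q * \<rho> (HessInv q r)) * grad_coeff \<rho> K r j)"
      unfolding sum_subtractf sum_distrib_right by (subst sum.swap) simp
    also have "(\<Sum>r\<in>-{k1, k2}. (\<Sum>q\<in>-{k1, k2}. H p q * \<rho> (HessInv q r)) * grad_coeff \<rho> K r j)
        = (\<Sum>r\<in>-{k1, k2}. if r = p then grad_coeff \<rho> K r j else 0)"
      using p by (intro sum.cong) (auto simp: HG)
    also have "\<dots> = grad_coeff \<rho> K p j" using p by simp
    finally have "(\<Sum>q\<in>-{k1, k2}. H p q * coeff (?K q) j) + grad_coeff \<rho> ?K p j = (\<Sum>q\<in>-{k1, k2}. H p q * coeff (K q) j)"
      using E[OF j] by simp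
    also have "\<dots> = 0" using I True by (intro sum.neutral) auto
    finally show ?thesis .
  qed
  then show ?thesis using I E c0 c1 unfolding polar_inv_def by (auto simp: extend_z_def)
qed

lemma polar_inv_extend_k1:
  assumes "polar_inv k1 k2 H \<rho> n n K" "n \<ge> 2" "k1 \<noteq> k2"
    and \<rho>: "\<rho> (Deriv [k1, k2, k1]) = 1" "\<rho> (Deriv [k2, k1, k1]) = 1"
  shows "polar_inv k1 k2 H \<rho> n (Suc n) (extend_k1 k1 n \<rho> K)"
proof -
  let ?K = "extend_k1 k1 n \<rho> K"
  let ?c = "- grad_coeff \<rho> K k1 (Suc n)"
  let ?cp = "\<lambda>p. if p = k1 then ?c else 0"
  note I = assms(1)[unfolded polar_inv_def]
  have Kp: "?K p = K p + monom (?cp p) n" for p by (simp add: extend_k1_def)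
  have d: "monom 1 n dvd ?K p - K p" for p
    by (auto simp: Kp monom_1_dvd_iff')
  have c0: "coeff (?K p) 0 = 0" and c1: "p \<noteq> k2 \<Longrightarrow> coeff (?K p) 1 = 0" for p
    using I assms(2) by (auto simp: Kp)
  have E: "grad_coeff \<rho> ?K p j = grad_coeff \<rho> K p j" if "j \<le> n" for p j
    by (rule grad_coeff_eq[OF _ c0 d that]) (use I in blast)
  have K1: "coeff (K p) 1 = (if p = k2 then 1 else 0)" for p using I by auto
  \<comment> \<open>Among the products of two components, only those of the \<open>k1\<close>- and
    the \<open>k2\<close>-component change in degree n + 1: the linear coefficient of the curve is 1
    for \<open>k2\<close> and 0 otherwise, and the degree n + n exceeds n + 1 because n \<ge>
    2.\<close>
  have "coeff (?K a * ?K b) (Suc n) - coeff (K a * K b) (Suc n)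
      = (if a = k1 \<and> b = k2 then ?c else 0) + (if a = k2 \<and> b = k1 then ?c else 0)" for a b
  proof -
    have "?K a * ?K b = K a * K b + monom (?cp a) n * K b + monom (?cp b) n * K a + monom (?cp a * ?cp b) (n + n)"
      unfolding Kp by (simp only: mult_monom[symmetric]) (simp add: algebra_simps)
    then show ?thesis using assms(2,3) K1[of a] K1[of b] by (simp add: coeff_monom_mult)
  qed
  then have prod: "coeff (?K a * ?K b) (Suc n) = coeff (K a * K b) (Suc n) +
      ((if a = k1 \<and> b = k2 then ?c else 0) + (if a = k2 \<and> b = k1 then ?c else 0))" for a b
    by (metis add.commute diff_add_cancel)
  have "grad_coeff \<rho> ?K k1 (Suc n) = grad_coeff \<rho> K k1 (Suc n) + ?c"
  proof -
    have split: "{2..Suc n} = insert 2 {3..Suc n}" using assms(2) by auto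
    have r3: "(\<Sum>r=3..Suc n. 1 / fact r * (\<Sum>ps\<in>words r. \<rho> (Deriv (ps @ [k1])) * coeff (curve_monom ?K ps) (Suc n)))
      = (\<Sum>r=3..Suc n. 1 / fact r * (\<Sum>ps\<in>words r. \<rho> (Deriv (ps @ [k1])) * coeff (curve_monom K ps) (Suc n)))"
    proof (intro sum.cong refl arg_cong2[where f = "(*)"])
      fix r and ps :: "'a list" assume "r \<in> {3..Suc n}" "ps \<in> {ps. length ps = r}"
      then show "coeff (curve_monom ?K ps) (Suc n) = coeff (curve_monom K ps) (Suc n)"
        using I by (intro curve_monom_coeff_eq[OF _ c0 d]) auto
    qed
    have "(\<Sum>ps\<in>words 2. \<rho> (Deriv (ps @ [k1])) * coeff (curve_monom ?K ps) (Suc n))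
       = (\<Sum>ps\<in>words 2. \<rho> (Deriv (ps @ [k1])) * coeff (curve_monom K ps) (Suc n))
         + (\<Sum>a\<in>UNIV. \<Sum>b\<in>UNIV. (if a = k1 \<and> b = k2 then \<rho> (Deriv [a, b, k1]) * ?c else 0) + (if a = k2 \<and> b = k1 then \<rho> (Deriv [a, b, k1]) * ?c else 0))"
      unfolding sum_words_2 sum.distrib[symmetric]
    proof (intro sum.cong refl)
      fix a b
      show "\<rho> (Deriv ([a, b] @ [k1])) * coeff (curve_monom ?K [a, b]) (Suc n)
        = \<rho> (Deriv ([a, b] @ [k1])) * coeff (curve_monom K [a, b]) (Suc n)
         + ((if a = k1 \<and> b = k2 then \<rho> (Deriv [a, b, k1]) * ?c else 0) + (if a = k2 \<and> b = k1 then \<rho> (Deriv [a, b, k1]) * ?c else 0))"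
        using prod[of a b] assms(3) by (cases "a = k1 \<and> b = k2"; cases "a = k2 \<and> b = k1") (auto simp: \<rho> algebra_simps)
    qed
    \<comment> \<open>Both orders of the pair contribute, which compensates the weight
      \<open>1 / fact 2\<close>.\<close>
    also have "(\<Sum>a\<in>UNIV. \<Sum>b\<in>UNIV. (if a = k1 \<and> b = k2 then \<rho> (Deriv [a, b, k1]) * ?c else 0) + (if a = k2 \<and> b = k1 then \<rho> (Deriv [a, b, k1]) * ?c else 0)) = 2 * ?c"
    proof -
      have "(\<Sum>a\<in>UNIV. \<Sum>b\<in>UNIV. if a = u \<and> b = v then \<rho> (Deriv [a, b, k1]) * ?c else 0) = \<rho> (Deriv [u, v, k1]) * ?c" for u v
      proof -
        have "(\<Sum>b\<in>UNIV. if a = u \<and> b = v then \<rho> (Deriv [a, b, k1]) * ?c else 0) = (if a = u then \<rho> (Deriv [a, v, k1]) * ?c else 0)" for a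
          by (cases "a = u") auto
        then show ?thesis by simp
      qed
      then show ?thesis unfolding sum.distrib \<rho> by (simp add: \<rho>)
    qed
    finally show ?thesis
      unfolding grad_coeff_def[of \<rho> _ k1 "Suc n"] split using r3 by (simp add: fact_2 field_simps)
  qed
  then have "grad_coeff \<rho> ?K k1 (Suc n) = 0" by simp
  then have "\<forall>j\<le>Suc n. grad_coeff \<rho> ?K k1 j = 0"
    using E I by (metis le_Suc_eq)
  moreover have "?K q = K q" if "q \<noteq> k1" for q using that by (simp add: extend_k1_def)
  moreover have "(\<Sum>q\<in>-{k1, k2}. H p q * coeff (?K q) j) = (\<Sum>q\<in>-{k1, k2}. H p q * coeff (K q) j)" for p j
    by (intro sum.cong) (auto simp: extend_k1_def)
  ultimately show ?thesis using I E c0 c1 assms(3) unfolding polar_inv_def by auto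
qed

lemma polar_inv_polar:
  assumes "k1 \<noteq> k2"
    and \<rho>: "\<rho> (Deriv [k1, k2, k1]) = 1" "\<rho> (Deriv [k2, k1, k1]) = 1" "\<rho> (Deriv [k2, k2, k1]) = 0"
    and HG: "\<And>p r. p \<notin> {k1, k2} \<Longrightarrow> r \<notin> {k1, k2} \<Longrightarrow>
      (\<Sum>q\<in>-{k1, k2}. H p q * \<rho> (HessInv q r)) = (if p = r then 1 else 0)"
  shows "polar_inv k1 k2 H \<rho> (i + 2) (i + 2) (polar k1 k2 \<rho> i)"
proof (induction i)
  case 0
  let ?K = "\<lambda>p. if p = k2 then monom 1 1 else 0 :: real poly"
  have "polar_inv k1 k2 H \<rho> 1 (Suc 1) ?K"
    unfolding polar_inv_def
  proof (intro conjI allI impI ballI)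
    fix j :: nat assume "j \<le> Suc 1"
    then consider "j < 2" | "j = 2" by linarith
    then show "grad_coeff \<rho> ?K k1 j = 0"
    proof cases
      case 2
      \<comment> \<open>The hypothesis on the derivative in \<open>k1\<close>, \<open>k2\<close>,
        \<open>k2\<close> enters here: along the line (0, t, 0) it is, up to a factor, the
        coefficient of t^2 in \<partial>f/\<partial>k1.\<close>
      have "\<rho> (Deriv [a, b, k1]) * coeff (?K a * ?K b) 2 = 0" for a b
        using \<rho>(3) by (auto simp: mult_monom)
      then have "(\<Sum>a\<in>UNIV. \<Sum>b\<in>UNIV. \<rho> (Deriv [a, b, k1]) * coeff (?K a * ?K b) 2) = 0"
        by (intro sum.neutral ballI)
      then show ?thesis using 2 by (simp add: grad_coeff_def sum_words_2)
    qed (simp add: grad_coeff_def)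
  qed (use assms(1) in \<open>auto simp: grad_coeff_def\<close>)
  from polar_inv_extend_z[OF this _ HG] show ?case by (simp add: numeral_2_eq_2)
next
  case (Suc i)
  have "polar_inv k1 k2 H \<rho> (i + 2) (Suc (i + 2)) (extend_k1 k1 (i + 2) \<rho> (polar k1 k2 \<rho> i))"
    by (rule polar_inv_extend_k1[OF Suc _ assms(1) \<rho>(1,2)]) simp
  from polar_inv_extend_z[OF this _ HG] show ?case by simp
qed

lemma polar_tail:
  assumes "i \<le> j" "k1 \<noteq> k2"
  shows "monom 1 (i + 2) dvd polar k1 k2 \<rho> j k1 - polar k1 k2 \<rho> i k1"
    and "p \<noteq> k1 \<Longrightarrow> monom 1 (i + 3) dvd polar k1 k2 \<rho> j p - polar k1 k2 \<rho> i p"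
    and "polar k1 k2 \<rho> j k2 = monom 1 1"
proof -
  have "monom 1 (i + 2) dvd polar k1 k2 \<rho> j k1 - polar k1 k2 \<rho> i k1 \<and>
    (\<forall>p. p \<noteq> k1 \<longrightarrow> monom 1 (i + 3) dvd polar k1 k2 \<rho> j p - polar k1 k2 \<rho> i p)"
    using assms(1)
    by (induction j rule: dec_induct) (auto simp: extend_z_def extend_k1_def monom_1_dvd_iff')
  then show "monom 1 (i + 2) dvd polar k1 k2 \<rho> j k1 - polar k1 k2 \<rho> i k1"
    "p \<noteq> k1 \<Longrightarrow> monom 1 (i + 3) dvd polar k1 k2 \<rho> j p - polar k1 k2 \<rho> i p" by auto
  show "polar k1 k2 \<rho> j k2 = monom 1 1"
    by (induction j) (use assms(2) in \<open>auto simp: extend_z_def extend_k1_def\<close>)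
qed

section \<open>Orders of vanishing\<close>

text \<open>Order at least n, read as O(t^n) on the punctured filter; the value at 0 is therefore
  unconstrained, and \<open>vanishes_isCont_0\<close> recovers it for continuous functions.\<close>

definition vanishes :: "nat \<Rightarrow> (real \<Rightarrow> real) \<Rightarrow> bool" where
  "vanishes n g \<longleftrightarrow> g \<in> O[at 0](\<lambda>t. t ^ n)"

lemma vanishesI: "\<forall>\<^sub>F t in at 0. \<bar>g t\<bar> \<le> C * \<bar>t\<bar> ^ n \<Longrightarrow> vanishes n g"
  unfolding vanishes_def by (rule bigoI[of _ C]) (simp add: power_abs)

lemma vanishesE:
  assumes "vanishes n g" obtains C where "C > 0" "\<forall>\<^sub>F t in at 0. \<bar>g t\<bar> \<le> C * \<bar>t\<bar> ^ n"
  using assms unfolding vanishes_def by (elim landau_o.bigE) (simp add: power_abs)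

lemma vanishes_add: "vanishes n f \<Longrightarrow> vanishes n g \<Longrightarrow> vanishes n (\<lambda>t. f t + g t)"
  and vanishes_diff: "vanishes n f \<Longrightarrow> vanishes n g \<Longrightarrow> vanishes n (\<lambda>t. f t - g t)"
  and vanishes_0: "vanishes n (\<lambda>t. 0)"
  unfolding vanishes_def by (auto intro: sum_in_bigo)

lemma vanishes_mult: "vanishes m f \<Longrightarrow> vanishes n g \<Longrightarrow> vanishes (m + n) (\<lambda>t. f t * g t)"
  unfolding vanishes_def power_add by (rule landau_o.big.mult)

lemma vanishes_sum: "(\<And>i. i \<in> I \<Longrightarrow> vanishes n (f i)) \<Longrightarrow> vanishes n (\<lambda>t. \<Sum>i\<in>I. f i t)"
  by (induction I rule: infinite_finite_induct) (auto intro: vanishes_0 vanishes_add)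

lemma vanishes_mono:
  assumes "vanishes n g" "m \<le> n" shows "vanishes m g"
proof -
  obtain C where C: "C > 0" "\<forall>\<^sub>F t in at 0. \<bar>g t\<bar> \<le> C * \<bar>t\<bar> ^ n" using vanishesE[OF assms(1)] .
  have "\<forall>\<^sub>F t in at (0::real). \<bar>t\<bar> < 1"
    by (auto simp: eventually_at intro!: exI[of _ 1])
  then have "\<forall>\<^sub>F t in at 0. \<bar>g t\<bar> \<le> C * \<bar>t\<bar> ^ m" using C(2)
  proof eventually_elim
    case (elim t)
    then have "C * \<bar>t\<bar> ^ n \<le> C * \<bar>t\<bar> ^ m" using C(1) assms(2)
      by (intro mult_left_mono power_decreasing) auto
    then show ?case using elim by linarith
  qed
  then show ?thesis by (rule vanishesI)
qed

lemma vanishes_bound: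
  assumes "vanishes n g" "\<forall>\<^sub>F t in at 0. \<bar>f t\<bar> \<le> \<bar>g t\<bar>" shows "vanishes n f"
proof -
  obtain C where C: "C > 0" "\<forall>\<^sub>F t in at 0. \<bar>g t\<bar> \<le> C * \<bar>t\<bar> ^ n" using vanishesE[OF assms(1)] .
  have "\<forall>\<^sub>F t in at 0. \<bar>f t\<bar> \<le> C * \<bar>t\<bar> ^ n" using C(2) assms(2) by eventually_elim linarith
  then show ?thesis by (rule vanishesI)
qed

lemma vanishes_cong: "vanishes n g \<Longrightarrow> \<forall>\<^sub>F t in at 0. f t = g t \<Longrightarrow> vanishes n f"
  by (erule vanishes_bound) (auto elim: eventually_mono)

lemma vanishes_tendsto: "(g \<longlongrightarrow> l) (at 0) \<Longrightarrow> vanishes 0 g"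
  unfolding vanishes_def by (rule bigoI_tendsto[of _ _ l]) auto

lemma vanishes_isCont: "isCont g 0 \<Longrightarrow> vanishes 0 g"
  unfolding isCont_def by (rule vanishes_tendsto)

lemma vanishes_const: "vanishes 0 (\<lambda>t. c)"
  by (rule vanishes_isCont) simp

lemma vanishes_cmult: "vanishes n g \<Longrightarrow> vanishes n (\<lambda>t. c * g t)"
  using vanishes_mult[OF vanishes_const] by fastforce

lemma vanishes_power: "vanishes n (\<lambda>t. t ^ n)"
  by (rule vanishesI[of _ 1]) (simp add: power_abs)

lemma tendsto_vanishes:
  assumes "vanishes n g" "n > 0" shows "(g \<longlongrightarrow> 0) (at 0)"
proof -
  obtain C where C: "C > 0" "\<forall>\<^sub>F t in at 0. \<bar>g t\<bar> \<le> C * \<bar>t\<bar> ^ n" using vanishesE[OF assms(1)] .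
  have "((\<lambda>t. C * \<bar>t\<bar> ^ n) \<longlongrightarrow> C * \<bar>0::real\<bar> ^ n) (at 0)" by (intro tendsto_intros)
  then have "((\<lambda>t. C * \<bar>t\<bar> ^ n) \<longlongrightarrow> 0) (at 0)" using assms(2) by (simp add: power_0_left)
  from tendsto_0_le[OF this, of g 1] show ?thesis using C by (auto elim: eventually_mono)
qed

lemma vanishes_isCont_0:
  assumes "vanishes n g" "n > 0" "isCont g 0" shows "g 0 = 0"
  using tendsto_vanishes[OF assms(1,2)] assms(3) LIM_unique unfolding isCont_def by blast

lemma vanishes_cancel:
  assumes "vanishes (Suc n) (\<lambda>t. t * g t)" shows "vanishes n g"
proof -
  obtain C where C: "C > 0" "\<forall>\<^sub>F t in at 0. \<bar>t * g t\<bar> \<le> C * \<bar>t\<bar> ^ Suc n" using vanishesE[OF assms] .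
  have "\<forall>\<^sub>F t in at (0::real). t \<noteq> 0" by (simp add: eventually_at_filter)
  then have "\<forall>\<^sub>F t in at 0. \<bar>g t\<bar> \<le> C * \<bar>t\<bar> ^ n" using C(2)
  proof eventually_elim
    case (elim t)
    then have "\<bar>t\<bar> * \<bar>g t\<bar> \<le> \<bar>t\<bar> * (C * \<bar>t\<bar> ^ n)" by (simp add: abs_mult mult_ac)
    then show ?case using elim by simp
  qed
  then show ?thesis by (rule vanishesI)
qed

lemma vanishes_poly:
  assumes "monom 1 n dvd q" shows "vanishes n (poly q)"
proof -
  obtain k where "q = monom 1 n * k" using assms by (elim dvdE)
  then have "poly q = (\<lambda>t. t ^ n * poly k t)" by (simp add: poly_monom fun_eq_iff)
  then show ?thesis using vanishes_mult[OF vanishes_power vanishes_isCont[OF poly_isCont], of n k] by simp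
qed

text \<open>The way back from orders to coefficients: expansions are compared as functions modulo
  O(t^n), and the coefficients below n are then read off by dividing out one factor t at a
  time.\<close>

lemma vanishes_poly_coeff:
  assumes "vanishes n (poly q)" "j < n" shows "coeff q j = 0"
  using assms
proof (induction j arbitrary: n q)
  case 0
  then show ?case using vanishes_isCont_0[OF 0(1) _ poly_isCont] by (simp add: poly_0_coeff_0)
next
  case (Suc j)
  then obtain m where m: "n = Suc m" "j < m" by (cases n) auto
  have "poly q 0 = 0" using Suc.prems vanishes_isCont_0[OF Suc.prems(1) _ poly_isCont] by simp
  then obtain r where r: "q = [:0, 1:] * r" using poly_eq_0_iff_dvd[of q 0] by auto
  have "vanishes m (poly r)"
    by (rule vanishes_cancel) (use Suc.prems(1) r m in simp)
  then have "coeff r j = 0" using Suc.IH m by blast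
  then show ?case using r by simp
qed

lemma vanishes_comp_isCont:
  fixes g :: "'a::real_normed_vector \<Rightarrow> real"
  assumes "isCont g 0" "vanishes 1 (\<lambda>t. norm (\<xi> t))" shows "vanishes 0 (\<lambda>t. g (\<xi> t))"
proof (rule vanishes_tendsto)
  have "(\<xi> \<longlongrightarrow> 0) (at 0)" using tendsto_vanishes[OF assms(2)] tendsto_norm_zero_iff by auto
  then show "((\<lambda>t. g (\<xi> t)) \<longlongrightarrow> g 0) (at 0)" using assms(1) isCont_tendsto_compose by blast
qed

lemma differentiable_at_bound:
  fixes g :: "'a::real_normed_vector \<Rightarrow> 'b::real_normed_vector"
  assumes "g differentiable (at x)"
  obtains C where "C > 0" "\<forall>\<^sub>F y in nhds x. norm (g y - g x) \<le> C * norm (y - x)"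
proof -
  obtain g' where g': "(g has_derivative g') (at x)" using assms differentiable_def by blast
  obtain B where B: "B > 0" "\<And>v. norm (g' v) \<le> norm v * B"
    using bounded_linear.pos_bounded[OF has_derivative_bounded_linear[OF g']] by blast
  obtain d where d: "d > 0" "\<And>y. norm (y - x) < d \<Longrightarrow> norm (g y - g x - g' (y - x)) \<le> 1 * norm (y - x)"
    using g' unfolding has_derivative_at_alt by (metis zero_less_one)
  have "norm (g y - g x) \<le> (B + 1) * norm (y - x)" if "norm (y - x) < d" for y
  proof -
    have "norm (g y - g x) \<le> norm (g y - g x - g' (y - x)) + norm (g' (y - x))"
      by (metis add.commute diff_add_cancel norm_triangle_ineq)
    then show ?thesis using d(2)[OF that] B(2)[of "y - x"] by (simp add: algebra_simps)
  qed
  then show ?thesis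
    using that[of "B + 1"] d B(1) unfolding eventually_nhds_metric dist_norm by auto
qed

lemma vanishes_comp_differentiable:
  fixes g :: "'a::real_normed_vector \<Rightarrow> real"
  assumes "g differentiable (at 0)" "g 0 = 0" "vanishes n (\<lambda>t. norm (\<xi> t))" "n > 0"
  shows "vanishes n (\<lambda>t. g (\<xi> t))"
proof -
  obtain C where C: "C > 0" "\<forall>\<^sub>F y in nhds 0. norm (g y - g 0) \<le> C * norm (y - 0)"
    using differentiable_at_bound[OF assms(1)] .
  have "(\<xi> \<longlongrightarrow> 0) (at 0)" using tendsto_vanishes[OF assms(3,4)] tendsto_norm_zero_iff by auto
  from eventually_compose_filterlim[OF C(2) this] have "\<forall>\<^sub>F t in at 0. \<bar>g (\<xi> t)\<bar> \<le> \<bar>C * norm (\<xi> t)\<bar>"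
    using assms(2) C(1) by (auto elim: eventually_mono simp: abs_mult)
  with vanishes_cmult[OF assms(3)] show ?thesis by (rule vanishes_bound)
qed

section \<open>Taylor expansion along polynomial curves\<close>

definition curve :: "('n::finite \<Rightarrow> real poly) \<Rightarrow> real \<Rightarrow> real ^ 'n" where
  "curve K t = (\<chi> p. poly (K p) t)"

lemma curve_nth [simp]: "curve K t $ p = poly (K p) t"
  by (simp add: curve_def)

lemma vanishes_norm_vec:
  fixes \<xi> :: "real \<Rightarrow> real ^ 'n::finite"
  assumes "\<And>p. vanishes n (\<lambda>t. \<xi> t $ p)" shows "vanishes n (\<lambda>t. norm (\<xi> t))"
proof (rule vanishes_bound)
  have "vanishes n (\<lambda>t. \<bar>\<xi> t $ p\<bar>)" for p
    by (rule vanishes_bound[OF assms[of p]]) simp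
  then show "vanishes n (\<lambda>t. \<Sum>p\<in>UNIV. \<bar>\<xi> t $ p\<bar>)" by (intro vanishes_sum)
  show "\<forall>\<^sub>F t in at 0. \<bar>norm (\<xi> t)\<bar> \<le> \<bar>\<Sum>p\<in>UNIV. \<bar>\<xi> t $ p\<bar>\<bar>"
    by (rule always_eventually) (auto intro: order_trans[OF norm_le_l1_cart])
qed

lemma vanishes_norm_curve:
  assumes "\<And>p. coeff (K p) 0 = 0" shows "vanishes 1 (\<lambda>t. norm (curve K t))"
  by (rule vanishes_norm_vec) (use assms vanishes_poly[of 1] in \<open>simp add: monom_1_dvd_iff'\<close>)

lemma linear_vec_sum:
  fixes L :: "real ^ 'n::finite \<Rightarrow> real"
  assumes "linear L" shows "L v = (\<Sum>p\<in>UNIV. v $ p * L (axis p 1))"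
proof -
  have "L (\<Sum>p\<in>UNIV. v $ p *\<^sub>R axis p 1) = (\<Sum>p\<in>UNIV. v $ p * L (axis p 1))"
    by (simp add: linear_sum[OF assms] linear_scale[OF assms])
  then show ?thesis using basis_expansion[of v] by (simp add: scalar_mult_eq_scaleR)
qed

lemma partial_append: "partial (ps @ qs) f = partial ps (partial qs f)"
  by (simp add: partial_def iter_deriv_append)

lemma partial_Cons: "partial (p # ps) f x = frechet_derivative (partial ps f) (at x) (axis p 1)"
  by (simp add: partial_def)

lemma partial_Nil [simp]: "partial [] f = f"
  by (simp add: partial_def)

lemma smooth_near_partial: "smooth_near f x \<Longrightarrow> smooth_near (partial ps f) x"
  unfolding partial_def by (rule smooth_near_iter_deriv)

lemma frechet_derivative_partial:
  fixes f :: "real ^ 'n::finite \<Rightarrow> real"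
  assumes "f differentiable (at x)"
  shows "frechet_derivative f (at x) v = (\<Sum>p\<in>UNIV. v $ p * partial [p] f x)"
  using linear_vec_sum[of "frechet_derivative f (at x)" v] assms frechet_derivative_works has_derivative_linear
  by (fastforce simp: partial_def)

text \<open>Summing over words counts a multi-index once for every ordering, so multinomial
  coefficients never appear and \<open>1 / fact r\<close> is the only weight in the Taylor
  formula.\<close>

lemma iter_deriv_replicate:
  fixes f :: "real ^ 'n::finite \<Rightarrow> real"
  assumes "\<And>x. smooth_near f x"
  shows "iter_deriv (replicate r v) f x = (\<Sum>ps\<in>words r. partial ps f x * prod_list (map (($) v) ps))"
proof (induction r arbitrary: x)
  case (Suc r)
  let ?g = "\<lambda>x. \<Sum>ps\<in>words r. partial ps f x * prod_list (map (($) v) ps)"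
  have d: "partial ps f differentiable (at x)" for ps x
    using smooth_near_differentiable[OF smooth_near_partial[OF assms]] .
  have "(?g has_derivative (\<lambda>w. \<Sum>ps\<in>words r. frechet_derivative (partial ps f) (at x) w * prod_list (map (($) v) ps))) (at x)"
    by (intro has_derivative_sum has_derivative_mult_left) (use d frechet_derivative_works in blast)
  from fun_cong[OF frechet_derivative_at[OF this], of v, symmetric]
  have "frechet_derivative ?g (at x) v = (\<Sum>ps\<in>words r. frechet_derivative (partial ps f) (at x) v * prod_list (map (($) v) ps))" .
  also have "\<dots> = (\<Sum>ps\<in>words r. \<Sum>p\<in>UNIV. v $ p * partial [p] (partial ps f) x * prod_list (map (($) v) ps))"
    by (simp add: frechet_derivative_partial[OF d] sum_distrib_right)
  also have "\<dots> = (\<Sum>p\<in>UNIV. \<Sum>ps\<in>words r. partial (p # ps) f x * prod_list (map (($) v) (p # ps)))"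
    by (subst sum.swap) (simp add: partial_append[symmetric] mult_ac)
  finally have "frechet_derivative ?g (at x) v = (\<Sum>p\<in>UNIV. \<Sum>ps\<in>words r. partial (p # ps) f x * prod_list (map (($) v) (p # ps)))" .
  moreover have "iter_deriv (replicate r v) f = ?g" using Suc by (rule ext)
  ultimately show ?case by (simp add: sum_words_Suc)
qed simp

definition taylor_poly :: "nat \<Rightarrow> (real ^ 'n::finite \<Rightarrow> real) \<Rightarrow> ('n \<Rightarrow> real poly) \<Rightarrow> real poly" where
  "taylor_poly R f K = (\<Sum>r<R. smult (1 / fact r) (\<Sum>ps\<in>words r. smult (partial ps f 0) (curve_monom K ps)))"

lemma poly_curve_monom: "poly (curve_monom K ps) t = prod_list (map (($) (curve K t)) ps)"
  by (induction ps) auto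

lemma taylor_curve:
  fixes f :: "real ^ 'n::finite \<Rightarrow> real"
  assumes sm: "\<And>x. smooth_near f x" and K: "\<And>p. coeff (K p) 0 = 0"
  shows "vanishes R (\<lambda>t. f (curve K t) - poly (taylor_poly R f K) t)"
proof -
  have ex: "\<exists>s. \<bar>s\<bar> \<le> 1 \<and> f v = (\<Sum>r<R. iter_deriv (replicate r v) f 0 / fact r)
      + iter_deriv (replicate R v) f (s *\<^sub>R v) / fact R" for v
  proof -
    obtain s where "\<bar>s\<bar> \<le> \<bar>1\<bar>" "f (0 + 1 *\<^sub>R v) = (\<Sum>r<R. iter_deriv (replicate r v) f 0 / fact r * 1 ^ r)
      + iter_deriv (replicate R v) f (0 + s *\<^sub>R v) / fact R * 1 ^ R"
      using directional_taylor[of 1 f 0 v R] sm by blast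
    then show ?thesis by (intro exI[of _ s]) simp
  qed
  \<comment> \<open>The intermediate point is chosen as a function of the vector. Only its bound
    matters: it makes \<open>\<xi>\<close> tend to 0 with t, so that the derivatives stay bounded
    along it.\<close>
  obtain s where s: "\<bar>s v\<bar> \<le> 1" "f v = (\<Sum>r<R. iter_deriv (replicate r v) f 0 / fact r)
      + iter_deriv (replicate R v) f (s v *\<^sub>R v) / fact R" for v
  proof -
    have "\<forall>v. \<exists>s. \<bar>s\<bar> \<le> 1 \<and> f v = (\<Sum>r<R. iter_deriv (replicate r v) f 0 / fact r)
      + iter_deriv (replicate R v) f (s *\<^sub>R v) / fact R" using ex by blast
    from choice[OF this] show ?thesis using that by blast
  qed
  define \<xi> where "\<xi> t = s (curve K t) *\<^sub>R curve K t" for t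
  have "f (curve K t) - poly (taylor_poly R f K) t
      = (\<Sum>ps\<in>words R. 1 / fact R * (partial ps f (\<xi> t) * poly (curve_monom K ps) t))" for t
    by (subst s(2)) (simp add: taylor_poly_def iter_deriv_replicate[OF sm] poly_sum poly_curve_monom \<xi>_def
        sum_divide_distrib sum_distrib_left)
  moreover have "vanishes R (\<lambda>t. \<Sum>ps\<in>words R. 1 / fact R * (partial ps f (\<xi> t) * poly (curve_monom K ps) t))"
  proof (intro vanishes_sum vanishes_cmult)
    fix ps :: "'n list" assume ps: "ps \<in> {ps. length ps = R}"
    have \<xi>: "vanishes 1 (\<lambda>t. norm (\<xi> t))"
      by (rule vanishes_bound[OF vanishes_norm_curve[of K]])
        (use K s(1) in \<open>auto simp: \<xi>_def intro!: always_eventually mult_left_le_one_le\<close>)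
    have "vanishes 0 (\<lambda>t. partial ps f (\<xi> t))"
      by (rule vanishes_comp_isCont[OF smooth_near_isCont[OF smooth_near_partial[OF sm]] \<xi>])
    from vanishes_mult[OF this vanishes_poly[OF curve_monom_dvd[of K ps, OF K]]] ps
    show "vanishes R (\<lambda>t. partial ps f (\<xi> t) * poly (curve_monom K ps) t)" by simp
  qed
  ultimately show ?thesis by simp
qed

lemma partial_swap:
  fixes f :: "real ^ 'n::finite \<Rightarrow> real"
  assumes "smooth_near f x" shows "partial (us @ p # q # vs) f x = partial (us @ q # p # vs) f x"
  using iter_deriv_swap[OF assms] by (simp add: partial_def)

text \<open>A factor other than the \<open>k\<close>-component starts in degree 2, which raises the
  order of the whole product by one.\<close>

lemma coeff_curve_monom_nonpure:
  assumes "\<And>p. coeff (K p) 0 = 0" "\<And>p. p \<noteq> k \<Longrightarrow> coeff (K p) 1 = 0" "\<not> set ps \<subseteq> {k}" "j \<le> length ps"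
  shows "coeff (curve_monom K ps) j = 0"
proof -
  have "monom 1 (Suc (length ps)) dvd curve_monom K ps" using assms(3)
  proof (induction ps)
    case (Cons p ps)
    have m1: "monom 1 1 dvd K p" unfolding monom_1_dvd_iff' using assms by simp
    show ?case
    proof (cases "set ps \<subseteq> {k}")
      case True
      then have "p \<noteq> k" using Cons by auto
      then have "monom 1 2 dvd K p" unfolding monom_1_dvd_iff' using assms by (auto simp: less_2_cases_iff)
      from mult_dvd_mono[OF this curve_monom_dvd[of K ps, OF assms(1)]] show ?thesis by (simp add: mult_monom)
    next
      case False
      from mult_dvd_mono[OF m1 Cons.IH[OF False]] show ?thesis by (simp add: mult_monom)
    qed
  qed simp
  then show ?thesis using assms(4) unfolding monom_1_dvd_iff' by simp
qed

lemma curve_monom_replicate: "K k = monom 1 1 \<Longrightarrow> curve_monom K (replicate r k) = monom 1 r"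
  by (induction r) (auto simp: mult_monom monom_0 pCons_one)

lemma words_pure: "{ps \<in> words r. set ps \<subseteq> {k}} = {replicate r k}"
  by (auto intro: replicate_eqI dest: in_set_replicate[THEN iffD1])

section \<open>The expansion along the polar curve\<close>

locale corank_two =
  fixes k1 k2 :: "'n::finite" and f :: "real ^ 'n \<Rightarrow> real"
  assumes k12: "k1 \<noteq> k2"
    and smooth: "smooth_on UNIV f"
    and critical: "critical_point f 0"
    and kernel: "hessian_kernel f 0 = span {axis k1 1, axis k2 1}"
    and third: "partial [k1, k1, k1] f 0 = 0" "partial [k1, k2, k2] f 0 = 0" "partial [k1, k1, k2] f 0 = 1"
begin

abbreviation H :: "'n \<Rightarrow> 'n \<Rightarrow> real" where "H p q \<equiv> partial [p, q] f 0"

abbreviation "\<rho> \<equiv> jet_value k1 k2 f"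

abbreviation "K \<equiv> polar k1 k2 \<rho>"

lemma sm: "smooth_near f x"
  using smooth unfolding smooth_near_def by blast

lemma diff_partial: "partial ps f differentiable (at x)"
  by (rule smooth_near_differentiable[OF smooth_near_partial[OF sm]])

lemma H_sym: "H p q = H q p"
  using partial_swap[OF sm, of "[]" p q "[]" 0] by simp

lemma partial1_zero: "partial [p] f 0 = 0"
proof -
  have "frechet_derivative f (at 0) = (\<lambda>_. 0)"
    using critical frechet_derivative_at unfolding critical_point_def by metis
  then show ?thesis by (simp add: partial_def)
qed

lemma iter_deriv_2: "iter_deriv [u, v] f x = (\<Sum>p\<in>UNIV. \<Sum>q\<in>UNIV. u $ p * v $ q * partial [p, q] f x)"
proof -
  have "iter_deriv [v] f y = (\<Sum>q\<in>UNIV. v $ q * partial [q] f y)" for y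
    using frechet_derivative_partial[OF smooth_near_differentiable[OF sm]] by simp
  then have e: "iter_deriv [v] f = (\<lambda>y. \<Sum>q\<in>UNIV. v $ q * partial [q] f y)" by (rule ext)
  have "((\<lambda>y. \<Sum>q\<in>UNIV. v $ q * partial [q] f y) has_derivative
      (\<lambda>w. \<Sum>q\<in>UNIV. v $ q * frechet_derivative (partial [q] f) (at x) w)) (at x)"
    by (intro has_derivative_sum has_derivative_mult_right) (use diff_partial frechet_derivative_works in blast)
  from fun_cong[OF frechet_derivative_at[OF this], of u, symmetric]
  have "iter_deriv [u, v] f x = (\<Sum>q\<in>UNIV. v $ q * frechet_derivative (partial [q] f) (at x) u)"
    using e by simp
  also have "\<dots> = (\<Sum>q\<in>UNIV. \<Sum>p\<in>UNIV. u $ p * v $ q * partial [p, q] f x)"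
    by (simp add: frechet_derivative_partial[OF diff_partial] partial_append[symmetric] sum_distrib_left mult_ac)
  finally show ?thesis by (subst sum.swap)
qed

lemma H_k: "H k1 q = 0" "H k2 q = 0" "H q k1 = 0" "H q k2 = 0"
proof -
  have "axis k1 1 \<in> hessian_kernel f 0" "axis k2 1 \<in> hessian_kernel f 0"
    unfolding kernel by (auto intro: span_base)
  then have "H k1 q = 0" "H k2 q = 0" for q
    unfolding hessian_kernel_def by (auto simp: partial_def)
  then show "H k1 q = 0" "H k2 q = 0" "H q k1 = 0" "H q k2 = 0"
    using H_sym[of q k1] H_sym[of q k2] by metis+
qed

text \<open>Extending \<open>u\<close> by 0 gives a vector in the kernel of the Hessian; the kernel
  is spanned by the \<open>k1\<close>- and \<open>k2\<close>-axes, so the z-components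
  vanish.\<close>

lemma H_nondeg:
  assumes "\<And>p. p \<notin> {k1, k2} \<Longrightarrow> (\<Sum>q\<in>-{k1, k2}. H p q * u q) = 0" "p \<notin> {k1, k2}"
  shows "u p = 0"
proof -
  define w :: "real ^ 'n" where "w = (\<chi> q. if q \<in> {k1, k2} then 0 else u q)"
  have "(\<Sum>q\<in>UNIV. H p q * w $ q) = 0" for p
  proof (cases "p \<in> {k1, k2}")
    case True then show ?thesis using H_k by auto
  next
    case False
    have "(\<Sum>q\<in>UNIV. H p q * w $ q) = (\<Sum>q\<in>-{k1, k2}. H p q * u q)"
      by (rule sum.mono_neutral_cong_right) (auto simp: w_def)
    then show ?thesis using assms(1)[OF False] by simp
  qed
  then have z: "(\<Sum>q\<in>UNIV. w $ q * H q p) = 0" for p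
    using H_sym[of _ p] by (simp add: mult.commute[of "w $ _"])
  have "iter_deriv [w, v] f 0 = (\<Sum>q\<in>UNIV. v $ q * (\<Sum>p\<in>UNIV. w $ p * H p q))" for v
    unfolding iter_deriv_2 by (subst sum.swap) (simp add: sum_distrib_left mult_ac)
  then have "w \<in> hessian_kernel f 0" unfolding hessian_kernel_def using z by simp
  then have "w \<in> span {axis k1 1, axis k2 1}" using kernel by simp
  then obtain a b where "w = a *\<^sub>R axis k1 1 + b *\<^sub>R axis k2 1"
    unfolding span_insert span_singleton by (auto simp: algebra_simps eq_diff_eq)
  then have "w $ p = 0" using assms(2) by (auto simp: axis_def)
  then show ?thesis using assms(2) by (simp add: w_def)
qed

text \<open>Needed for c = 1, where it makes the matrix behind \<open>hess_z_inv\<close> invertible,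
  and for c = 1/2, the quadratic part of \<open>f\<close> in the Morse lemma.\<close>

lemma block_matrix_left_inverse:
  fixes M :: "real ^ 'n ^ 'n"
  assumes M: "M = (\<chi> i j. if i \<notin> {k1, k2} \<and> j \<notin> {k1, k2} then c * H i j else if i = j then 1 else 0)" and "c \<noteq> 0"
  shows "\<exists>N. N ** M = mat 1"
proof -
  have "w = 0" if "M *v w = 0" for w
  proof -
    have w: "(\<Sum>q\<in>UNIV. M $ p $ q * w $ q) = 0" for p
      using arg_cong[OF that, of "\<lambda>v. v $ p"] by (simp add: matrix_vector_mult_def)
    have k: "w $ p = 0" if "p \<in> {k1, k2}" for p
    proof -
      have "(\<Sum>q\<in>UNIV. M $ p $ q * w $ q) = (\<Sum>q\<in>UNIV. if q = p then w $ q else 0)"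
        by (rule sum.cong) (use that in \<open>auto simp: M\<close>)
      then show ?thesis using w by simp
    qed
    have "(\<Sum>q\<in>-{k1, k2}. H p q * w $ q) = 0" if "p \<notin> {k1, k2}" for p
    proof -
      have "(\<Sum>q\<in>UNIV. M $ p $ q * w $ q) = (\<Sum>q\<in>-{k1, k2}. c * (H p q * w $ q))"
        by (rule sum.mono_neutral_cong_right) (use that k in \<open>auto simp: M\<close>)
      then show ?thesis using w \<open>c \<noteq> 0\<close> by (simp flip: sum_distrib_left)
    qed
    from H_nondeg[of "($) w", OF this] k show ?thesis by (auto simp: vec_eq_iff)
  qed
  then have "inj ((*v) M)" using linear_injective_0[OF matrix_vector_mul_linear] by blast
  then show ?thesis using matrix_left_invertible_injective by blast
qed

lemma H_inverse:
  assumes "p \<notin> {k1, k2}" "r \<notin> {k1, k2}"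
  shows "(\<Sum>q\<in>-{k1, k2}. H p q * hess_z_inv k1 k2 f q r) = (if p = r then 1 else 0)"
proof -
  define M :: "real ^ 'n ^ 'n" where
    "M = (\<chi> i j. if i \<notin> {k1, k2} \<and> j \<notin> {k1, k2} then partial [i, j] f 0 else if i = j then 1 else 0)"
  have "\<exists>N. N ** M = mat 1"
    by (rule block_matrix_left_inverse[of M 1]) (simp_all add: M_def cong: if_cong)
  then have "invertible M" by (simp add: invertible_left_inverse)
  then have "M ** matrix_inv M = mat 1"
    unfolding invertible_def matrix_inv_def by (rule someI_ex[THEN conjunct1])
  then have "(M ** matrix_inv M) $ p $ r = (if p = r then 1 else 0)" by (simp add: mat_def)
  moreover have "(M ** matrix_inv M) $ p $ r = (\<Sum>q\<in>-{k1, k2}. H p q * hess_z_inv k1 k2 f q r)"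
    unfolding matrix_matrix_mult_def hess_z_inv_def M_def[symmetric]
    by (simp, rule sum.mono_neutral_cong_right) (use assms in \<open>auto simp: M_def\<close>)
  ultimately show ?thesis by simp
qed

lemma third_swap: "partial [k1, k2, k1] f 0 = 1" "partial [k2, k1, k1] f 0 = 1" "partial [k2, k2, k1] f 0 = 0"
  using partial_swap[OF sm, of "[k1]" k1 k2 "[]" 0] partial_swap[OF sm, of "[]" k1 k2 "[k1]" 0]
    partial_swap[OF sm, of "[k2]" k1 k2 "[]" 0] partial_swap[OF sm, of "[]" k1 k2 "[k2]" 0] third by simp_all

lemma inv: "polar_inv k1 k2 H \<rho> (i + 2) (i + 2) (K i)"
  by (rule polar_inv_polar[OF k12]) (use third_swap H_inverse in auto)

lemma K_0: "coeff (K i p) 0 = 0" and K_k2: "K i k2 = monom 1 1" and K_1: "p \<noteq> k2 \<Longrightarrow> coeff (K i p) 1 = 0"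
  and K_z: "p \<notin> {k1, k2} \<Longrightarrow> j \<le> i + 2 \<Longrightarrow> (\<Sum>q\<in>-{k1, k2}. H p q * coeff (K i q) j) + grad_coeff \<rho> (K i) p j = 0"
  and K_k1: "j \<le> i + 2 \<Longrightarrow> grad_coeff \<rho> (K i) k1 j = 0"
  using inv[of i] unfolding polar_inv_def by blast+

text \<open>Links the formal \<open>grad_coeff\<close> to \<open>f\<close>: the term of order 0
  vanishes at the critical point, order 1 gives the Hessian, and orders above \<open>j\<close>
  contribute nothing because the curve passes through 0.\<close>

lemma coeff_taylor_grad:
  assumes "j < R" "R > 1"
  shows "coeff (taylor_poly R (partial [p] f) (K i)) j = (\<Sum>q\<in>-{k1, k2}. H p q * coeff (K i q) j) + grad_coeff \<rho> (K i) p j"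
proof -
  let ?c = "\<lambda>r. 1 / fact r * (\<Sum>ps\<in>words r. partial (ps @ [p]) f 0 * coeff (curve_monom (K i) ps) j)"
  have "coeff (taylor_poly R (partial [p] f) (K i)) j = (\<Sum>r<R. ?c r)"
    by (simp add: taylor_poly_def coeff_sum partial_append)
  also have "{..<R} = {0, 1} \<union> {2..<R}" using assms(2) by auto
  also have "(\<Sum>r\<in>{0, 1} \<union> {2..<R}. ?c r) = (?c 0 + ?c 1) + (\<Sum>r=2..<R. ?c r)"
    by (subst sum.union_disjoint) auto
  also have "?c 0 = 0" by (simp add: partial1_zero)
  also have "?c 1 = (\<Sum>q\<in>UNIV. H q p * coeff (K i q) j)"
    using sum_words_Suc[of "\<lambda>ps. partial (ps @ [p]) f 0 * coeff (curve_monom (K i) ps) j" 0] by simp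
  also have "\<dots> = (\<Sum>q\<in>UNIV. H p q * coeff (K i q) j)"
    by (intro sum.cong refl arg_cong2[where f = "(*)"] H_sym)
  also have "\<dots> = (\<Sum>q\<in>-{k1, k2}. H p q * coeff (K i q) j)"
    by (rule sum.mono_neutral_right) (use H_k in auto)
  also have "(\<Sum>r=2..<R. ?c r) = (\<Sum>r=2..j. ?c r)"
  proof (rule sum.mono_neutral_right)
    show "\<forall>r\<in>{2..<R} - {2..j}. ?c r = 0"
    proof
      fix r assume "r \<in> {2..<R} - {2..j}"
      then have "j < r" by auto
      then have "coeff (curve_monom (K i) ps) j = 0" if "length ps = r" for ps
        using curve_monom_dvd[of "K i" ps, OF K_0] that unfolding monom_1_dvd_iff' by simp
      then show "?c r = 0" by simp
    qed
  qed (use assms in auto)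
  finally show ?thesis by (simp add: grad_coeff_def)
qed

lemma grad_vanishes:
  assumes "p \<noteq> k2" shows "vanishes (i + 3) (\<lambda>t. partial [p] f (curve (K i) t))"
proof -
  let ?T = "taylor_poly (i + 3) (partial [p] f) (K i)"
  have "coeff ?T j = 0" if "j < i + 3" for j
  proof (cases "p = k1")
    case True
    have "(\<Sum>q\<in>-{k1, k2}. H k1 q * coeff (K i q) j) = 0" using H_k by simp
    then show ?thesis using coeff_taylor_grad[OF that] K_k1[of j i] that True by simp
  next
    case False
    then show ?thesis using coeff_taylor_grad[OF that] K_z[of p j i] that assms by simp
  qed
  then have "vanishes (i + 3) (poly ?T)" by (intro vanishes_poly) (simp add: monom_1_dvd_iff')
  from vanishes_add[OF taylor_curve[of "partial [p] f" "K i", OF smooth_near_partial[OF sm] K_0] this] show ?thesis by simp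
qed

text \<open>Second-order Taylor expansion in the difference \<delta> of the two curves. As \<delta>
  has order i + 2 in \<open>k1\<close> and i + 3 in z, the gradient of order i + 3 gives at least 2
  i + 5 in the linear term. Quadratic terms involving \<open>k1\<close> have order 2 (i + 2) plus
  one more from the second derivative, which vanishes at 0; those in z alone have order 2 (i +
  3).\<close>

lemma curve_diff_vanishes:
  assumes "i \<le> j"
  shows "vanishes (2 * i + 5) (\<lambda>t. f (curve (K j) t) - f (curve (K i) t))"
proof -
  define \<delta> where "\<delta> t = curve (K j) t - curve (K i) t" for t
  have \<delta>1: "vanishes (i + 2) (\<lambda>t. \<delta> t $ k1)"
    by (rule vanishes_cong[OF vanishes_poly[OF polar_tail(1)[OF assms k12, of \<rho>]]]) (simp add: \<delta>_def)
  have \<delta>z: "vanishes (i + 3) (\<lambda>t. \<delta> t $ p)" if "p \<noteq> k1" for p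
    by (rule vanishes_cong[OF vanishes_poly[OF polar_tail(2)[OF assms k12 that, of \<rho>]]]) (simp add: \<delta>_def)
  have \<delta>2: "\<delta> t $ k2 = 0" for t by (simp add: \<delta>_def K_k2)
  have ex: "\<exists>s. \<bar>s\<bar> \<le> 1 \<and> f (curve (K j) t) = f (curve (K i) t) + iter_deriv [\<delta> t] f (curve (K i) t)
      + iter_deriv [\<delta> t, \<delta> t] f (curve (K i) t + s *\<^sub>R \<delta> t) / 2" for t
  proof -
    obtain s where "\<bar>s\<bar> \<le> \<bar>1\<bar>" "f (curve (K i) t + 1 *\<^sub>R \<delta> t) = (\<Sum>r<2. iter_deriv (replicate r (\<delta> t)) f (curve (K i) t) / fact r * 1 ^ r)
      + iter_deriv (replicate 2 (\<delta> t)) f (curve (K i) t + s *\<^sub>R \<delta> t) / fact 2 * 1 ^ 2"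
      using directional_taylor[of 1 f "curve (K i) t" "\<delta> t" 2] sm by blast
    then show ?thesis by (intro exI[of _ s]) (simp add: numeral_2_eq_2 \<delta>_def)
  qed
  have "\<forall>t. \<exists>s. \<bar>s\<bar> \<le> 1 \<and> f (curve (K j) t) = f (curve (K i) t) + iter_deriv [\<delta> t] f (curve (K i) t)
      + iter_deriv [\<delta> t, \<delta> t] f (curve (K i) t + s *\<^sub>R \<delta> t) / 2" using ex by blast
  from choice[OF this] obtain s where s: "\<And>t. \<bar>s t\<bar> \<le> 1"
    "\<And>t. f (curve (K j) t) = f (curve (K i) t) + iter_deriv [\<delta> t] f (curve (K i) t)
      + iter_deriv [\<delta> t, \<delta> t] f (curve (K i) t + s t *\<^sub>R \<delta> t) / 2" by blast
  define \<xi> where "\<xi> t = curve (K i) t + s t *\<^sub>R \<delta> t" for t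
  have n\<delta>: "vanishes 1 (\<lambda>t. norm (\<delta> t))"
  proof (rule vanishes_norm_vec)
    fix p show "vanishes 1 (\<lambda>t. \<delta> t $ p)"
      by (cases "p = k1") (auto intro: vanishes_mono[OF \<delta>1] vanishes_mono[OF \<delta>z])
  qed
  have \<xi>: "vanishes 1 (\<lambda>t. norm (\<xi> t))"
  proof (rule vanishes_bound[OF vanishes_add[OF vanishes_norm_curve[OF K_0] n\<delta>]])
    have "norm (\<xi> t) \<le> norm (curve (K i) t) + norm (\<delta> t)" for t
    proof -
      have "norm (s t *\<^sub>R \<delta> t) \<le> norm (\<delta> t)" using s(1)[of t] by (simp add: mult_left_le_one_le)
      then show ?thesis unfolding \<xi>_def using norm_triangle_ineq[of "curve (K i) t" "s t *\<^sub>R \<delta> t"] by linarith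
    qed
    then show "\<forall>\<^sub>F t in at 0. \<bar>norm (\<xi> t)\<bar> \<le> \<bar>norm (curve (K i) t) + norm (\<delta> t)\<bar>"
      by (intro always_eventually) simp
  qed
  have 1: "vanishes (2 * i + 5) (\<lambda>t. \<delta> t $ p * partial [p] f (curve (K i) t))" for p
  proof -
    consider "p = k2" | "p = k1" | "p \<notin> {k1, k2}" by blast
    then show ?thesis
    proof cases
      case 1 then show ?thesis by (simp add: \<delta>2 vanishes_0)
    next
      case 2
      show ?thesis unfolding 2
        by (rule vanishes_mono[OF vanishes_mult[OF \<delta>1 grad_vanishes[OF k12, of i]]]) simp
    next
      case 3 then show ?thesis
        by (intro vanishes_mono[OF vanishes_mult[OF \<delta>z grad_vanishes[of p i]]]) auto
    qed
  qed
  have 2: "vanishes (2 * i + 5) (\<lambda>t. \<delta> t $ p * \<delta> t $ q * partial [p, q] f (\<xi> t))" for p q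
  proof (cases "p = k1 \<or> q = k1")
    case True
    then have "H p q = 0" using H_k by auto
    then have v: "vanishes 1 (\<lambda>t. partial [p, q] f (\<xi> t))"
      by (intro vanishes_comp_differentiable[OF diff_partial _ \<xi>]) auto
    have "vanishes (i + 2) (\<lambda>t. \<delta> t $ p)" "vanishes (i + 2) (\<lambda>t. \<delta> t $ q)"
    proof -
      have "vanishes (i + 2) (\<lambda>t. \<delta> t $ r)" for r
        by (cases "r = k1") (use \<delta>1 in \<open>auto intro: vanishes_mono[OF \<delta>z]\<close>)
      then show "vanishes (i + 2) (\<lambda>t. \<delta> t $ p)" "vanishes (i + 2) (\<lambda>t. \<delta> t $ q)" by auto
    qed
    from vanishes_mult[OF vanishes_mult[OF this] v] show ?thesis
      by (rule vanishes_mono) simp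
  next
    case False
    have v: "vanishes 0 (\<lambda>t. partial [p, q] f (\<xi> t))"
      by (rule vanishes_comp_isCont[OF smooth_near_isCont[OF smooth_near_partial[OF sm]] \<xi>])
    from False have "vanishes (i + 3) (\<lambda>t. \<delta> t $ p)" "vanishes (i + 3) (\<lambda>t. \<delta> t $ q)"
      using \<delta>z by auto
    from vanishes_mult[OF vanishes_mult[OF this] v] show ?thesis
      by (rule vanishes_mono) simp
  qed
  have "f (curve (K j) t) - f (curve (K i) t) = (\<Sum>p\<in>UNIV. \<delta> t $ p * partial [p] f (curve (K i) t))
      + 1 / 2 * (\<Sum>p\<in>UNIV. \<Sum>q\<in>UNIV. \<delta> t $ p * \<delta> t $ q * partial [p, q] f (\<xi> t))" for t
    unfolding s(2)[of t] iter_deriv_2 \<xi>_def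
    using frechet_derivative_partial[OF smooth_near_differentiable[OF sm]] by simp
  moreover have "vanishes (2 * i + 5) (\<lambda>t. (\<Sum>p\<in>UNIV. \<delta> t $ p * partial [p] f (curve (K i) t))
      + 1 / 2 * (\<Sum>p\<in>UNIV. \<Sum>q\<in>UNIV. \<delta> t $ p * \<delta> t $ q * partial [p, q] f (\<xi> t)))"
    by (intro vanishes_add vanishes_cmult vanishes_sum 1 2)
  ultimately show ?thesis by simp
qed

text \<open>The index is the exponent of t, so that \<open>dcoef m\<close> is the number d with
  index m + 1. For m = 3 only the pure derivative remains.\<close>

definition dcoef :: "nat \<Rightarrow> real" where
  "dcoef m = partial (replicate m k2) f 0 + (if m = 3 then 0 else d_rest k1 k2 m \<rho>)"

lemma coeff_taylor_sum:
  "coeff (taylor_poly R f (K i)) j = (\<Sum>r<R. 1 / fact r * (\<Sum>ps\<in>words r. partial ps f 0 * coeff (curve_monom (K i) ps) j))"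
  by (simp add: taylor_poly_def coeff_sum)

lemma taylor_term_small:
  assumes "j < r"
  shows "(\<Sum>ps\<in>words r. partial ps f 0 * coeff (curve_monom (K i) ps) j) = 0"
proof -
  have "coeff (curve_monom (K i) ps) j = 0" if "length ps = r" for ps
    using curve_monom_dvd[of "K i" ps, OF K_0] that assms unfolding monom_1_dvd_iff' by simp
  then show ?thesis by simp
qed

text \<open>In degree j the words of length j contribute only through the linear part of the curve,
  which is t in the direction \<open>k2\<close>.\<close>

lemma taylor_term_diag:
  "(\<Sum>ps\<in>words j. partial ps f 0 * coeff (curve_monom (K i) ps) j) = partial (replicate j k2) f 0"
proof -
  have "(\<Sum>ps\<in>words j. partial ps f 0 * coeff (curve_monom (K i) ps) j)
      = (\<Sum>ps\<in>{replicate j k2}. partial ps f 0 * coeff (curve_monom (K i) ps) j)"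
  proof (rule sum.mono_neutral_right)
    show "\<forall>ps\<in>words j - {replicate j k2}. partial ps f 0 * coeff (curve_monom (K i) ps) j = 0"
    proof
      fix ps assume "ps \<in> words j - {replicate j k2}"
      then have "\<not> set ps \<subseteq> {k2}" "j \<le> length ps" using words_pure[of j k2] by auto
      from coeff_curve_monom_nonpure[OF K_0 K_1 this] show "partial ps f 0 * coeff (curve_monom (K i) ps) j = 0" by simp
    qed
  qed (auto simp: finite_words)
  then show ?thesis by (simp add: curve_monom_replicate K_k2)
qed

text \<open>A pure word gives exactly t^r with r < j and leaves no trace in degree j. This is why
  derivatives in \<open>k2\<close> alone stay out of the polynomial part.\<close>

lemma taylor_term_nonpure:
  assumes "r < j"
  shows "(\<Sum>ps\<in>words r. partial ps f 0 * coeff (curve_monom (K i) ps) j)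
    = (\<Sum>ps\<in>{ps \<in> words r. \<not> set ps \<subseteq> {k2}}. partial ps f 0 * coeff (curve_monom (K i) ps) j)"
proof (rule sum.mono_neutral_right)
  show "\<forall>ps\<in>words r - {ps \<in> words r. \<not> set ps \<subseteq> {k2}}. partial ps f 0 * coeff (curve_monom (K i) ps) j = 0"
  proof
    fix ps assume "ps \<in> words r - {ps \<in> words r. \<not> set ps \<subseteq> {k2}}"
    then have "ps \<in> {replicate r k2}" unfolding words_pure[symmetric] by auto
    then show "partial ps f 0 * coeff (curve_monom (K i) ps) j = 0"
      using assms by (simp add: curve_monom_replicate K_k2)
  qed
qed (auto simp: finite_words)

text \<open>Arranged so that the inner sum is the Hessian part of a z-equation, to be replaced by
  means of \<open>K_z\<close>; \<open>l\<close> starts at 2 because the z-components do.\<close>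

lemma taylor_term_2:
  "(\<Sum>ps\<in>words 2. partial ps f 0 * coeff (curve_monom (K i) ps) j)
    = (\<Sum>p\<in>-{k1, k2}. \<Sum>l\<in>{2..j}. coeff (K i p) l * (\<Sum>q\<in>-{k1, k2}. H p q * coeff (K i q) (j - l)))"
proof -
  have "(\<Sum>ps\<in>words 2. partial ps f 0 * coeff (curve_monom (K i) ps) j)
      = (\<Sum>p\<in>UNIV. \<Sum>q\<in>UNIV. H p q * (\<Sum>l\<le>j. coeff (K i p) l * coeff (K i q) (j - l)))"
    by (simp add: sum_words_2 coeff_mult)
  also have "\<dots> = (\<Sum>p\<in>-{k1, k2}. \<Sum>q\<in>-{k1, k2}. H p q * (\<Sum>l\<le>j. coeff (K i p) l * coeff (K i q) (j - l)))"
    by (intro sum.mono_neutral_cong_right) (use H_k in \<open>auto intro!: sum.neutral\<close>)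
  also have "\<dots> = (\<Sum>p\<in>-{k1, k2}. \<Sum>l\<le>j. \<Sum>q\<in>-{k1, k2}. H p q * (coeff (K i p) l * coeff (K i q) (j - l)))"
    by (intro sum.cong refl) (subst sum.swap, simp add: sum_distrib_left)
  also have "\<dots> = (\<Sum>p\<in>-{k1, k2}. \<Sum>l\<in>{2..j}. \<Sum>q\<in>-{k1, k2}. H p q * (coeff (K i p) l * coeff (K i q) (j - l)))"
  proof (rule sum.cong[OF refl])
    fix p assume p: "p \<in> -{k1, k2}"
    let ?g = "\<lambda>l. \<Sum>q\<in>-{k1, k2}. H p q * (coeff (K i p) l * coeff (K i q) (j - l))"
    show "(\<Sum>l\<le>j. ?g l) = (\<Sum>l\<in>{2..j}. ?g l)"
    proof (rule sum.mono_neutral_right)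
      show "\<forall>l\<in>{..j} - {2..j}. ?g l = 0"
      proof
        fix l assume "l \<in> {..j} - {2..j}"
        then have "l = 0 \<or> l = 1" by auto
        then have "coeff (K i p) l = 0" using K_0 K_1 p by auto
        then show "?g l = 0" by simp
      qed
    qed auto
  qed
  finally show ?thesis by (simp add: sum_distrib_left mult_ac)
qed

lemma coeff_taylor_small:
  assumes "j \<le> 3" "j < R"
  shows "coeff (taylor_poly R f (K i)) j = (if j = 0 then f 0 else if j = 3 then dcoef 3 / 6 else 0)"
proof -
  let ?s = "\<lambda>r. \<Sum>ps\<in>words r. partial ps f 0 * coeff (curve_monom (K i) ps) j"
  have "coeff (taylor_poly R f (K i)) j = (\<Sum>r<R. 1 / fact r * ?s r)" by (rule coeff_taylor_sum)
  also have "\<dots> = (\<Sum>r\<le>j. 1 / fact r * ?s r)"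
    by (rule sum.mono_neutral_right) (use assms taylor_term_small in auto)
  also have "\<dots> = (\<Sum>r<j. 1 / fact r * ?s r) + partial (replicate j k2) f 0 / fact j"
    by (simp add: lessThan_Suc_atMost[symmetric] taylor_term_diag)
  also have "(\<Sum>r<j. 1 / fact r * ?s r) = 0"
  proof (rule sum.neutral, rule ballI)
    fix r assume r: "r \<in> {..<j}"
    consider "r = 0" | "r = 1" | "r = 2" using assms(1) r by force
    then show "1 / fact r * ?s r = 0"
    proof cases
      case 1 then show ?thesis using r by simp
    next
      case 2
      have "?s (Suc 0) = 0" by (simp only: sum_words_Suc) (simp add: partial1_zero)
      then show ?thesis using 2 by simp
    next
      case 3
      then have j: "j = 3" using r assms by auto
      have "(\<Sum>l\<in>{2..j}. coeff (K i p) l * (\<Sum>q\<in>-{k1, k2}. H p q * coeff (K i q) (j - l))) = 0" for p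
      proof (rule sum.neutral, rule ballI)
        fix l assume "l \<in> {2..j}"
        then have "j - l = 0 \<or> j - l = 1" using j by auto
        then have "coeff (K i q) (j - l) = 0" if "q \<notin> {k1, k2}" for q using K_0 K_1 that by auto
        then show "coeff (K i p) l * (\<Sum>q\<in>-{k1, k2}. H p q * coeff (K i q) (j - l)) = 0" by simp
      qed
      then show ?thesis unfolding 3 taylor_term_2 by simp
    qed
  qed
  finally have e: "coeff (taylor_poly R f (K i)) j = partial (replicate j k2) f 0 / fact j" by simp
  consider "j = 0" | "j = 1" | "j = 2" | "j = 3" using assms(1) by linarith
  then show ?thesis
  proof cases
    case 4 then show ?thesis using e by (simp add: dcoef_def fact_numeral)
  qed (use e H_k partial1_zero in \<open>auto simp: numeral_2_eq_2\<close>)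
qed

text \<open>Stage m - 4 solves the z-equations up to degree m - 2. As the z-components start in
  degree 2, only these degrees are met in the Hessian term, so it can be traded for
  \<open>grad_coeff\<close>. Apart from the pure derivative of order m, this stage also keeps all
  derivatives at order at most m - 1.\<close>

lemma coeff_taylor_large:
  assumes "m \<ge> 4" "m < R"
  shows "coeff (taylor_poly R f (K (m - 4))) m = dcoef m / fact m"
proof -
  let ?i = "m - 4"
  let ?s = "\<lambda>r. \<Sum>ps\<in>words r. partial ps f 0 * coeff (curve_monom (K ?i) ps) m"
  have "coeff (taylor_poly R f (K ?i)) m = (\<Sum>r<R. 1 / fact r * ?s r)" by (rule coeff_taylor_sum)
  also have "\<dots> = (\<Sum>r\<in>{0,1,2} \<union> ({3..<m} \<union> {m}). 1 / fact r * ?s r)"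
    by (rule sum.mono_neutral_right) (use assms taylor_term_small in auto)
  also have "\<dots> = (?s 0 + ?s 1 + 1 / 2 * ?s 2) + ((\<Sum>r=3..<m. 1 / fact r * ?s r) + 1 / fact m * ?s m)"
    using assms(1) by (subst sum.union_disjoint; (subst sum.union_disjoint)?) (auto simp: fact_2)
  also have "?s 0 = 0" using assms by simp
  also have "?s 1 = 0" unfolding One_nat_def by (simp only: sum_words_Suc) (simp add: partial1_zero)
  also have "?s 2 = - (\<Sum>p\<in>-{k1, k2}. \<Sum>l\<in>{2..m}. coeff (K ?i p) l * grad_coeff \<rho> (K ?i) p (m - l))"
    unfolding taylor_term_2 sum_negf[symmetric]
  proof (intro sum.cong refl)
    fix p l assume "p \<in> -{k1, k2}" "l \<in> {2..m}"
    moreover from this have "m - l \<le> ?i + 2" using assms(1) by auto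
    ultimately show "coeff (K ?i p) l * (\<Sum>q\<in>-{k1, k2}. H p q * coeff (K ?i q) (m - l)) =
      - (coeff (K ?i p) l * grad_coeff \<rho> (K ?i) p (m - l))"
      using K_z[of p "m - l" ?i] assms(1) by (simp add: eq_neg_iff_add_eq_0 flip: distrib_left)
  qed
  also have "?s m = partial (replicate m k2) f 0" by (rule taylor_term_diag)
  also have "(\<Sum>r=3..<m. 1 / fact r * ?s r)
     = (\<Sum>r=3..<m. 1 / fact r * (\<Sum>ps\<in>{ps \<in> words r. \<not> set ps \<subseteq> {k2}}. \<rho> (Deriv ps) * coeff (curve_monom (K ?i) ps) m))"
    by (intro sum.cong refl) (simp add: taylor_term_nonpure)
  finally show ?thesis
    using assms(1) by (simp add: dcoef_def d_rest_def Let_def add_divide_distrib)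
qed

theorem polar_expansion:
  assumes "m \<ge> 3" "m \<le> i + 4"
  shows "vanishes (Suc m) (\<lambda>t. f (curve (K i) t) - f 0 - (\<Sum>j=3..m. dcoef j / fact j * t ^ j))"
proof -
  let ?T = "taylor_poly (Suc m) f"
  have c: "coeff (?T (K i)) j = (if j = 0 then f 0 else if j \<ge> 3 then dcoef j / fact j else 0)" if j: "j \<le> m" for j
  proof (cases "j \<le> 3")
    case True
    then show ?thesis using coeff_taylor_small[of j "Suc m" i] j by (auto simp: fact_numeral)
  next
    case False
    have "j - 4 \<le> i" using assms j by simp
    \<comment> \<open>Passing from stage j - 4 to stage i makes an error of order 2 (j - 4) + 5 = 2
      j - 3, which is at least j + 1 because j \<ge> 4.\<close>
    have "vanishes (Suc j) (\<lambda>t. f (curve (K i) t) - f (curve (K (j - 4)) t))"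
      by (rule vanishes_mono[OF curve_diff_vanishes[OF \<open>j - 4 \<le> i\<close>]]) (use False in auto)
    note A = this
    have B: "vanishes (Suc j) (\<lambda>t. f (curve (K l) t) - poly (?T (K l)) t)" for l
      by (rule vanishes_mono[OF taylor_curve[OF sm K_0]]) (use j in auto)
    have "vanishes (Suc j) (\<lambda>t. (f (curve (K i) t) - f (curve (K (j - 4)) t)) -
       (f (curve (K i) t) - poly (?T (K i)) t) + (f (curve (K (j - 4)) t) - poly (?T (K (j - 4))) t))"
      by (rule vanishes_add[OF vanishes_diff[OF A B] B])
    then have "vanishes (Suc j) (poly (?T (K i) - ?T (K (j - 4))))" by (rule vanishes_cong) simp
    from vanishes_poly_coeff[OF this, of j] have "coeff (?T (K i)) j = coeff (?T (K (j - 4))) j" by simp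
    then show ?thesis using coeff_taylor_large[of j "Suc m"] False j by simp
  qed
  let ?P = "[:f 0:] + (\<Sum>j=3..m. monom (dcoef j / fact j) j)"
  have "coeff (?T (K i) - ?P) j = 0" if "j < Suc m" for j
    using c[of j] that by (cases j) (auto simp: coeff_sum)
  then have "vanishes (Suc m) (poly (?T (K i) - ?P))"
    by (intro vanishes_poly) (simp add: monom_1_dvd_iff')
  from vanishes_add[OF taylor_curve[of f "K i", OF sm K_0] this]
  show ?thesis by (simp add: poly_sum poly_monom algebra_simps)
qed

end

section \<open>Integral remainders and division by powers of a variable\<close>

lemma line_taylor_integral:
  fixes F :: "'a::euclidean_space \<Rightarrow> real"
  assumes "\<And>t. t \<in> {0..1} \<Longrightarrow> smooth_near F (b + (t * c) *\<^sub>R v)" "n > 0"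
  shows "F (b + c *\<^sub>R v) = (\<Sum>r<n. c ^ r / fact r * iter_deriv (replicate r v) F b)
    + c ^ n * integral {0..1} (\<lambda>t. (1 - t) ^ (n - 1) / fact (n - 1) * iter_deriv (replicate n v) F (b + (t * c) *\<^sub>R v))"
proof -
  define D where "D m t = c ^ m * iter_deriv (replicate m v) F (b + (t * c) *\<^sub>R v)" for m t
  have der: "(D m has_vector_derivative D (Suc m) t) (at t within {0..1})" if "m < n" "0 \<le> t" "t \<le> 1" for m t
  proof -
    have s: "smooth_near (iter_deriv (replicate m v) F) (b + (t * c) *\<^sub>R v)"
      using assms(1)[of t] that by (intro smooth_near_iter_deriv) auto
    then have "iter_deriv (replicate m v) F differentiable (at (b + t *\<^sub>R (c *\<^sub>R v)))"
      using smooth_near_differentiable by auto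
    from has_derivative_along_line[OF this]
    have "((\<lambda>t. iter_deriv (replicate m v) F (b + (t * c) *\<^sub>R v)) has_real_derivative
        frechet_derivative (iter_deriv (replicate m v) F) (at (b + (t * c) *\<^sub>R v)) (c *\<^sub>R v)) (at t)" by simp
    moreover have "frechet_derivative (iter_deriv (replicate m v) F) (at (b + (t * c) *\<^sub>R v)) (c *\<^sub>R v)
        = c * iter_deriv (replicate (Suc m) v) F (b + (t * c) *\<^sub>R v)"
      using linear_scale[OF has_derivative_linear[OF smooth_near_has_derivative[OF s]]] by simp
    ultimately have "((\<lambda>t. iter_deriv (replicate m v) F (b + (t * c) *\<^sub>R v)) has_real_derivative
        c * iter_deriv (replicate (Suc m) v) F (b + (t * c) *\<^sub>R v)) (at t)" by simp
    from DERIV_cmult[OF this, of "c ^ m"]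
    show ?thesis unfolding D_def has_real_derivative_iff_has_vector_derivative
      by (simp add: has_vector_derivative_at_within mult_ac)
  qed
  have "D 0 1 = (\<Sum>i<n. ((1 - 0) ^ i / fact i) *\<^sub>R D i 0) + integral {0..1} (\<lambda>x. ((1 - x) ^ (n - 1) / fact (n - 1)) *\<^sub>R D n x)"
    by (rule Taylor_integral[OF assms(2)]) (use der in auto)
  moreover have "(\<lambda>x. ((1 - x) ^ (n - 1) / fact (n - 1)) *\<^sub>R D n x) =
     (\<lambda>x. c ^ n * ((1 - x) ^ (n - 1) / fact (n - 1) * iter_deriv (replicate n v) F (b + (x * c) *\<^sub>R v)))"
    by (auto simp: D_def mult_ac)
  ultimately show ?thesis by (simp add: D_def mult_ac)
qed

text \<open>Hadamard's lemma with parameters: the remainder in integral form is x^n times an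
  integral that depends smoothly on all variables.\<close>

lemma taylor_remainder_smooth:
  fixes g :: "real \<times> 'a::euclidean_space \<Rightarrow> real"
  assumes sm: "smooth_near g (0, b0)" and n: "n > 0"
  obtains R where "smooth_near R (0, b0)"
    "\<forall>\<^sub>F p in nhds (0, b0). g p = (\<Sum>j<n. fst p ^ j / fact j * iter_deriv (replicate j (1, 0)) g (0, snd p)) + fst p ^ n * R p"
proof -
  define G where "G p = (1 - snd p) ^ (n - 1) / fact (n - 1) *
      iter_deriv (replicate n (1, 0)) g (snd p * fst (fst p), snd (fst p))"
    for p :: "(real \<times> 'a) \<times> real"
  define R where "R p = integral {0..1} (\<lambda>t. G (p, t))" for p
  have smG: "smooth_near G ((0, b0), t)" for t
  proof -
    have 1: "smooth_near (\<lambda>p::(real \<times> 'a) \<times> real. (snd p * fst (fst p), snd (fst p))) ((0, b0), t)"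
      by (intro smooth_near_Pair smooth_near_mult smooth_near_fst smooth_near_snd smooth_near_ident)
    have 2: "smooth_near (\<lambda>p::(real \<times> 'a) \<times> real. iter_deriv (replicate n (1, 0)) g (snd p * fst (fst p), snd (fst p))) ((0, b0), t)"
      by (rule smooth_near_compose[OF _ 1]) (simp add: smooth_near_iter_deriv[OF sm])
    have 3: "smooth_near (\<lambda>p::(real \<times> 'a) \<times> real. (1 - snd p) ^ (n - 1) * (1 / fact (n - 1))) ((0, b0), t)"
      by (intro smooth_near_mult smooth_near_power smooth_near_diff smooth_near_const smooth_near_snd smooth_near_ident)
    from smooth_near_mult[OF 3 2] show ?thesis unfolding G_def by simp
  qed
  have "smooth_near R (0, b0)"
    unfolding R_def using smG by (rule smooth_near_integral)
  moreover have "\<forall>\<^sub>F p in nhds (0, b0). g p =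
      (\<Sum>j<n. fst p ^ j / fact j * iter_deriv (replicate j (1, 0)) g (0, snd p)) + fst p ^ n * R p"
  proof -
    obtain U where U: "open U" "(0, b0) \<in> U" "\<And>q. q \<in> U \<Longrightarrow> smooth_near g q"
      using smooth_near_eventually[OF sm] unfolding eventually_nhds by blast
    obtain S T where ST: "open S" "open T" "0 \<in> S" "b0 \<in> T" "S \<times> T \<subseteq> U"
      using open_prod_elim[OF U(1,2)] by (metis mem_Sigma_iff)
    obtain e where e: "e > 0" "ball 0 e \<subseteq> S" using ST openE by blast
    have "g (x, b) = (\<Sum>j<n. x ^ j / fact j * iter_deriv (replicate j (1, 0)) g (0, b)) + x ^ n * R (x, b)"
      if xb: "x \<in> ball 0 e" "b \<in> T" for x b
    proof -
      have "smooth_near g ((0, b) + (t * x) *\<^sub>R (1, 0))" if "t \<in> {0..1}" for t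
      proof -
        have "\<bar>t * x\<bar> \<le> 1 * \<bar>x\<bar>" unfolding abs_mult by (intro mult_right_mono) (use that in auto)
        then have "t * x \<in> ball 0 e" using xb by simp
        then have "(t * x, b) \<in> U" using e xb ST by blast
        then show ?thesis using U(3) by simp
      qed
      from line_taylor_integral[OF this n] show ?thesis by (simp add: R_def G_def)
    qed
    then have "\<And>p. p \<in> ball 0 e \<times> T \<Longrightarrow> g p =
      (\<Sum>j<n. fst p ^ j / fact j * iter_deriv (replicate j (1, 0)) g (0, snd p)) + fst p ^ n * R p" by auto
    moreover have "open (ball (0::real) e \<times> T)" using ST by (auto intro: open_Times)
    ultimately show ?thesis
      unfolding eventually_nhds using e ST by (intro exI[of _ "ball 0 e \<times> T"]) auto
  qed
  ultimately show ?thesis using that by blast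
qed

lemma eventually_nhds_compose:
  assumes "\<forall>\<^sub>F y in nhds (g x). P y" "isCont g x" shows "\<forall>\<^sub>F x in nhds x. P (g x)"
proof -
  obtain S where "open S" "g x \<in> S" "\<And>y. y \<in> S \<Longrightarrow> P y" using assms(1) unfolding eventually_nhds by blast
  moreover from this obtain T where "open T" "x \<in> T" "\<And>y. y \<in> T \<Longrightarrow> g y \<in> S"
    using assms(2)[unfolded continuous_at_open, rule_format, of S] by blast
  ultimately show ?thesis unfolding eventually_nhds by blast
qed

lemma eventually_nhds_imp_at: "eventually P (nhds a) \<Longrightarrow> eventually P (at a)"
  by (auto simp: eventually_at_filter elim: eventually_mono)

text \<open>The Taylor polynomial of degree below n inherits order n from \<open>F\<close> and is
  therefore zero; only the smooth remainder term is left.\<close>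

lemma smooth_vanishes_factor:
  fixes F :: "real \<Rightarrow> real"
  assumes sm: "smooth_near F 0" and v: "vanishes n F"
  obtains h where "smooth_near h 0" "\<forall>\<^sub>F t in nhds 0. F t = t ^ n * h t"
proof (cases "n = 0")
  case True then show ?thesis using that[of F] sm by simp
next
  case False
  \<comment> \<open>A dummy second variable, to fit the form with parameters.\<close>
  define g :: "real \<times> real \<Rightarrow> real" where "g p = F (fst p)" for p
  have "smooth_near g (0, 0)" unfolding g_def
    by (rule smooth_near_compose[of F]) (use sm in \<open>auto intro!: smooth_intros\<close>)
  then obtain R where R: "smooth_near R (0, 0)"
    "\<forall>\<^sub>F p in nhds (0, 0). g p = (\<Sum>j<n. fst p ^ j / fact j * iter_deriv (replicate j (1, 0)) g (0, snd p)) + fst p ^ n * R p"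
    using taylor_remainder_smooth False by blast
  define h where "h t = R (t, 0)" for t
  define q where "q = (\<Sum>j<n. monom (iter_deriv (replicate j (1, 0)) g (0, 0) / fact j) j)"
  have smh: "smooth_near h 0"
    unfolding h_def by (rule smooth_near_compose[of R]) (use R in \<open>auto intro!: smooth_intros\<close>)
  have e: "\<forall>\<^sub>F t in nhds 0. F t = poly q t + t ^ n * h t"
  proof -
    have "isCont (\<lambda>t::real. (t, 0::real)) 0" by (intro continuous_intros)
    from eventually_nhds_compose[OF _ this, of "\<lambda>p. g p = (\<Sum>j<n. fst p ^ j / fact j * iter_deriv (replicate j (1, 0)) g (0, snd p)) + fst p ^ n * R p"] R(2)
    show ?thesis by (auto elim!: eventually_mono simp: g_def h_def q_def poly_sum poly_monom mult_ac)
  qed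
  have "vanishes n (\<lambda>t. F t - t ^ n * h t)"
    using vanishes_mult[OF vanishes_power vanishes_isCont[OF smooth_near_isCont[OF smh]], of n]
    by (intro vanishes_diff[OF v]) simp
  then have "vanishes n (poly q)"
    by (rule vanishes_cong) (use e in \<open>auto simp: eventually_at_filter elim: eventually_mono\<close>)
  then have "coeff q j = 0" if "j < n" for j using vanishes_poly_coeff that by blast
  moreover have "coeff q j = 0" if "j \<ge> n" for j using that by (auto simp: q_def coeff_sum)
  ultimately have "q = 0" by (metis leading_coeff_0_iff not_le)
  then show ?thesis using that[OF smh] e by simp
qed

lemma vanishes_differentiable:
  fixes F :: "real \<Rightarrow> real"
  assumes "F differentiable (at 0)" "F 0 = 0" shows "vanishes 1 F"
  by (rule vanishes_comp_differentiable[of F 1 "\<lambda>t. t", OF assms])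
    (auto intro: vanishesI[of _ 1])

text \<open>An estimate O(t^(n+1)) alone cannot be differentiated; smoothness permits writing
  \<open>F\<close> as t^(n+1) times a smooth function first.\<close>

lemma vanishes_deriv:
  fixes F :: "real \<Rightarrow> real"
  assumes "smooth_near F 0" "vanishes (Suc n) F" "\<forall>\<^sub>F t in nhds 0. (F has_real_derivative F' t) (at t)"
  shows "vanishes n F'"
proof -
  obtain h where h: "smooth_near h 0" "\<forall>\<^sub>F t in nhds 0. F t = t ^ Suc n * h t"
    using smooth_vanishes_factor[OF assms(1,2)] .
  define h' where "h' t = frechet_derivative h (at t) 1" for t
  have dh: "\<forall>\<^sub>F t in nhds 0. (h has_real_derivative h' t) (at t)"
    using smooth_near_eventually[OF h(1)]
  proof eventually_elim
    case (elim t)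
    from has_derivative_along_line[of h 0 t 1] smooth_near_differentiable[OF elim]
    show ?case by (simp add: h'_def)
  qed
  have "\<forall>\<^sub>F t in nhds 0. F' t = t ^ n * (of_nat (Suc n) * h t + t * h' t)"
    using eventually_eventually[THEN iffD2, OF h(2)] dh assms(3)
  proof eventually_elim
    case (elim t)
    have "((\<lambda>t. t ^ Suc n * h t) has_real_derivative t ^ Suc n * h' t + of_nat (Suc n) * t ^ n * h t) (at t)"
      by (rule derivative_eq_intros elim(2) refl | simp)+
    moreover have "((\<lambda>t. t ^ Suc n * h t) has_real_derivative F' t) (at t)"
      using DERIV_cong_ev[OF refl elim(1) refl] elim(3) by simp
    ultimately show ?case using DERIV_unique by (fastforce simp: algebra_simps)
  qed
  moreover have "vanishes (n + 0) (\<lambda>t. t ^ n * (of_nat (Suc n) * h t + t * h' t))"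
    by (intro vanishes_mult vanishes_power vanishes_isCont smooth_near_isCont)
      (auto simp: h'_def intro!: smooth_intros smooth_near_deriv h)
  ultimately show ?thesis
    by (intro vanishes_cong[OF _ eventually_nhds_imp_at[where P = "\<lambda>t. F' t = t ^ n * (of_nat (Suc n) * h t + t * h' t)"]]) simp
qed

section \<open>Gradients along regular curves\<close>

text \<open>The key invariant: in the coordinates of the normal form the gradient cannot vanish to order
  \<open>m\<close> along a regular curve.\<close>

lemma D_gradient_order:
  fixes X Y :: "real \<Rightarrow> real"
  assumes X: "(X has_real_derivative a) (at 0)" "X 0 = 0" and Y: "(Y has_real_derivative b) (at 0)" "Y 0 = 0"
    and c: "c \<noteq> 0" and m: "m \<ge> 3"
    and v1: "vanishes m (\<lambda>t. X t * Y t)" and v2: "vanishes m (\<lambda>t. X t ^ 2 + c * Y t ^ (m - 1))"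
  shows "a = 0 \<and> b = 0"
proof -
  \<comment> \<open>Blow-up: the quotients have the limits \<open>a\<close> and \<open>b\<close>,
    and the two estimates turn into statements of order m - 2 about them.\<close>
  define x y where "x t = X t / t" and "y t = Y t / t" for t
  have x: "(x \<longlongrightarrow> a) (at 0)" and y: "(y \<longlongrightarrow> b) (at 0)"
    using X Y unfolding x_def y_def by (simp_all add: DERIV_def)
  have ev: "\<forall>\<^sub>F t in at (0::real). t \<noteq> 0" by (simp add: eventually_at_filter)
  have cancel: "vanishes k g" if "vanishes (j + k) (\<lambda>t. t ^ j * g t)" for j k g
    using that
  proof (induction j)
    case (Suc j)
    have "vanishes (Suc (j + k)) (\<lambda>t. t * (t ^ j * g t))" using Suc.prems by (simp add: mult_ac)
    from Suc.IH[OF vanishes_cancel[OF this]] show ?case .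
  qed simp
  have m2: "2 + (m - 2) = m" using m by simp
  have xy: "vanishes (m - 2) (\<lambda>t. x t * y t)"
  proof (rule cancel[of 2])
    have "vanishes m (\<lambda>t. t ^ 2 * (x t * y t))"
    proof (rule vanishes_cong[OF v1])
      show "\<forall>\<^sub>F t in at 0. t ^ 2 * (x t * y t) = X t * Y t"
        using ev by eventually_elim (simp add: x_def y_def power2_eq_square)
    qed
    then show "vanishes (2 + (m - 2)) (\<lambda>t. t ^ 2 * (x t * y t))" unfolding m2 .
  qed
  have "((\<lambda>t. x t * y t) \<longlongrightarrow> a * b) (at 0)" using x y by (rule tendsto_mult)
  moreover have "((\<lambda>t. x t * y t) \<longlongrightarrow> 0) (at 0)" using tendsto_vanishes[OF xy] m by simp
  ultimately have ab: "a = 0 \<or> b = 0" using LIM_unique by fastforce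
  have v2': "vanishes (m - 2) (\<lambda>t. x t ^ 2 + c * (t ^ (m - 3) * y t ^ (m - 1)))"
  proof (rule cancel[of 2])
    have "vanishes m (\<lambda>t. t ^ 2 * (x t ^ 2 + c * (t ^ (m - 3) * y t ^ (m - 1))))"
    proof (rule vanishes_cong[OF v2])
      show "\<forall>\<^sub>F t in at 0. t ^ 2 * (x t ^ 2 + c * (t ^ (m - 3) * y t ^ (m - 1))) = X t ^ 2 + c * Y t ^ (m - 1)"
        using ev
      proof eventually_elim
        case (elim t)
        have "m - 1 = (m - 3) + 2" using m by simp
        then have "t ^ (m - 1) = t ^ (m - 3) * t ^ 2" by (metis power_add)
        then have "t ^ 2 * (t ^ (m - 3) * y t ^ (m - 1)) = (t * y t) ^ (m - 1)"
          by (simp add: power_mult_distrib mult_ac)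
        moreover have "t * y t = Y t" "t * x t = X t" using elim by (auto simp: x_def y_def)
        ultimately show ?case by (simp add: distrib_left power_mult_distrib[symmetric] mult.left_commute[of _ c])
      qed
    qed
    then show "vanishes (2 + (m - 2)) (\<lambda>t. t ^ 2 * (x t ^ 2 + c * (t ^ (m - 3) * y t ^ (m - 1))))" unfolding m2 .
  qed
  have lim: "((\<lambda>t. x t ^ 2 + c * (t ^ (m - 3) * y t ^ (m - 1))) \<longlongrightarrow> a ^ 2 + c * (0 ^ (m - 3) * b ^ (m - 1))) (at 0)"
    by (intro tendsto_intros x y)
  moreover have "((\<lambda>t. x t ^ 2 + c * (t ^ (m - 3) * y t ^ (m - 1))) \<longlongrightarrow> 0) (at 0)"
    using tendsto_vanishes[OF v2'] m by simp
  ultimately have e: "a ^ 2 + c * (0 ^ (m - 3) * b ^ (m - 1)) = 0" using LIM_unique by blast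
  \<comment> \<open>For m = 3 the limit is a^2 + c b^2, since 0^0 = 1, and one of a, b is already
    known to vanish. For larger m the limit only gives a = 0.\<close>
  show ?thesis
  proof (cases "m = 3")
    case True
    then show ?thesis using e ab c by auto
  next
    case False
    then have a: "a = 0" using e m by (simp add: power_0_left)
    have "b = 0"
    proof (rule ccontr)
      \<comment> \<open>If b were nonzero, dividing the product estimate by \<open>y\<close> would
        give \<open>x\<close> the order m - 2. Then the term c t^(m-3) y^(m-1) would have order m -
        2 as well, although \<open>y\<close> tends to b.\<close>
      assume b: "b \<noteq> 0"
      have evy: "\<forall>\<^sub>F t in at 0. y t \<noteq> 0" using tendsto_imp_eventually_ne[OF y b] .
      have "vanishes 0 (\<lambda>t. inverse (y t))" by (rule vanishes_tendsto[OF tendsto_inverse[OF y b]])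
      from vanishes_mult[OF xy this] have w: "vanishes (m - 2) (\<lambda>t. x t * y t * inverse (y t))" by simp
      have vx: "vanishes (m - 2) x"
        by (rule vanishes_cong[OF w]) (use evy in \<open>eventually_elim, simp\<close>)
      have "vanishes (m - 2) (\<lambda>t. x t ^ 2)"
        unfolding power2_eq_square by (rule vanishes_mono[OF vanishes_mult[OF vx vx]]) simp
      from vanishes_diff[OF v2' this] have "vanishes (m - 2) (\<lambda>t. t ^ (m - 3) * (c * y t ^ (m - 1)))"
        by (simp add: mult.left_commute)
      moreover have "m - 2 = (m - 3) + 1" using m by simp
      ultimately have "vanishes ((m - 3) + 1) (\<lambda>t. t ^ (m - 3) * (c * y t ^ (m - 1)))" by (simp only:)
      then have "vanishes 1 (\<lambda>t. c * y t ^ (m - 1))" by (rule cancel)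
      then have "((\<lambda>t. c * y t ^ (m - 1)) \<longlongrightarrow> 0) (at 0)" by (rule tendsto_vanishes) simp
      moreover have "((\<lambda>t. c * y t ^ (m - 1)) \<longlongrightarrow> c * b ^ (m - 1)) (at 0)" by (intro tendsto_intros y)
      ultimately have "c * b ^ (m - 1) = 0" using LIM_unique by blast
      then show False using c b by simp
    qed
    then show ?thesis using a by simp
  qed
qed

lemma frechet_compose_partial:
  fixes F :: "real ^ 'n::finite \<Rightarrow> real" and \<psi> :: "'a::euclidean_space \<Rightarrow> real ^ 'n"
  assumes "smooth_near F (\<psi> x)" "smooth_near \<psi> x"
  shows "frechet_derivative (\<lambda>x. F (\<psi> x)) (at x) v = (\<Sum>q\<in>UNIV. frechet_derivative \<psi> (at x) v $ q * partial [q] F (\<psi> x))"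
proof -
  have "((\<lambda>x. F (\<psi> x)) has_derivative (\<lambda>v. frechet_derivative F (at (\<psi> x)) (frechet_derivative \<psi> (at x) v))) (at x)"
    by (rule has_derivative_compose[OF smooth_near_has_derivative[OF assms(2)] smooth_near_has_derivative[OF assms(1)]])
  from fun_cong[OF frechet_derivative_at[OF this], of v, symmetric]
  show ?thesis using frechet_derivative_partial[OF smooth_near_differentiable[OF assms(1)]] by simp
qed

text \<open>By the chain rule the gradient of \<open>G\<close> is the gradient of \<open>F\<close>
  at the image point, multiplied by the Jacobian. The entries of the Jacobian stay bounded, so the
  order cannot drop.\<close>

lemma grad_compose_vanishes:
  fixes F G :: "real ^ 'n::finite \<Rightarrow> real" and \<psi> :: "real ^ 'n \<Rightarrow> real ^ 'n"
  assumes F: "smooth_near F 0" and \<psi>: "smooth_near \<psi> 0" "\<psi> 0 = 0"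
    and G: "\<forall>\<^sub>F x in nhds 0. G x = F (\<psi> x)"
    and \<delta>: "vanishes 1 (\<lambda>t. norm (\<delta> t))" "\<And>q. vanishes m (\<lambda>t. partial [q] F (\<psi> (\<delta> t)))"
  shows "vanishes m (\<lambda>t. partial [p] G (\<delta> t))"
proof -
  have "\<forall>\<^sub>F x in nhds 0. smooth_near F (\<psi> x)"
    by (rule eventually_nhds_compose[OF _ smooth_near_isCont[OF \<psi>(1)]]) (use smooth_near_eventually[OF F] \<psi>(2) in simp)
  then have "\<forall>\<^sub>F x in nhds 0. partial [p] G x = (\<Sum>q\<in>UNIV. frechet_derivative \<psi> (at x) (axis p 1) $ q * partial [q] F (\<psi> x))"
    using eventually_eventually[THEN iffD2, OF G] smooth_near_eventually[OF \<psi>(1)]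
  proof eventually_elim
    case (elim x)
    then obtain U where "open U" "x \<in> U" "\<And>y. y \<in> U \<Longrightarrow> G y = F (\<psi> y)" unfolding eventually_nhds by blast
    then have "partial [p] G x = frechet_derivative (\<lambda>x. F (\<psi> x)) (at x) (axis p 1)"
      unfolding partial_Cons partial_Nil using frechet_derivative_cong_open[of U x G "\<lambda>x. F (\<psi> x)"] by simp
    then show ?case using frechet_compose_partial[OF elim(1,3)] by simp
  qed
  moreover have "(\<delta> \<longlongrightarrow> 0) (at 0)" using tendsto_vanishes[OF \<delta>(1)] tendsto_norm_zero_iff by auto
  ultimately have ev: "\<forall>\<^sub>F t in at 0. partial [p] G (\<delta> t) = (\<Sum>q\<in>UNIV. frechet_derivative \<psi> (at (\<delta> t)) (axis p 1) $ q * partial [q] F (\<psi> (\<delta> t)))"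
    by (rule eventually_compose_filterlim)
  have "vanishes (0 + m) (\<lambda>t. frechet_derivative \<psi> (at (\<delta> t)) (axis p 1) $ q * partial [q] F (\<psi> (\<delta> t)))" for q
  proof (rule vanishes_mult[OF _ \<delta>(2)])
    show "vanishes 0 (\<lambda>t. frechet_derivative \<psi> (at (\<delta> t)) (axis p 1) $ q)"
      by (rule vanishes_comp_isCont[OF smooth_near_isCont \<delta>(1)])
        (intro smooth_near_vec_nth smooth_near_deriv \<psi>)
  qed
  then have "vanishes m (\<lambda>t. \<Sum>q\<in>UNIV. frechet_derivative \<psi> (at (\<delta> t)) (axis p 1) $ q * partial [q] F (\<psi> (\<delta> t)))"
    by (intro vanishes_sum) simp
  then show ?thesis using ev by (rule vanishes_cong)
qed

lemma diffeo_germE: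
  assumes "diffeo_germ \<phi>"
  obtains \<theta> where "smooth_near \<phi> 0" "\<phi> 0 = 0" "smooth_near \<theta> 0" "\<theta> 0 = 0"
    "\<forall>\<^sub>F x in nhds 0. \<theta> (\<phi> x) = x" "\<forall>\<^sub>F y in nhds 0. \<phi> (\<theta> y) = y"
proof -
  obtain U V \<theta> where *: "\<phi> 0 = 0" "open U" "open V" "0 \<in> U" "homeomorphism U V \<phi> \<theta>" "smooth_on U \<phi>" "smooth_on V \<theta>"
    using assms unfolding diffeo_germ_def by blast
  have "\<phi> 0 \<in> V" using *(4,5) unfolding homeomorphism_def by blast
  then have "0 \<in> V" "\<theta> 0 = 0" using * homeomorphism_apply1[OF *(5,4)] by auto
  moreover have "\<forall>\<^sub>F x in nhds 0. \<theta> (\<phi> x) = x" "\<forall>\<^sub>F y in nhds 0. \<phi> (\<theta> y) = y"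
    using * homeomorphism_apply1[OF *(5)] homeomorphism_apply2[OF *(5)] \<open>0 \<in> V\<close> unfolding eventually_nhds by blast+
  ultimately show ?thesis using that[of \<theta>] * smooth_on_imp_near by blast
qed

lemma D_form_partials:
  fixes k1 k2 :: "'n::finite" and A :: "'n \<Rightarrow> 'n \<Rightarrow> real" and c d :: real
  assumes k12: "k1 \<noteq> k2" and A: "\<And>p q. A p q = A q p" and m: "m \<ge> 1"
  defines "g \<equiv> (\<lambda>x. d + (x $ k1)^2 * x $ k2 + c * (x $ k2)^m + (\<Sum>p\<in>-{k1, k2}. \<Sum>q\<in>-{k1, k2}. A p q * x $ p * x $ q))"
  shows "smooth_near g x" "partial [k1] g x = 2 * (x $ k1 * x $ k2)"
    "partial [k2] g x = (x $ k1)^2 + c * of_nat m * (x $ k2)^(m - 1)"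
    "p \<notin> {k1, k2} \<Longrightarrow> partial [p] g x = 2 * (\<Sum>q\<in>-{k1, k2}. A p q * x $ q)"
proof -
  show "smooth_near g x" unfolding g_def by (intro smooth_intros)
  let ?D = "\<lambda>v. 2 * x $ k1 * v $ k1 * x $ k2 + (x $ k1)^2 * v $ k2 + c * (of_nat m * (x $ k2)^(m - 1) * v $ k2)
      + (\<Sum>p\<in>-{k1, k2}. \<Sum>q\<in>-{k1, k2}. A p q * x $ p * v $ q + A p q * v $ p * x $ q)"
  have nth: "((\<lambda>x. x $ i) has_derivative (\<lambda>v. v $ i)) (at x)" for i
    by (rule bounded_linear_imp_has_derivative[OF bounded_linear_vec_nth])
  have "(g has_derivative ?D) (at x)"
    unfolding g_def
    apply (rule has_derivative_eq_rhs)
     apply (rule has_derivative_add has_derivative_const has_derivative_mult has_derivative_power nth has_derivative_sum)+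
    apply (simp add: fun_eq_iff algebra_simps sum.distrib power2_eq_square)
    done
  from fun_cong[OF frechet_derivative_at[OF this], symmetric] have P: "partial [i] g x = ?D (axis i 1)" for i
    by (simp add: partial_def)
  have z: "axis i 1 $ p = (if p = i then 1 else (0::real))" for i p :: 'n by (simp add: axis_def)
  have S: "(\<Sum>p\<in>-{k1, k2}. \<Sum>q\<in>-{k1, k2}. A p q * x $ p * axis i 1 $ q + A p q * axis i 1 $ p * x $ q) = 0" if "i \<in> {k1, k2}" for i
    by (intro sum.neutral ballI) (use that in \<open>auto simp: z\<close>)
  show "partial [k1] g x = 2 * (x $ k1 * x $ k2)" "partial [k2] g x = (x $ k1)^2 + c * of_nat m * (x $ k2)^(m - 1)"
    unfolding P S[of k1, simplified] S[of k2, simplified] using k12 by (simp_all add: z)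
  assume p: "p \<notin> {k1, k2}"
  have "(\<Sum>i\<in>-{k1, k2}. \<Sum>j\<in>-{k1, k2}. A i j * x $ i * axis p 1 $ j + A i j * axis p 1 $ i * x $ j)
    = (\<Sum>i\<in>-{k1, k2}. \<Sum>j\<in>-{k1, k2}. if j = p then A i j * x $ i else 0) + (\<Sum>i\<in>-{k1, k2}. if i = p then (\<Sum>j\<in>-{k1, k2}. A i j * x $ j) else 0)"
    unfolding sum.distrib z by (intro arg_cong2[where f = "(+)"] sum.cong refl) auto
  also have "\<dots> = (\<Sum>i\<in>-{k1, k2}. A i p * x $ i) + (\<Sum>j\<in>-{k1, k2}. A p j * x $ j)"
    using p by (simp cong: sum.cong)
  also have "(\<Sum>i\<in>-{k1, k2}. A i p * x $ i) = (\<Sum>j\<in>-{k1, k2}. A p j * x $ j)"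
    by (intro sum.cong refl) (simp add: A[of _ p])
  finally show "partial [p] g x = 2 * (\<Sum>q\<in>-{k1, k2}. A p q * x $ q)"
    unfolding P using p by (auto simp: z)
qed

lemma frechet_derivative_right_inverse:
  fixes \<theta> :: "'a::euclidean_space \<Rightarrow> 'b::euclidean_space" and \<phi> :: "'b \<Rightarrow> 'a"
  assumes "smooth_near \<theta> 0" "\<theta> 0 = 0" "smooth_near \<phi> 0" "\<forall>\<^sub>F y in nhds 0. \<phi> (\<theta> y) = y"
    and "frechet_derivative \<theta> (at 0) v = 0"
  shows "v = 0"
proof -
  have "((\<lambda>y. \<phi> (\<theta> y)) has_derivative (\<lambda>v. frechet_derivative \<phi> (at 0) (frechet_derivative \<theta> (at 0) v))) (at 0)"
    using has_derivative_compose[OF smooth_near_has_derivative[OF assms(1)], of \<phi>] smooth_near_has_derivative[OF assms(3)] assms(2) by simp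
  moreover obtain V where V: "open V" "0 \<in> V" "\<And>y. y \<in> V \<Longrightarrow> \<phi> (\<theta> y) = y"
    using assms(4) unfolding eventually_nhds by blast
  ultimately have "((\<lambda>y. y) has_derivative (\<lambda>v. frechet_derivative \<phi> (at 0) (frechet_derivative \<theta> (at 0) v))) (at 0)"
    using has_derivative_transform_within_open[OF _ V(1,2)] by metis
  from fun_cong[OF has_derivative_unique[OF this has_derivative_ident], of v]
  have "frechet_derivative \<phi> (at 0) 0 = v" using assms(5) by simp
  then show ?thesis
    using linear_0[OF has_derivative_linear[OF smooth_near_has_derivative[OF assms(3)]]] by simp
qed

text \<open>In the coordinates of the normal form the curve stays regular and the order of the
  gradient is kept. The z-part of the gradient is linear in z and has order at least 2, so
  nondegeneracy removes the z-components of the velocity; \<open>D_gradient_order\<close> removes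
  the other two.\<close>

lemma not_D_form:
  fixes k1 k2 :: "'n::finite" and f :: "real ^ 'n \<Rightarrow> real"
  assumes k12: "k1 \<noteq> k2" and sm: "smooth_near f 0"
    and red: "reducible_to_D k1 k2 (Suc m) c f" and c: "c \<noteq> 0" and m: "m \<ge> 3"
    and \<gamma>: "(\<gamma> has_vector_derivative v) (at 0)" "\<gamma> 0 = 0" "v \<noteq> 0"
    and grad: "\<And>p. vanishes m (\<lambda>t. partial [p] f (\<gamma> t))"
  shows False
proof -
  obtain d Q where Q: "nondeg_quadratic_form k1 k2 Q"
    and gr: "germ_reducible f (\<lambda>x. d + (x $ k1)^2 * x $ k2 + c * (x $ k2)^m + Q x)"
    using red unfolding reducible_to_D_def by auto
  obtain A where A: "\<And>p q. A p q = A q p" "Q = (\<lambda>x. \<Sum>p\<in>-{k1, k2}. \<Sum>q\<in>-{k1, k2}. A p q * x $ p * x $ q)"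
    "\<And>u. (\<forall>p\<in>-{k1, k2}. (\<Sum>q\<in>-{k1, k2}. A p q * u q) = 0) \<Longrightarrow> (\<forall>p\<in>-{k1, k2}. u p = 0)"
    using Q unfolding nondeg_quadratic_form_def by blast
  define g where "g = (\<lambda>x. d + (x $ k1)^2 * x $ k2 + c * (x $ k2)^m + (\<Sum>p\<in>-{k1, k2}. \<Sum>q\<in>-{k1, k2}. A p q * x $ p * x $ q))"
  note P = D_form_partials[where A = A and m = m and c = c and d = d, OF k12 A(1), folded g_def]
  obtain \<phi> where \<phi>: "diffeo_germ \<phi>" "\<forall>\<^sub>F x in nhds 0. f (\<phi> x) = g x"
    using gr A(2) unfolding germ_reducible_def g_def by auto
  obtain \<theta> where \<theta>: "smooth_near \<phi> 0" "\<phi> 0 = 0" "smooth_near \<theta> 0" "\<theta> 0 = 0"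
    "\<forall>\<^sub>F x in nhds 0. \<theta> (\<phi> x) = x" "\<forall>\<^sub>F y in nhds 0. \<phi> (\<theta> y) = y" using diffeo_germE[OF \<phi>(1)] .
  define \<delta> where "\<delta> t = \<theta> (\<gamma> t)" for t
  define w where "w = frechet_derivative \<theta> (at 0) v"
  have \<delta>: "(\<delta> has_vector_derivative w) (at 0)"
  proof -
    have "(\<theta> has_derivative frechet_derivative \<theta> (at 0)) (at (\<gamma> 0))"
      using smooth_near_has_derivative[OF \<theta>(3)] \<gamma>(2) by simp
    from has_derivative_compose[OF \<gamma>(1)[unfolded has_vector_derivative_def] this]
    show ?thesis unfolding has_vector_derivative_def \<delta>_def[abs_def] w_def
      using linear_scale[OF has_derivative_linear[OF smooth_near_has_derivative[OF \<theta>(3)]]] by simp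
  qed
  have \<delta>0: "\<delta> 0 = 0" by (simp add: \<delta>_def \<gamma> \<theta>)
  have w0: "w \<noteq> 0"
    using frechet_derivative_right_inverse[OF \<theta>(3,4,1,6)] \<gamma>(3) unfolding w_def by blast
  have comp: "((\<lambda>t. \<delta> t $ p) has_real_derivative w $ p) (at 0)" for p
    using bounded_linear.has_vector_derivative[OF bounded_linear_vec_nth \<delta>]
    by (simp add: has_real_derivative_iff_has_vector_derivative)
  have n\<delta>: "vanishes 1 (\<lambda>t. norm (\<delta> t))"
    by (rule vanishes_norm_vec, rule vanishes_differentiable)
      (use comp \<delta>0 in \<open>auto simp: real_differentiable_def\<close>)
  have gg: "\<forall>\<^sub>F x in nhds 0. g x = f (\<phi> x)" using \<phi>(2) by (simp add: eq_commute)
  have ev\<gamma>: "\<forall>\<^sub>F t in at 0. \<phi> (\<delta> t) = \<gamma> t"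
  proof -
    have "isCont \<gamma> 0" using \<gamma>(1) has_vector_derivative_continuous by blast
    from eventually_nhds_compose[OF _ this, of "\<lambda>y. \<phi> (\<theta> y) = y"] \<theta>(6) \<gamma>(2)
    have "\<forall>\<^sub>F t in nhds 0. \<phi> (\<theta> (\<gamma> t)) = \<gamma> t" by simp
    then show ?thesis by (auto simp: eventually_at_filter \<delta>_def elim: eventually_mono)
  qed
  have v: "vanishes m (\<lambda>t. partial [p] g (\<delta> t))" for p
  proof (rule grad_compose_vanishes[OF sm \<theta>(1,2) gg n\<delta>])
    fix q show "vanishes m (\<lambda>t. partial [q] f (\<phi> (\<delta> t)))"
      by (rule vanishes_cong[OF grad[of q]]) (use ev\<gamma> in \<open>auto elim: eventually_mono\<close>)
  qed
  have z: "w $ p = 0" if p: "p \<notin> {k1, k2}" for p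
  proof -
    have "(\<Sum>q\<in>-{k1, k2}. A p q * w $ q) = 0" if p: "p \<notin> {k1, k2}" for p
    proof -
      have d: "((\<lambda>t. 2 * (\<Sum>q\<in>-{k1, k2}. A p q * \<delta> t $ q)) has_real_derivative 2 * (\<Sum>q\<in>-{k1, k2}. A p q * w $ q)) (at 0)"
        by (intro DERIV_cmult DERIV_sum comp)
      have V2: "vanishes 2 (\<lambda>t. 2 * (\<Sum>q\<in>-{k1, k2}. A p q * \<delta> t $ q))"
        using vanishes_mono[OF v[of p], of 2] P(4)[OF _ p] m by simp
      have ev: "\<forall>\<^sub>F t in at (0::real). t \<noteq> 0" by (simp add: eventually_at_filter)
      have "vanishes 2 (\<lambda>t. t * (2 * (\<Sum>q\<in>-{k1, k2}. A p q * \<delta> t $ q) / t))"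
        by (rule vanishes_cong[OF V2]) (use ev in \<open>eventually_elim, simp\<close>)
      then have "vanishes (Suc 1) (\<lambda>t. t * (2 * (\<Sum>q\<in>-{k1, k2}. A p q * \<delta> t $ q) / t))"
        by (simp only: numeral_2_eq_2 One_nat_def)
      then have "vanishes 1 (\<lambda>t. 2 * (\<Sum>q\<in>-{k1, k2}. A p q * \<delta> t $ q) / t)" by (rule vanishes_cancel)
      then have "((\<lambda>t. 2 * (\<Sum>q\<in>-{k1, k2}. A p q * \<delta> t $ q) / t) \<longlongrightarrow> 0) (at 0)" by (rule tendsto_vanishes) simp
      moreover have "((\<lambda>t. 2 * (\<Sum>q\<in>-{k1, k2}. A p q * \<delta> t $ q) / t) \<longlongrightarrow> 2 * (\<Sum>q\<in>-{k1, k2}. A p q * w $ q)) (at 0)"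
        using d \<delta>0 by (simp add: DERIV_def)
      ultimately show ?thesis using LIM_unique by fastforce
    qed
    then show ?thesis using A(3)[of "($) w"] p by auto
  qed
  have "vanishes m (\<lambda>t. \<delta> t $ k1 * \<delta> t $ k2)"
    using vanishes_cmult[OF v[of k1], of "1/2"] P(2) m by simp
  moreover have "vanishes m (\<lambda>t. (\<delta> t $ k1)^2 + c * of_nat m * (\<delta> t $ k2)^(m - 1))"
    using v[of k2] P(3) m by simp
  ultimately have "w $ k1 = 0 \<and> w $ k2 = 0"
    using D_gradient_order[OF comp _ comp, of k1 k2 "c * of_nat m" m] \<delta>0 c m by simp
  then have "w $ i = 0" for i using z[of i] by (cases "i \<in> {k1, k2}") auto
  then have "w = 0" by (simp add: vec_eq_iff)
  then show False using w0 by blast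
qed

text \<open>The curve is the image of the \<open>k2\<close>-axis: on that axis only the
  \<open>k2\<close>-component of the gradient of the normal form survives, equal to c m
  t^(m-1).\<close>

lemma D_form_gradient:
  fixes k1 k2 :: "'n::finite" and f :: "real ^ 'n \<Rightarrow> real"
  assumes k12: "k1 \<noteq> k2" and red: "reducible_to_D k1 k2 (Suc m) c f" and m: "m \<ge> 1"
  obtains \<gamma> v where "(\<gamma> has_vector_derivative v) (at 0)" "\<gamma> 0 = 0" "v \<noteq> 0"
    "\<And>p. vanishes (m - 1) (\<lambda>t. partial [p] f (\<gamma> t))"
proof -
  obtain d Q where Q: "nondeg_quadratic_form k1 k2 Q"
    and gr: "germ_reducible f (\<lambda>x. d + (x $ k1)^2 * x $ k2 + c * (x $ k2)^m + Q x)"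
    using red unfolding reducible_to_D_def by auto
  obtain A where A: "\<And>p q. A p q = A q p" "Q = (\<lambda>x. \<Sum>p\<in>-{k1, k2}. \<Sum>q\<in>-{k1, k2}. A p q * x $ p * x $ q)"
    using Q unfolding nondeg_quadratic_form_def by blast
  define g where "g = (\<lambda>x. d + (x $ k1)^2 * x $ k2 + c * (x $ k2)^m + (\<Sum>p\<in>-{k1, k2}. \<Sum>q\<in>-{k1, k2}. A p q * x $ p * x $ q))"
  note P = D_form_partials[where A = A and m = m and c = c and d = d, OF k12 A(1) m, folded g_def]
  obtain \<phi> where \<phi>: "diffeo_germ \<phi>" "\<forall>\<^sub>F x in nhds 0. f (\<phi> x) = g x"
    using gr A(2) unfolding germ_reducible_def g_def by auto
  obtain \<theta> where \<theta>: "smooth_near \<phi> 0" "\<phi> 0 = 0" "smooth_near \<theta> 0" "\<theta> 0 = 0"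
    "\<forall>\<^sub>F x in nhds 0. \<theta> (\<phi> x) = x" "\<forall>\<^sub>F y in nhds 0. \<phi> (\<theta> y) = y" using diffeo_germE[OF \<phi>(1)] .
  define e :: "real ^ 'n" where "e = axis k2 1"
  define \<gamma> where "\<gamma> t = \<phi> (t *\<^sub>R e)" for t
  define v where "v = frechet_derivative \<phi> (at 0) e"
  have \<gamma>: "(\<gamma> has_vector_derivative v) (at 0)"
  proof -
    have "((\<lambda>t. t *\<^sub>R e) has_derivative (\<lambda>t. t *\<^sub>R e)) (at 0)"
      by (auto intro!: derivative_eq_intros)
    moreover have "(\<phi> has_derivative frechet_derivative \<phi> (at 0)) (at (0 *\<^sub>R e))"
      using smooth_near_has_derivative[OF \<theta>(1)] by simp
    ultimately have "((\<lambda>t. \<phi> (t *\<^sub>R e)) has_derivative (\<lambda>t. frechet_derivative \<phi> (at 0) (t *\<^sub>R e))) (at 0)"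
      by (rule has_derivative_compose)
    then show ?thesis unfolding has_vector_derivative_def \<gamma>_def[abs_def] v_def
      using linear_scale[OF has_derivative_linear[OF smooth_near_has_derivative[OF \<theta>(1)]]] by simp
  qed
  have "e \<noteq> 0" by (simp add: e_def axis_eq_0_iff)
  then have v0: "v \<noteq> 0"
    using frechet_derivative_right_inverse[OF \<theta>(1,2,3,5)] unfolding v_def by blast
  have \<gamma>0: "\<gamma> 0 = 0" by (simp add: \<gamma>_def \<theta>)
  have n\<gamma>: "vanishes 1 (\<lambda>t. norm (\<gamma> t))"
  proof (rule vanishes_norm_vec, rule vanishes_differentiable)
    fix p
    have "((\<lambda>t. \<gamma> t $ p) has_real_derivative v $ p) (at 0)"
      using bounded_linear.has_vector_derivative[OF bounded_linear_vec_nth \<gamma>]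
      by (simp add: has_real_derivative_iff_has_vector_derivative)
    then show "(\<lambda>t. \<gamma> t $ p) differentiable at 0" by (auto simp: real_differentiable_def)
  qed (simp add: \<gamma>0)
  have gg: "\<forall>\<^sub>F y in nhds 0. f y = g (\<theta> y)"
  proof -
    have "\<forall>\<^sub>F y in nhds 0. f (\<phi> (\<theta> y)) = g (\<theta> y)"
      by (rule eventually_nhds_compose[OF _ smooth_near_isCont[OF \<theta>(3)]]) (use \<phi>(2) \<theta>(4) in simp)
    then show ?thesis using \<theta>(6) by eventually_elim simp
  qed
  have "\<forall>\<^sub>F t in nhds 0. \<theta> (\<phi> (t *\<^sub>R e)) = t *\<^sub>R e"
    by (rule eventually_nhds_compose[where g = "\<lambda>t. t *\<^sub>R e"]) (use \<theta>(5) in \<open>auto intro!: continuous_intros\<close>)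
  then have ev: "\<forall>\<^sub>F t in at 0. \<theta> (\<gamma> t) = t *\<^sub>R e"
    by (auto simp: eventually_at_filter \<gamma>_def elim: eventually_mono)
  have "vanishes (m - 1) (\<lambda>t. partial [p] f (\<gamma> t))" for p
  proof (rule grad_compose_vanishes[OF P(1) \<theta>(3,4) gg n\<gamma>])
    fix q
    have e: "e $ k2 = 1" "i \<noteq> k2 \<Longrightarrow> e $ i = 0" for i by (auto simp: e_def axis_def)
    consider "q = k1" | "q = k2" | "q \<notin> {k1, k2}" by blast
    then have "vanishes (m - 1) (\<lambda>t. partial [q] g (t *\<^sub>R e))"
    proof cases
      case 1 then show ?thesis using e(2)[OF k12] by (simp add: P(2) vanishes_0)
    next
      case 2 then show ?thesis using e(1) e(2)[OF k12] vanishes_cmult[OF vanishes_power] by (simp add: P(3))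
    next
      case 3
      have "(\<Sum>j\<in>-{k1, k2}. A q j * (t * e $ j)) = 0" for t by (intro sum.neutral) (auto simp: e(2))
      then show ?thesis using P(4)[OF 3] by (simp add: vanishes_0)
    qed
    then show "vanishes (m - 1) (\<lambda>t. partial [q] g (\<theta> (\<gamma> t)))"
      by (rule vanishes_cong) (use ev in \<open>auto elim: eventually_mono\<close>)
  qed
  then show ?thesis using that \<gamma> \<gamma>0 v0 by blast
qed

section \<open>The normal form in two variables\<close>

lemma smooth_on_iff_near: "open U \<Longrightarrow> smooth_on U f \<longleftrightarrow> (\<forall>x\<in>U. smooth_near f x)"
  unfolding smooth_near_def smooth_on_def by blast

lemma smooth_near_poly:
  fixes p :: "real poly"
  shows "smooth_near f x \<Longrightarrow> smooth_near (\<lambda>x. poly p (f x)) x"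
  by (induction p) (auto intro!: smooth_near_const smooth_near_add smooth_near_mult)

lemma eventually_pos:
  fixes f :: "'a::euclidean_space \<Rightarrow> real"
  assumes "smooth_near f x" "f x > 0" shows "\<forall>\<^sub>F y in nhds x. f y > 0"
  by (rule eventually_nhds_compose[where g = f, OF _ smooth_near_isCont[OF assms(1)]])
    (use assms(2) eventually_nhds_in_open[of "{0<..}" "f x"] in simp)

text \<open>As a polynomial, \<open>tail_quotient n Y w = ((Y - w)\<^bsup>n+1\<^esup> - Y\<^bsup>n+1\<^esup> - (-w)\<^bsup>n+1\<^esup>) / (Y w)\<close>.\<close>

primrec tail_quotient :: "nat \<Rightarrow> real \<Rightarrow> real \<Rightarrow> real" where
  "tail_quotient 0 Y w = 0"
| "tail_quotient (Suc n) Y w = (Y - w) * tail_quotient n Y w - (- w) ^ n - Y ^ n"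

lemma tail_quotient: "(Y - w) ^ Suc n = Y ^ Suc n + (- w) ^ Suc n + Y * w * tail_quotient n Y w"
proof (induction n)
  case (Suc n)
  have "(Y - w) ^ Suc (Suc n) = (Y - w) * (Y ^ Suc n + (- w) ^ Suc n + Y * w * tail_quotient n Y w)"
    using Suc by simp
  also have "\<dots> = Y ^ Suc (Suc n) + (- w) ^ Suc (Suc n) + Y * w * ((Y - w) * tail_quotient n Y w - (- w) ^ n - Y ^ n)"
    by (simp add: algebra_simps)
  finally show ?case by simp
qed simp

lemma tail_quotient_0: "n \<ge> 2 \<Longrightarrow> tail_quotient n 0 0 = 0"
  by (cases n) auto

lemma smooth_near_tail_quotient:
  "smooth_near f x \<Longrightarrow> smooth_near g x \<Longrightarrow> smooth_near (\<lambda>x. tail_quotient n (f x) (g x)) x"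
  by (induction n) (auto intro!: smooth_near_const smooth_near_diff smooth_near_mult smooth_near_power smooth_near_minus)

text \<open>The map (e, s) to (e - s (-e)^m, s) has an invertible derivative wherever s = 0; the
  first component of its local inverse solves the equation.\<close>

lemma implicit_power_equation:
  obtains \<epsilon> :: "real \<times> real \<Rightarrow> real" where "smooth_near \<epsilon> (a0, 0)"
    "\<forall>\<^sub>F q in nhds (a0, 0). \<epsilon> q = fst q + snd q * (- \<epsilon> q) ^ m"
proof -
  define \<Phi> :: "real \<times> real \<Rightarrow> real \<times> real" where "\<Phi> q = (fst q - snd q * (- fst q) ^ m, snd q)" for q
  have sm: "smooth_near \<Phi> q" for q unfolding \<Phi>_def by (intro smooth_intros)
  define D where "D = frechet_derivative (\<lambda>q::real \<times> real. (- fst q) ^ m) (at (a0, 0))"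
  have D: "((\<lambda>q::real \<times> real. (- fst q) ^ m) has_derivative D) (at (a0, 0))"
    unfolding D_def by (rule smooth_near_has_derivative) (intro smooth_intros)
  have "((\<lambda>q::real \<times> real. fst q - snd q * (- fst q) ^ m) has_derivative (\<lambda>v. fst v - (snd (a0, 0::real) * D v + snd v * (- fst (a0, 0::real)) ^ m))) (at (a0, 0))"
    by (intro has_derivative_diff has_derivative_mult D has_derivative_fst has_derivative_snd has_derivative_ident)
  then have "(\<Phi> has_derivative (\<lambda>v. (fst v - snd v * (- a0) ^ m, snd v))) (at (a0, 0))"
    unfolding \<Phi>_def by (intro has_derivative_Pair has_derivative_snd has_derivative_ident) simp
  from frechet_derivative_at[OF this]
  have inj: "v = 0" if "frechet_derivative \<Phi> (at (a0, 0)) v = 0" for v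
    using that by (metis (no_types, lifting) diff_zero mult_zero_left prod.collapse prod.inject zero_prod_def)
  have smU: "smooth_on UNIV \<Phi>" using sm smooth_on_iff_near[of UNIV \<Phi>] by simp
  obtain U' V \<theta> where *: "open U'" "(a0, 0) \<in> U'" "open V" "\<Phi> (a0, 0) \<in> V" "homeomorphism U' V \<Phi> \<theta>" "smooth_on V \<theta>"
    by (rule smooth_local_inverse[OF open_UNIV UNIV_I smU, of "(a0, 0)"]) (use inj in blast)+
  have \<Phi>0: "\<Phi> (a0, 0) = (a0, 0)" by (simp add: \<Phi>_def)
  have "fst (\<theta> q) = fst q + snd q * (- fst (\<theta> q)) ^ m" if "q \<in> V" for q
    using homeomorphism_apply2[OF *(5) that] unfolding \<Phi>_def by (auto simp: prod_eq_iff)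
  then have "\<forall>\<^sub>F q in nhds (a0, 0). fst (\<theta> q) = fst q + snd q * (- fst (\<theta> q)) ^ m"
    using *(3,4) \<Phi>0 unfolding eventually_nhds by metis
  moreover have "smooth_near (\<lambda>q. fst (\<theta> q)) (a0, 0)"
    using smooth_on_imp_near[OF *(3,6)] *(4) \<Phi>0 by (auto intro: smooth_near_fst)
  ultimately show ?thesis using that by blast
qed

text \<open>Put \<open>y u = Y - x\<^sup>2 e\<close> in \<open>x\<^sup>2 (y u) + x\<^sup>4 A + (y u)\<^sup>m k'\<close>. Modulo multiples of \<open>x\<^sup>2 Y\<close> and
  \<open>Y\<^sup>m\<close> what remains is \<open>x\<^sup>4 (A - e + x\<^bsup>2m-4\<^esup> k' (-e)\<^sup>m)\<close>, and \<open>e\<close> is chosen to annihilate it.\<close>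

lemma normal_form_step:
  fixes \<Psi> :: "real \<times> real \<Rightarrow> real"
  assumes m: "m \<ge> 3" and sm: "smooth_near k (0, 0)" "smooth_near u (0, 0)" "smooth_near A (0, 0)"
    and u: "u (0, 0) > 0" and c: "c * k (0, 0) > 0"
    and eq: "\<forall>\<^sub>F p in nhds (0, 0). \<Psi> p = C + snd p ^ m * k p + fst p ^ 2 * (snd p * u p) + fst p ^ 4 * A p"
  obtains a Y \<beta> where "smooth_near a (0, 0)" "a (0, 0) > 0" "smooth_near Y (0, 0)" "Y (0, 0) = 0" "\<beta> > 0"
    "(Y has_derivative (\<lambda>h. \<beta> * snd h)) (at (0, 0))"
    "\<forall>\<^sub>F p in nhds (0, 0). \<Psi> p = C + (fst p * a p) ^ 2 * Y p + c * Y p ^ m"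
proof -
  \<comment> \<open>Rewrites y^m k as (y u)^m k'.\<close>
  define k' where "k' p = k p * u p powr (- real m)" for p
  have smk': "smooth_near k' (0, 0)"
    unfolding k'_def by (intro smooth_near_mult smooth_near_powr sm u)
  have c0: "c \<noteq> 0" using c by auto
  obtain \<epsilon> where \<epsilon>: "smooth_near \<epsilon> (A (0, 0), 0)" "\<forall>\<^sub>F q in nhds (A (0, 0), 0). \<epsilon> q = fst q + snd q * (- \<epsilon> q) ^ m"
    using implicit_power_equation .
  \<comment> \<open>Parameters of the equation for \<open>e\<close>. The exponent 2 m - 4 is what
    (x^2)^m leaves once x^4 is split off; it is positive as m \<ge> 3, so the second entry vanishes
    at 0.\<close>
  define ab where "ab p = (A p, fst p ^ (2 * m - 4) * k' p)" for p :: "real \<times> real"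
  have smab: "smooth_near ab (0, 0)" unfolding ab_def by (intro smooth_intros sm smk')
  have ab0: "ab (0, 0) = (A (0, 0), 0)" using m by (simp add: ab_def power_0_left)
  define e where "e p = \<epsilon> (ab p)" for p
  have sme: "smooth_near e (0, 0)" unfolding e_def by (rule smooth_near_compose) (use \<epsilon> smab ab0 in auto)
  have ev1: "\<forall>\<^sub>F p in nhds (0, 0). e p = A p + fst p ^ (2 * m - 4) * k' p * (- e p) ^ m"
    using eventually_nhds_compose[where g = ab and P = "\<lambda>q. \<epsilon> q = fst q + snd q * (- \<epsilon> q) ^ m",
        OF _ smooth_near_isCont[OF smab]] \<epsilon>(2)
    unfolding ab0 by (simp add: e_def ab_def)
  define w where "w p = fst p ^ 2 * e p" for p
  define Y1 where "Y1 p = snd p * u p + w p" for p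
  \<comment> \<open>Collects all that multiplies x^2 \<open>Y1\<close>: the leading 1 and the mixed
    terms of the m-th power, which vanish at 0.\<close>
  define B where "B p = 1 + k' p * (e p * tail_quotient (m - 1) (Y1 p) (w p))" for p
  have smw: "smooth_near w (0, 0)" unfolding w_def by (intro smooth_intros sme)
  have smY1: "smooth_near Y1 (0, 0)" unfolding Y1_def by (intro smooth_intros sm smw)
  have smB: "smooth_near B (0, 0)"
    unfolding B_def by (intro smooth_near_add smooth_near_mult smooth_near_const smooth_near_tail_quotient smk' sme smY1 smw)
  have B0: "B (0, 0) = 1" using m by (simp add: B_def Y1_def w_def tail_quotient_0)
  have kc0: "k' (0, 0) / c > 0"
  proof -
    have "(c * k (0, 0)) * u (0, 0) powr (- real m) > 0" using c u by simp
    then have "c * k' (0, 0) > 0" by (simp add: k'_def mult.assoc)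
    then show ?thesis by (auto simp: zero_less_mult_iff zero_less_divide_iff)
  qed
  have smkc: "smooth_near (\<lambda>p. k' p / c) (0, 0)"
    unfolding divide_inverse by (intro smooth_intros smk')
  \<comment> \<open>The m-th root absorbs the ratio k'/c into \<open>Y\<close>; the sign condition
    on c makes the ratio positive. The factor \<open>a\<close> below then restores the coefficient
    of x^2, since a^2 r = B.\<close>
  define r where "r p = (k' p / c) powr (1 / real m)" for p
  have smr: "smooth_near r (0, 0)" unfolding r_def by (rule smooth_near_powr[OF smkc kc0])
  have r0: "r (0, 0) > 0" using kc0 unfolding r_def powr_gt_zero by linarith
  define a where "a p = B p powr (1 / 2) * r p powr (- 1 / 2)" for p
  define Y where "Y p = Y1 p * r p" for p
  have "\<forall>\<^sub>F p in nhds (0, 0). \<Psi> p = C + (fst p * a p) ^ 2 * Y p + c * Y p ^ m"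
    using eq ev1 eventually_pos[OF sm(2) u] eventually_pos[OF smkc kc0] eventually_pos[OF smr r0]
      eventually_pos[OF smB, unfolded B0, OF zero_less_one]
  proof eventually_elim
    case (elim p)
    let ?x = "fst p" and ?y = "snd p"
    have "r p ^ m = r p powr real m" using elim(5) by (simp add: powr_realpow)
    also have "\<dots> = (k' p / c) powr 1" using m unfolding r_def powr_powr by simp
    also have "\<dots> = k' p / c" using elim(4) by (intro powr_one) simp
    finally have rm: "r p ^ m = k' p / c" .
    have "(B p powr (1 / 2)) ^ 2 = B p powr 1" "(r p powr (- 1 / 2)) ^ 2 = r p powr (- 1)"
      unfolding power2_eq_square powr_add[symmetric] by simp_all
    then have "(B p powr (1 / 2)) ^ 2 = B p" "(r p powr (- 1 / 2)) ^ 2 * r p = 1"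
      using elim(5,6) by (simp_all add: powr_neg_one)
    then have ar: "(a p) ^ 2 * r p = B p" by (simp add: a_def power_mult_distrib)
    have "u p ^ m * u p powr (- real m) = 1"
      using elim(3) by (simp add: powr_minus powr_realpow)
    then have ym: "?y ^ m * k p = (Y1 p - w p) ^ m * k' p"
      by (simp add: k'_def Y1_def power_mult_distrib)
    have mm: "m = Suc (m - 1)" using m by simp
    have tail: "(Y1 p - w p) ^ m = Y1 p ^ m + (- w p) ^ m + Y1 p * w p * tail_quotient (m - 1) (Y1 p) (w p)"
      by (subst (1 2 3) mm) (rule tail_quotient)
    have "2 * m = 4 + (2 * m - 4)" using m by simp
    then have wm: "(- w p) ^ m = ?x ^ 4 * (?x ^ (2 * m - 4) * (- e p) ^ m)"
      unfolding w_def by (metis mult.assoc mult_minus_right power_add power_mult power_mult_distrib)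
    have "\<Psi> p - C = (Y1 p - w p) ^ m * k' p + ?x ^ 2 * (Y1 p - w p) + ?x ^ 4 * A p"
      using elim(1) ym by (simp add: Y1_def)
    also have "\<dots> = k' p * Y1 p ^ m + ?x ^ 2 * (Y1 p * B p)
        + ?x ^ 4 * (A p + ?x ^ (2 * m - 4) * k' p * (- e p) ^ m - e p)"
      unfolding tail wm B_def by (simp add: w_def algebra_simps power2_eq_square power4_eq_xxxx)
    also have "\<dots> = k' p * Y1 p ^ m + ?x ^ 2 * (Y1 p * B p)" using elim(2) by simp
    also have "k' p * Y1 p ^ m = c * Y p ^ m"
      using rm c0 by (simp add: Y_def power_mult_distrib)
    also have "?x ^ 2 * (Y1 p * B p) = (?x * a p) ^ 2 * Y p"
      unfolding ar[symmetric] by (simp add: Y_def power_mult_distrib mult_ac)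
    finally show ?case by simp
  qed
  moreover have "smooth_near a (0, 0)"
    unfolding a_def by (intro smooth_near_mult smooth_near_powr smB smr) (use B0 r0 in auto)
  moreover have "a (0, 0) > 0" using B0 r0 by (simp add: a_def)
  moreover have smY: "smooth_near Y (0, 0)" unfolding Y_def by (intro smooth_near_mult smY1 smr)
  moreover have "Y (0, 0) = 0" by (simp add: Y_def Y1_def w_def)
  moreover have "u (0, 0) * r (0, 0) > 0" using u r0 by simp
  moreover have "(Y has_derivative (\<lambda>h. (u (0, 0) * r (0, 0)) * snd h)) (at (0, 0))"
  proof -
    have f: "(fst has_derivative fst) (at (0::real, 0::real))" and s: "(snd has_derivative snd) (at (0::real, 0::real))"
      by (intro bounded_linear_imp_has_derivative bounded_linear_fst bounded_linear_snd)+
    have "((\<lambda>p. snd p * u p + fst p * (fst p * e p)) has_derivative (\<lambda>h. snd h * u (0, 0))) (at (0, 0))"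
      using has_derivative_add[OF has_derivative_mult[OF s smooth_near_has_derivative[OF sm(2)]]
          has_derivative_mult[OF f has_derivative_mult[OF f smooth_near_has_derivative[OF sme]]]] by simp
    then have "(Y1 has_derivative (\<lambda>h. snd h * u (0, 0))) (at (0, 0))"
      unfolding Y1_def w_def power2_eq_square mult.assoc .
    from has_derivative_mult[OF this smooth_near_has_derivative[OF smr]]
    show ?thesis unfolding Y_def by (simp add: Y1_def w_def mult_ac)
  qed
  ultimately show ?thesis using that by blast
qed

lemma smooth_factor_linear:
  fixes F :: "real \<Rightarrow> real"
  assumes "smooth_near F 0" "F 0 = 0"
  obtains h where "smooth_near h 0" "\<forall>\<^sub>F t in nhds 0. F t = t * h t" "(F has_real_derivative h 0) (at 0)"
proof -
  have "vanishes 1 F" using vanishes_differentiable smooth_near_differentiable assms by blast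
  then obtain h where h: "smooth_near h 0" "\<forall>\<^sub>F t in nhds 0. F t = t ^ 1 * h t"
    using smooth_vanishes_factor[OF assms(1)] by metis
  have "(h has_real_derivative frechet_derivative h (at 0) 1) (at 0)"
    using has_derivative_along_line[of h 0 0 1] smooth_near_differentiable[OF h(1)] by simp
  then have "((\<lambda>t. t * h t) has_real_derivative 0 * frechet_derivative h (at 0) 1 + 1 * h 0) (at 0)"
    by (auto intro!: derivative_eq_intros)
  then have "(F has_real_derivative h 0) (at 0)"
    using DERIV_cong_ev[OF refl h(2) refl] by simp
  then show ?thesis using that h by simp
qed

text \<open>Takes the axis x = 0 to the curve x = p(y) and fixes y, so that composing with it
  straightens the curve while derivatives in x are still taken along the same lines.\<close>

definition shear :: "real poly \<Rightarrow> real \<times> real \<Rightarrow> real \<times> real" where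
  "shear p q = (poly p (snd q) + fst q, snd q)"

lemma shear_derivative:
  "(shear p has_derivative (\<lambda>h. (poly (pderiv p) (snd q) * snd h + fst h, snd h))) (at q)"
proof -
  have "((\<lambda>q. poly p (snd q)) has_derivative (\<lambda>h. poly (pderiv p) (snd q) * snd h)) (at q)"
    using has_derivative_compose[OF has_derivative_snd[OF has_derivative_ident] poly_DERIV[of p "snd q", unfolded has_field_derivative_def]]
    by simp
  then show ?thesis unfolding shear_def[abs_def]
    by (intro has_derivative_Pair has_derivative_add has_derivative_fst has_derivative_snd has_derivative_ident)
qed

lemma smooth_near_shear: "smooth_near (shear p) q"
  unfolding shear_def[abs_def] by (intro smooth_intros smooth_near_poly)

lemma iter_deriv_shear:
  fixes g :: "real \<times> real \<Rightarrow> real"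
  assumes "smooth_near g (shear p q)"
  shows "iter_deriv (replicate j (1, 0)) (\<lambda>q. g (shear p q)) q = iter_deriv (replicate j (1, 0)) g (shear p q)"
  using assms
proof (induction j arbitrary: q)
  case (Suc j)
  obtain W where W: "open W" "q \<in> W" "\<And>y. y \<in> W \<Longrightarrow> smooth_near g (shear p y)"
    using eventually_nhds_compose[OF smooth_near_eventually[OF Suc.prems] smooth_near_isCont[OF smooth_near_shear]]
    unfolding eventually_nhds by blast
  let ?h = "iter_deriv (replicate j (1, 0)) g"
  have "frechet_derivative (iter_deriv (replicate j (1, 0)) (\<lambda>q. g (shear p q))) (at q) (1, 0)
      = frechet_derivative (\<lambda>q. ?h (shear p q)) (at q) (1, 0)"
    using frechet_derivative_cong_open[OF W(1,2) Suc.IH[OF W(3)]] by simp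
  also have "\<dots> = frechet_derivative ?h (at (shear p q)) (1, 0)"
    using fun_cong[OF frechet_derivative_at[OF has_derivative_compose[OF shear_derivative
          smooth_near_has_derivative[OF smooth_near_iter_deriv[OF Suc.prems, of "replicate j (1, 0)"]]]], of "(1, 0)"] by simp
  finally show ?case by simp
qed simp

text \<open>After the shear, the derivatives in x along the axis are g0 = const + y^m k0, g1 = y^m
  k1, g2 = y u0 and g3 = y u1; these factors come from \<open>v0\<close>, \<open>v1\<close> and the
  derivatives that vanish at 0. Sorting gives y^m (k0 + x k1) + x^2 y (u0/2 + x u1/6) + x^4 A, the
  input of \<open>normal_form_step\<close>.\<close>

theorem planar_normal_form:
  fixes \<psi> :: "real \<times> real \<Rightarrow> real"
  assumes sm: "smooth_near \<psi> (0, 0)" and m: "m \<ge> 3" and c: "c * \<kappa> > 0"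
    and p: "coeff p 0 = 0" "coeff p 1 = 0"
    and v0: "vanishes (Suc m) (\<lambda>t. \<psi> (poly p t, t) - \<psi> (0, 0) - \<kappa> * t ^ m)"
    and v1: "vanishes m (\<lambda>t. iter_deriv [(1, 0)] \<psi> (poly p t, t))"
    and d2: "iter_deriv [(1, 0), (1, 0)] \<psi> (0, 0) = 0"
    and d3: "iter_deriv [(1, 0), (1, 0), (1, 0)] \<psi> (0, 0) = 0" "iter_deriv [(0, 1), (1, 0), (1, 0)] \<psi> (0, 0) = 1"
  obtains X Y \<alpha> \<beta> where "smooth_near X (0, 0)" "X (0, 0) = 0" "smooth_near Y (0, 0)" "Y (0, 0) = 0"
    "\<alpha> \<noteq> 0" "\<beta> \<noteq> 0" "(X has_derivative (\<lambda>h. \<alpha> * fst h)) (at (0, 0))" "(Y has_derivative (\<lambda>h. \<beta> * snd h)) (at (0, 0))"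
    "\<forall>\<^sub>F q in nhds (0, 0). \<psi> q = \<psi> (0, 0) + X q ^ 2 * Y q + c * Y q ^ m"
proof -
  define \<Psi> where "\<Psi> q = \<psi> (shear p q)" for q
  define g where "g j t = iter_deriv (replicate j (1, 0)) \<psi> (poly p t, t)" for j t
  have p0: "poly p 0 = 0" using p by (simp add: poly_0_coeff_0)
  have p1: "poly (pderiv p) 0 = 0" using p by (simp add: poly_0_coeff_0 coeff_pderiv)
  have sh0: "shear p (0, 0) = (0, 0)" by (simp add: shear_def p0)
  have smg: "smooth_near (g j) 0" for j
    unfolding g_def[abs_def]
    by (rule smooth_near_compose[of "iter_deriv (replicate j (1, 0)) \<psi>"])
      (use p0 sm in \<open>auto intro!: smooth_intros smooth_near_poly smooth_near_iter_deriv\<close>)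
  have smPsi: "smooth_near \<Psi> (0, 0)"
    unfolding \<Psi>_def by (rule smooth_near_compose) (use sh0 sm smooth_near_shear in auto)
  obtain A where A: "smooth_near A (0, 0)"
    "\<forall>\<^sub>F q in nhds (0, 0). \<Psi> q = (\<Sum>j<4. fst q ^ j / fact j * iter_deriv (replicate j (1, 0)) \<Psi> (0, snd q)) + fst q ^ 4 * A q"
    using taylor_remainder_smooth[OF smPsi, of 4] by auto
  have gev: "\<forall>\<^sub>F t in nhds 0. iter_deriv (replicate j (1, 0)) \<Psi> (0, t) = g j t" for j
  proof -
    have "\<forall>\<^sub>F q in nhds (0, 0). smooth_near \<psi> (shear p q)"
      by (rule eventually_nhds_compose[OF _ smooth_near_isCont[OF smooth_near_shear]])
        (use smooth_near_eventually[OF sm] sh0 in simp)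
    then have "\<forall>\<^sub>F q in nhds (0, 0). iter_deriv (replicate j (1, 0)) \<Psi> q = iter_deriv (replicate j (1, 0)) \<psi> (shear p q)"
      unfolding \<Psi>_def by eventually_elim (rule iter_deriv_shear)
    then have "\<forall>\<^sub>F t in nhds 0. iter_deriv (replicate j (1, 0)) \<Psi> (0, t) = iter_deriv (replicate j (1, 0)) \<psi> (shear p (0, t))"
      by (intro eventually_nhds_compose[where g = "\<lambda>t::real. (0::real, t)"]) (auto intro!: continuous_intros)
    then show ?thesis by (simp add: g_def shear_def)
  qed
  have vg0: "vanishes m (\<lambda>t. g 0 t - \<psi> (0, 0))"
  proof -
    have "vanishes m (\<lambda>t. (\<psi> (poly p t, t) - \<psi> (0, 0) - \<kappa> * t ^ m) + \<kappa> * t ^ m)"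
      by (intro vanishes_add vanishes_mono[OF v0] vanishes_cmult vanishes_power) simp
    then show ?thesis by (simp add: g_def)
  qed
  have "smooth_near (\<lambda>t. g 0 t - \<psi> (0, 0)) 0" by (intro smooth_intros smg)
  then obtain k0 where k0: "smooth_near k0 0" "\<forall>\<^sub>F t in nhds 0. g 0 t - \<psi> (0, 0) = t ^ m * k0 t"
    using smooth_vanishes_factor vg0 by blast
  have k00: "k0 0 = \<kappa>"
  proof -
    have "vanishes (Suc m) (\<lambda>t. t ^ m * (k0 t - \<kappa>))"
      by (rule vanishes_cong[OF v0])
        (use eventually_nhds_imp_at[OF k0(2)] in \<open>eventually_elim, simp add: g_def algebra_simps\<close>)
    note A = this
    have "vanishes (Suc n) (\<lambda>t. t ^ n * h t) \<Longrightarrow> vanishes 1 h" for n h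
    proof (induction n)
      case (Suc n)
      then show ?case using vanishes_cancel[of "Suc n" "\<lambda>t. t ^ n * h t"] by (simp add: mult_ac)
    qed simp
    from this[OF A] have "vanishes 1 (\<lambda>t. k0 t - \<kappa>)" .
    moreover have "isCont (\<lambda>t. k0 t - \<kappa>) 0" using smooth_near_isCont[OF k0(1)] by (intro continuous_intros)
    ultimately show ?thesis using vanishes_isCont_0[of 1 "\<lambda>t. k0 t - \<kappa>"] by simp
  qed
  have "vanishes m (g 1)" using v1 by (simp add: g_def[abs_def])
  then obtain k1 where k1: "smooth_near k1 0" "\<forall>\<^sub>F t in nhds 0. g 1 t = t ^ m * k1 t"
    using smooth_vanishes_factor[OF smg] by blast
  have g20: "g 2 0 = 0" "g 3 0 = 0" using d2 d3 p0 by (simp_all add: g_def numeral_2_eq_2 numeral_3_eq_3)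
  obtain u0 where u0: "smooth_near u0 0" "\<forall>\<^sub>F t in nhds 0. g 2 t = t * u0 t" "(g 2 has_real_derivative u0 0) (at 0)"
    using smooth_factor_linear[OF smg g20(1)] .
  obtain u1 where u1: "smooth_near u1 0" "\<forall>\<^sub>F t in nhds 0. g 3 t = t * u1 t"
    using smooth_factor_linear[OF smg g20(2)] .
  \<comment> \<open>The curve is tangent to the y-axis, so the slope of \<open>g 2\<close> at 0 is
    the mixed third derivative, which is 1.\<close>
  have u00: "u0 0 = 1"
  proof -
    let ?h = "iter_deriv (replicate 2 (1, 0)) \<psi>"
    have h: "(?h has_derivative frechet_derivative ?h (at (0, 0))) (at (poly p 0, 0))"
      using smooth_near_has_derivative[OF smooth_near_iter_deriv[OF sm]] p0 by simp
    have "((\<lambda>t. (poly p t, t)) has_derivative (\<lambda>s. (poly (pderiv p) 0 * s, s))) (at 0)"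
      using poly_DERIV[of p 0] unfolding has_field_derivative_def
      by (intro has_derivative_Pair has_derivative_ident) simp
    from has_derivative_compose[OF this h]
    have "(g 2 has_derivative (\<lambda>s. frechet_derivative ?h (at (0, 0)) (0, s))) (at 0)"
      by (simp add: g_def[abs_def] p1)
    moreover have "(g 2 has_derivative (*) (u0 0)) (at 0)" using u0(3) by (simp add: has_field_derivative_def)
    ultimately have "(\<lambda>s. frechet_derivative ?h (at (0, 0)) (0, s)) = (*) (u0 0)"
      by (rule has_derivative_unique)
    from fun_cong[OF this, of 1] d3(2) show ?thesis by (simp add: numeral_2_eq_2)
  qed
  define k where "k q = k0 (snd q) + fst q * k1 (snd q)" for q
  define u where "u q = u0 (snd q) / 2 + fst q * u1 (snd q) / 6" for q
  have smsnd: "smooth_near (\<lambda>q::real \<times> real. h (snd q)) (0, 0)" if "smooth_near h 0" for h :: "real \<Rightarrow> real"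
    by (rule smooth_near_compose[of h]) (use that in \<open>auto intro!: smooth_intros\<close>)
  have smk: "smooth_near k (0, 0)" unfolding k_def by (intro smooth_intros smsnd k0 k1)
  have smu: "smooth_near u (0, 0)" unfolding u_def divide_inverse by (intro smooth_intros smsnd u0 u1)
  have evsnd: "\<forall>\<^sub>F q in nhds (0::real, 0::real). P (snd q)" if "\<forall>\<^sub>F t in nhds 0. P t" for P :: "real \<Rightarrow> bool"
    by (rule eventually_nhds_compose[where g = snd]) (use that in \<open>auto intro!: continuous_intros\<close>)
  have EQ: "\<forall>\<^sub>F q in nhds (0, 0). \<Psi> q = \<psi> (0, 0) + snd q ^ m * k q + fst q ^ 2 * (snd q * u q) + fst q ^ 4 * A q"
    using A(2) evsnd[OF gev[of 0]] evsnd[OF gev[of 1]] evsnd[OF gev[of 2]] evsnd[OF gev[of 3]]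
      evsnd[OF k0(2)] evsnd[OF k1(2)] evsnd[OF u0(2)] evsnd[OF u1(2)]
  proof eventually_elim
    case (elim q)
    have "\<Psi> q = (g 0 (snd q) + fst q * g 1 (snd q) + fst q ^ 2 / 2 * g 2 (snd q) + fst q ^ 3 / 6 * g 3 (snd q)) + fst q ^ 4 * A q"
      using elim(1-5) by (simp add: eval_nat_numeral)
    also have "g 0 (snd q) = \<psi> (0, 0) + snd q ^ m * k0 (snd q)" using elim(6) by simp
    finally show ?case
      unfolding elim(7,8,9) k_def u_def by (simp add: algebra_simps eval_nat_numeral)
  qed
  have upos: "u (0, 0) > 0" by (simp add: u_def u00)
  have ck: "c * k (0, 0) > 0" using c by (simp add: k_def k00)
  obtain a Y \<beta> where aY: "smooth_near a (0, 0)" "a (0, 0) > 0" "smooth_near Y (0, 0)" "Y (0, 0) = 0" "\<beta> > 0"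
    "(Y has_derivative (\<lambda>h. \<beta> * snd h)) (at (0, 0))"
    "\<forall>\<^sub>F q in nhds (0, 0). \<Psi> q = \<psi> (0, 0) + (fst q * a q) ^ 2 * Y q + c * Y q ^ m"
    using normal_form_step[OF m smk smu A(1) upos ck EQ] by blast
  define \<sigma> where "\<sigma> = shear (- p)"
  have \<sigma>: "shear p (\<sigma> q) = q" for q by (simp add: \<sigma>_def shear_def)
  have \<sigma>0: "\<sigma> (0, 0) = (0, 0)" by (simp add: \<sigma>_def shear_def p0)
  have sm\<sigma>: "smooth_near \<sigma> q" for q unfolding \<sigma>_def by (rule smooth_near_shear)
  have d\<sigma>: "(\<sigma> has_derivative (\<lambda>h. h)) (at (0, 0))"
    using shear_derivative[of "- p" "(0, 0)"] by (simp add: \<sigma>_def p1 pderiv_minus)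
  define X where "X q = fst (\<sigma> q) * a (\<sigma> q)" for q
  define Y' where "Y' q = Y (\<sigma> q)" for q
  have sma: "smooth_near (\<lambda>q. a (\<sigma> q)) (0, 0)" by (rule smooth_near_compose) (use aY sm\<sigma> \<sigma>0 in auto)
  have "smooth_near X (0, 0)" unfolding X_def by (intro smooth_near_mult smooth_near_fst sm\<sigma> sma)
  moreover have "X (0, 0) = 0" by (simp add: X_def \<sigma>0)
  moreover have "smooth_near Y' (0, 0)" unfolding Y'_def by (rule smooth_near_compose) (use aY sm\<sigma> \<sigma>0 in auto)
  moreover have "Y' (0, 0) = 0" by (simp add: Y'_def \<sigma>0 aY)
  moreover have "(X has_derivative (\<lambda>h. a (0, 0) * fst h)) (at (0, 0))"
  proof -
    have "(X has_derivative (\<lambda>h. fst (\<sigma> (0, 0)) * frechet_derivative (\<lambda>q. a (\<sigma> q)) (at (0, 0)) h + fst h * a (\<sigma> (0, 0)))) (at (0, 0))"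
      unfolding X_def by (intro has_derivative_mult has_derivative_fst d\<sigma> smooth_near_has_derivative sma)
    then show ?thesis by (simp add: \<sigma>0 mult.commute)
  qed
  moreover have "(Y' has_derivative (\<lambda>h. \<beta> * snd h)) (at (0, 0))"
    using has_derivative_compose[OF d\<sigma>, of Y "\<lambda>h. \<beta> * snd h"] aY(6) by (simp add: Y'_def[abs_def] \<sigma>0)
  moreover have "\<forall>\<^sub>F q in nhds (0, 0). \<psi> q = \<psi> (0, 0) + X q ^ 2 * Y' q + c * Y' q ^ m"
  proof -
    have "\<forall>\<^sub>F q in nhds (0, 0). \<Psi> (\<sigma> q) = \<psi> (0, 0) + (fst (\<sigma> q) * a (\<sigma> q)) ^ 2 * Y (\<sigma> q) + c * Y (\<sigma> q) ^ m"
      by (rule eventually_nhds_compose[where g = \<sigma>, OF _ smooth_near_isCont[OF sm\<sigma>]]) (use aY(7) \<sigma>0 in simp)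
    then show ?thesis by (simp add: \<Psi>_def \<sigma> X_def Y'_def)
  qed
  ultimately show ?thesis using that[of X Y' "a (0, 0)" \<beta>] aY(2,5) by simp
qed

section \<open>The reduced function\<close>

lemma smooth_near_local_inverse:
  fixes \<Phi> :: "'a::euclidean_space \<Rightarrow> 'a"
  assumes "smooth_near \<Phi> x0" "\<And>v. frechet_derivative \<Phi> (at x0) v = 0 \<Longrightarrow> v = 0"
  obtains U V \<theta> where "open U" "x0 \<in> U" "open V" "\<Phi> x0 \<in> V" "homeomorphism U V \<Phi> \<theta>" "smooth_on U \<Phi>" "smooth_on V \<theta>"
proof -
  obtain W where W: "open W" "x0 \<in> W" "smooth_on W \<Phi>" using assms(1) unfolding smooth_near_def by blast
  obtain U V \<theta> where *: "open U" "U \<subseteq> W" "x0 \<in> U" "open V" "\<Phi> x0 \<in> V" "homeomorphism U V \<Phi> \<theta>" "smooth_on V \<theta>"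
    by (rule smooth_local_inverse[OF W]) (use assms(2) in blast)+
  have "smooth_on U \<Phi>" using W(3) *(2) unfolding smooth_on_def by blast
  then show ?thesis using that * by blast
qed

lemma smooth_near_lipschitz:
  fixes f :: "'a::euclidean_space \<Rightarrow> 'b::euclidean_space"
  assumes "smooth_near f x0"
  obtains C d where "C > 0" "d > 0" "\<And>x y. dist x x0 < d \<Longrightarrow> dist y x0 < d \<Longrightarrow> norm (f x - f y) \<le> C * norm (x - y)"
proof -
  have "\<forall>\<^sub>F x in nhds x0. norm (frechet_derivative f (at x) b) < norm (frechet_derivative f (at x0) b) + 1" for b
  proof -
    have c: "isCont (\<lambda>x. frechet_derivative f (at x) b) x0"
      by (rule smooth_near_isCont[OF smooth_near_deriv[OF assms]])
    have "open {y. norm y < norm (frechet_derivative f (at x0) b) + 1}"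
      by (intro open_Collect_less continuous_intros)
    from eventually_nhds_in_open[OF this, of "frechet_derivative f (at x0) b"]
    have "\<forall>\<^sub>F y in nhds (frechet_derivative f (at x0) b). norm y < norm (frechet_derivative f (at x0) b) + 1" by simp
    from eventually_nhds_compose[OF this c] show ?thesis .
  qed
  then have "\<forall>\<^sub>F x in nhds x0. (\<forall>b\<in>Basis. norm (frechet_derivative f (at x) b) < norm (frechet_derivative f (at x0) b) + 1)"
    by (intro eventually_ball_finite) auto
  with smooth_near_eventually[OF assms] have "\<forall>\<^sub>F x in nhds x0. smooth_near f x \<and>
      (\<forall>b\<in>Basis. norm (frechet_derivative f (at x) b) < norm (frechet_derivative f (at x0) b) + 1)"
    by (rule eventually_conj)
  then obtain d where d: "d > 0" "\<And>x. dist x x0 < d \<Longrightarrow> smooth_near f x"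
    "\<And>x b. dist x x0 < d \<Longrightarrow> b \<in> Basis \<Longrightarrow> norm (frechet_derivative f (at x) b) < norm (frechet_derivative f (at x0) b) + 1"
    unfolding eventually_nhds_metric by blast
  define C where "C = (\<Sum>b\<in>Basis. norm (frechet_derivative f (at x0) b) + 1)"
  have "C > 0" unfolding C_def by (intro sum_pos) (auto simp: add_nonneg_pos)
  moreover have "norm (f x - f y) \<le> C * norm (x - y)" if "dist x x0 < d" "dist y x0 < d" for x y
  proof (rule differentiable_bound[where S = "ball x0 d"])
    fix z assume z: "z \<in> ball x0 d"
    then have zd: "dist z x0 < d" by (simp add: dist_commute)
    have h: "(f has_derivative frechet_derivative f (at z)) (at z)" by (rule smooth_near_has_derivative[OF d(2)[OF zd]])
    then show "(f has_derivative frechet_derivative f (at z)) (at z within ball x0 d)"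
      by (rule has_derivative_at_withinI)
    have "onorm (frechet_derivative f (at z)) \<le> (\<Sum>b\<in>Basis. norm (frechet_derivative f (at z) b))"
      by (rule onorm_componentwise[OF has_derivative_bounded_linear[OF h]])
    also have "\<dots> \<le> C" unfolding C_def by (intro sum_mono less_imp_le d(3)[OF zd])
    finally show "onorm (frechet_derivative f (at z)) \<le> C" .
  qed (use that in \<open>auto simp: dist_commute\<close>)
  ultimately show ?thesis using that d(1) by blast
qed

text \<open>Smooth maps are locally Lipschitz; this carries the closeness of two curves from one
  coordinate system to another.\<close>

lemma vanishes_lipschitz:
  fixes f :: "'a::euclidean_space \<Rightarrow> 'b::euclidean_space"
  assumes "smooth_near f 0" "vanishes 1 (\<lambda>t. norm (a t))" "vanishes 1 (\<lambda>t. norm (b t))" "vanishes n (\<lambda>t. norm (a t - b t))"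
  shows "vanishes n (\<lambda>t. norm (f (a t) - f (b t)))"
proof -
  obtain C d where C: "C > 0" "d > 0" "\<And>x y. dist x 0 < d \<Longrightarrow> dist y 0 < d \<Longrightarrow> norm (f x - f y) \<le> C * norm (x - y)"
    using smooth_near_lipschitz[OF assms(1)] by blast
  have "\<forall>\<^sub>F t in at 0. norm (a t) < d" "\<forall>\<^sub>F t in at 0. norm (b t) < d"
    using tendsto_vanishes[OF assms(2)] tendsto_vanishes[OF assms(3)] C(2) order_tendstoD(2) by fastforce+
  then have "\<forall>\<^sub>F t in at 0. \<bar>norm (f (a t) - f (b t))\<bar> \<le> \<bar>C * norm (a t - b t)\<bar>"
  proof eventually_elim
    case (elim t)
    have "norm (f (a t) - f (b t)) \<le> C * norm (a t - b t)" by (rule C(3)) (use elim in auto)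
    then show ?case by simp
  qed
  with vanishes_cmult[OF assms(4)] show ?thesis by (rule vanishes_bound)
qed

lemma frechet_derivative_nth:
  fixes \<Phi> :: "'a::euclidean_space \<Rightarrow> real ^ 'n::finite"
  assumes "smooth_near \<Phi> x"
  shows "frechet_derivative \<Phi> (at x) v $ p = frechet_derivative (\<lambda>k. \<Phi> k $ p) (at x) v"
  using frechet_derivative_at[OF bounded_linear.has_derivative[OF bounded_linear_vec_nth
      smooth_near_has_derivative[OF assms]], of p] by metis

lemma frechet_derivative_linear_fun:
  "bounded_linear L \<Longrightarrow> frechet_derivative L (at x) = L"
  using frechet_derivative_at[OF bounded_linear_imp_has_derivative] by metis

section \<open>Elimination of z and the derivatives of the reduced function\<close>

context corank_two
begin

definition plane :: "real \<times> real \<Rightarrow> real ^ 'n" where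
  "plane q = (\<chi> p. if p = k1 then fst q else if p = k2 then snd q else 0)"

text \<open>Replacing the z-coordinates by the z-derivatives of \<open>f\<close> gives local
  coordinates, because the Hessian in z is invertible. In them the points critical in z form the
  plane z = 0, so the inverse of this map parametrizes the graph.\<close>

definition z_grad :: "real ^ 'n \<Rightarrow> real ^ 'n" where
  "z_grad k = (\<chi> p. if p \<in> {k1, k2} then k $ p else partial [p] f k)"

lemma smooth_near_plane: "smooth_near plane q"
  unfolding plane_def
proof (rule smooth_near_vec_lambda)
  fix p show "smooth_near (\<lambda>q. if p = k1 then fst q else if p = k2 then snd q else 0) q"
    by (cases "p = k1"; cases "p = k2") (auto intro!: smooth_intros)
qed

lemma smooth_near_z_grad: "smooth_near z_grad k"
  unfolding z_grad_def
proof (rule smooth_near_vec_lambda)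
  fix p show "smooth_near (\<lambda>k. if p \<in> {k1, k2} then k $ p else partial [p] f k) k"
    by (cases "p \<in> {k1, k2}") (auto intro!: smooth_intros smooth_near_partial sm)
qed

lemma z_grad_0: "z_grad 0 = 0"
  by (simp add: z_grad_def vec_eq_iff partial1_zero)

lemma plane_0: "plane (0, 0) = 0"
  by (simp add: plane_def vec_eq_iff)

lemma z_grad_deriv_inj:
  assumes "frechet_derivative z_grad (at 0) v = 0" shows "v = 0"
proof -
  have "frechet_derivative (\<lambda>k. z_grad k $ p) (at 0) v = 0" for p
    using frechet_derivative_nth[OF smooth_near_z_grad] assms by (metis zero_index)
  then have e: "frechet_derivative (\<lambda>k. if p \<in> {k1, k2} then k $ p else partial [p] f k) (at 0) v = 0" for p
    by (simp add: z_grad_def)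
  have k: "v $ p = 0" if "p \<in> {k1, k2}" for p
  proof -
    have "(\<lambda>k. if p \<in> {k1, k2} then k $ p else partial [p] f k) = (\<lambda>k. k $ p)" using that by auto
    then show ?thesis using e[of p] frechet_derivative_linear_fun[OF bounded_linear_vec_nth] by metis
  qed
  have "(\<Sum>q\<in>-{k1, k2}. H p q * v $ q) = 0" if "p \<notin> {k1, k2}" for p
  proof -
    have "(\<lambda>k. if p \<in> {k1, k2} then k $ p else partial [p] f k) = partial [p] f" using that by auto
    then have "(\<Sum>q\<in>UNIV. v $ q * H q p) = 0"
      using e[of p] frechet_derivative_partial[OF diff_partial, of "[p]" 0 v] by (simp add: partial_append[symmetric])
    moreover have "(\<Sum>q\<in>UNIV. v $ q * H q p) = (\<Sum>q\<in>-{k1, k2}. H p q * v $ q)"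
      by (rule sum.mono_neutral_cong_right) (use k H_sym[of p] in \<open>auto simp: mult.commute\<close>)
    ultimately show ?thesis by simp
  qed
  from H_nondeg[of "($) v", OF this] k have "v $ p = 0" for p by (cases "p \<in> {k1, k2}") auto
  then show ?thesis by (simp add: vec_eq_iff)
qed

lemma critical_graph_exists: "\<exists>s. critical_graph k1 k2 f s"
proof -
  obtain U V \<theta> where *: "open U" "0 \<in> U" "open V" "z_grad 0 \<in> V" "homeomorphism U V z_grad \<theta>" "smooth_on U z_grad" "smooth_on V \<theta>"
    by (rule smooth_near_local_inverse[OF smooth_near_z_grad[of 0]]) (use z_grad_deriv_inj in blast)+
  define s where "s q = \<theta> (plane q)" for q
  have "\<theta> 0 = 0" using homeomorphism_apply1[OF *(5,2)] z_grad_0 by simp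
  then have s0: "s (0, 0) = 0" by (simp add: s_def plane_0)
  have "continuous_on UNIV plane"
    using smooth_near_isCont[OF smooth_near_plane] by (simp add: continuous_at_imp_continuous_on)
  then have o: "open (plane -` V)" using *(3) continuous_on_open_vimage[of UNIV plane] by auto
  have "smooth_near s q" if "q \<in> plane -` V" for q
    unfolding s_def by (rule smooth_near_compose[OF _ smooth_near_plane]) (use that smooth_on_imp_near[OF *(3,7)] in auto)
  then have sm: "smooth_on (plane -` V) s" using smooth_on_iff_near[OF o] by blast
  have eq: "z_grad (s q) $ p = plane q $ p" if "q \<in> plane -` V" for q p
    using homeomorphism_apply2[OF *(5)] that by (simp add: s_def)
  have "s q $ k1 = fst q \<and> s q $ k2 = snd q \<and> (\<forall>p\<in>-{k1, k2}. partial [p] f (s q) = 0)" if "q \<in> plane -` V" for q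
  proof (intro conjI ballI)
    show "s q $ k1 = fst q" "s q $ k2 = snd q"
      using eq[OF that, of k1] eq[OF that, of k2] k12 by (auto simp: z_grad_def plane_def)
    show "partial [p] f (s q) = 0" if "p \<in> -{k1, k2}" for p
      using eq[OF \<open>q \<in> plane -` V\<close>, of p] that by (auto simp: z_grad_def plane_def)
  qed
  then have "\<forall>(x, y)\<in>plane -` V. s (x, y) $ k1 = x \<and> s (x, y) $ k2 = y \<and> (\<forall>p\<in>-{k1, k2}. partial [p] f (s (x, y)) = 0)"
    by fastforce
  moreover have "(0, 0) \<in> plane -` V" using *(4) z_grad_0 plane_0 by simp
  ultimately show ?thesis using s0 o sm unfolding critical_graph_def by blast
qed

text \<open>Names the choice made inside \<open>psi\<close>; the arguments below rest on the
  properties in \<open>critical_graph\<close> alone.\<close>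

definition graph :: "real \<times> real \<Rightarrow> real ^ 'n" where
  "graph = (SOME s. critical_graph k1 k2 f s)"

abbreviation \<psi> :: "real \<times> real \<Rightarrow> real" where "\<psi> \<equiv> psi k1 k2 f"

lemma psi_graph: "\<psi> = (\<lambda>q. f (graph q))"
  by (simp add: psi_def graph_def comp_def)

lemma critical_graph: "critical_graph k1 k2 f graph"
  unfolding graph_def using critical_graph_exists by (rule someI_ex)

lemma graph_0: "graph (0, 0) = 0"
  and smooth_near_graph: "smooth_near graph (0, 0)"
  and graph_eq: "\<forall>\<^sub>F q in nhds (0, 0). graph q $ k1 = fst q \<and> graph q $ k2 = snd q \<and> (\<forall>p\<in>-{k1, k2}. partial [p] f (graph q) = 0)"
proof -
  obtain U where U: "graph (0, 0) = 0" "open U" "(0, 0) \<in> U" "smooth_on U graph"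
    "\<forall>(x, y)\<in>U. graph (x, y) $ k1 = x \<and> graph (x, y) $ k2 = y \<and> (\<forall>p\<in>-{k1, k2}. partial [p] f (graph (x, y)) = 0)"
    using critical_graph unfolding critical_graph_def by blast
  show "graph (0, 0) = 0" "smooth_near graph (0, 0)" using U smooth_on_imp_near by auto
  show "\<forall>\<^sub>F q in nhds (0, 0). graph q $ k1 = fst q \<and> graph q $ k2 = snd q \<and> (\<forall>p\<in>-{k1, k2}. partial [p] f (graph q) = 0)"
    unfolding eventually_nhds using U by (intro exI[of _ U]) fastforce
qed

lemma smooth_near_psi: "smooth_near \<psi> (0, 0)"
  unfolding psi_graph by (rule smooth_near_compose[OF sm smooth_near_graph])

lemma frechet_eventually_eq:
  assumes "\<forall>\<^sub>F q in nhds x. g q = h q"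
  shows "\<forall>\<^sub>F q in nhds x. frechet_derivative g (at q) = frechet_derivative h (at q)"
  using eventually_eventually[THEN iffD2, OF assms]
proof eventually_elim
  case (elim q)
  then obtain U where "open U" "q \<in> U" "\<And>y. y \<in> U \<Longrightarrow> g y = h y" unfolding eventually_nhds by blast
  then show ?case by (rule frechet_derivative_cong_open)
qed

lemma graph_deriv: "\<forall>\<^sub>F q in nhds (0, 0). frechet_derivative graph (at q) v $ k1 = fst v \<and> frechet_derivative graph (at q) v $ k2 = snd v"
proof -
  have "\<forall>\<^sub>F q in nhds (0, 0). graph q $ k1 = fst q" "\<forall>\<^sub>F q in nhds (0, 0). graph q $ k2 = snd q"
    using graph_eq by (auto elim: eventually_mono)
  from frechet_eventually_eq[OF this(1)] frechet_eventually_eq[OF this(2)] smooth_near_eventually[OF smooth_near_graph]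
  show ?thesis
    by eventually_elim (simp add: frechet_derivative_nth frechet_derivative_linear_fun[OF bounded_linear_fst]
      frechet_derivative_linear_fun[OF bounded_linear_snd])
qed

text \<open>Differentiating \<partial>f/\<partial>z = 0 along the graph shows that the Hessian kills
  the velocity, so its z-part vanishes: the graph is tangent to the kernel plane.\<close>

lemma graph_deriv_0: "frechet_derivative graph (at (0, 0)) v = plane v"
proof -
  let ?D = "frechet_derivative graph (at (0, 0)) v"
  have k: "?D $ k1 = fst v" "?D $ k2 = snd v"
    using eventually_nhds_x_imp_x[OF graph_deriv[of v]] by auto
  have "?D $ p = 0" if "p \<notin> {k1, k2}" for p
  proof (rule H_nondeg[OF _ that])
    fix p assume p: "p \<notin> {k1, k2}"
    have "\<forall>\<^sub>F q in nhds (0, 0). partial [p] f (graph q) = 0" using graph_eq p by (auto elim: eventually_mono)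
    from eventually_nhds_x_imp_x[OF frechet_eventually_eq[OF this]]
    have "frechet_derivative (\<lambda>q. partial [p] f (graph q)) (at (0, 0)) v = 0" by (simp add: frechet_derivative_const)
    then have "(\<Sum>q\<in>UNIV. ?D $ q * H q p) = 0"
      using frechet_compose_partial[OF smooth_near_partial[OF sm] smooth_near_graph, of "[p]" v]
      by (simp add: graph_0 partial_append[symmetric])
    moreover have "(\<Sum>q\<in>UNIV. ?D $ q * H q p) = (\<Sum>q\<in>-{k1, k2}. H p q * ?D $ q)"
      by (rule sum.mono_neutral_cong_right) (use H_k H_sym[of p] in \<open>auto simp: mult.commute\<close>)
    ultimately show "(\<Sum>q\<in>-{k1, k2}. H p q * ?D $ q) = 0" by simp
  qed
  then show ?thesis using k k12 by (auto simp: vec_eq_iff plane_def)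
qed

definition dir :: "'n \<Rightarrow> real \<times> real" where
  "dir i = (if i = k1 then (1, 0) else (0, 1))"

lemma dir_k: "dir k1 = (1, 0)" "dir k2 = (0, 1)"
  using k12 by (auto simp: dir_def)

lemma plane_dir: "i \<in> {k1, k2} \<Longrightarrow> plane (dir i) = axis i 1"
  using k12 by (auto simp: dir_def plane_def vec_eq_iff axis_def)

text \<open>Envelope argument: the z-derivatives of \<open>f\<close> vanish on the graph, so the
  motion of the graph in z does not contribute.\<close>

lemma psi_deriv1:
  assumes "i \<in> {k1, k2}" shows "\<forall>\<^sub>F q in nhds (0, 0). iter_deriv [dir i] \<psi> q = partial [i] f (graph q)"
  using graph_eq graph_deriv[of "dir i"] smooth_near_eventually[OF smooth_near_graph]
proof eventually_elim
  case (elim q)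
  let ?D = "frechet_derivative graph (at q) (dir i)"
  have "iter_deriv [dir i] \<psi> q = (\<Sum>p\<in>UNIV. ?D $ p * partial [p] f (graph q))"
    unfolding psi_graph using frechet_compose_partial[OF sm elim(3)] by simp
  also have "\<dots> = (\<Sum>p\<in>{i}. ?D $ p * partial [p] f (graph q))"
  proof (rule sum.mono_neutral_right)
    show "\<forall>p\<in>UNIV - {i}. ?D $ p * partial [p] f (graph q) = 0"
      using elim(1,2) assms k12 by (auto simp: dir_def)
  qed auto
  also have "\<dots> = partial [i] f (graph q)" using elim(2) assms k12 by (auto simp: dir_def)
  finally show ?case .
qed

lemma deriv_comp_graph_0:
  assumes "j \<in> {k1, k2}"
  shows "frechet_derivative (\<lambda>q. partial ps f (graph q)) (at (0, 0)) (dir j) = partial (j # ps) f 0"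
proof -
  have "frechet_derivative (\<lambda>q. partial ps f (graph q)) (at (0, 0)) (dir j) = (\<Sum>q\<in>UNIV. axis j 1 $ q * partial (q # ps) f 0)"
    using frechet_compose_partial[OF smooth_near_partial[OF sm] smooth_near_graph, of ps "dir j"]
    by (simp add: graph_0 graph_deriv_0 plane_dir[OF assms] partial_append[symmetric])
  also have "\<dots> = (\<Sum>q\<in>UNIV. if q = j then partial (q # ps) f 0 else 0)"
    by (intro sum.cong) (auto simp: axis_def)
  finally show ?thesis by simp
qed

lemma psi_deriv2:
  assumes "i \<in> {k1, k2}" "j \<in> {k1, k2}" shows "iter_deriv [dir j, dir i] \<psi> (0, 0) = 0"
proof -
  have "iter_deriv [dir j, dir i] \<psi> (0, 0) = partial [j, i] f 0"
    using eventually_nhds_x_imp_x[OF frechet_eventually_eq[OF psi_deriv1[OF assms(1)]]]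
      deriv_comp_graph_0[OF assms(2), of "[i]"] by simp
  then show ?thesis using assms H_k by auto
qed

text \<open>Second derivatives of the graph enter multiplied by second derivatives of
  \<open>f\<close> in a kernel direction, which are 0 at the origin, and the graph is tangent to the
  kernel plane. So the elimination of z leaves third derivatives at the origin unchanged.\<close>

lemma psi_deriv3:
  assumes "i \<in> {k1, k2}" "j \<in> {k1, k2}" "l \<in> {k1, k2}"
  shows "iter_deriv [dir l, dir j, dir i] \<psi> (0, 0) = partial [l, j, i] f 0"
proof -
  let ?D = "\<lambda>q. frechet_derivative graph (at q) (dir j)"
  have "\<forall>\<^sub>F q in nhds (0, 0). iter_deriv [dir j, dir i] \<psi> q = (\<Sum>p\<in>UNIV. ?D q $ p * partial [p, i] f (graph q))"
    using frechet_eventually_eq[OF psi_deriv1[OF assms(1)]] smooth_near_eventually[OF smooth_near_graph]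
  proof eventually_elim
    case (elim q)
    then show ?case using frechet_compose_partial[OF smooth_near_partial[OF sm] elim(2), of "[i]" "dir j"]
      by (simp add: partial_append[symmetric])
  qed
  from eventually_nhds_x_imp_x[OF frechet_eventually_eq[OF this]]
  have "iter_deriv [dir l, dir j, dir i] \<psi> (0, 0)
      = frechet_derivative (\<lambda>q. \<Sum>p\<in>UNIV. ?D q $ p * partial [p, i] f (graph q)) (at (0, 0)) (dir l)" by simp
  also have "\<dots> = (\<Sum>p\<in>UNIV. ?D (0, 0) $ p * frechet_derivative (\<lambda>q. partial [p, i] f (graph q)) (at (0, 0)) (dir l)
      + frechet_derivative (\<lambda>q. ?D q $ p) (at (0, 0)) (dir l) * partial [p, i] f (graph (0, 0)))"
  proof -
    have "((\<lambda>q. \<Sum>p\<in>UNIV. ?D q $ p * partial [p, i] f (graph q)) has_derivative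
      (\<lambda>v. \<Sum>p\<in>UNIV. ?D (0, 0) $ p * frechet_derivative (\<lambda>q. partial [p, i] f (graph q)) (at (0, 0)) v
      + frechet_derivative (\<lambda>q. ?D q $ p) (at (0, 0)) v * partial [p, i] f (graph (0, 0)))) (at (0, 0))"
      by (intro has_derivative_sum has_derivative_mult smooth_near_has_derivative smooth_near_vec_nth smooth_near_deriv
          smooth_near_graph smooth_near_compose[OF smooth_near_partial[OF sm] smooth_near_graph])
    from fun_cong[OF frechet_derivative_at[OF this], of "dir l", symmetric] show ?thesis .
  qed
  also have "\<dots> = (\<Sum>p\<in>UNIV. if p = j then partial (l # [p, i]) f 0 else 0)"
    unfolding graph_0 graph_deriv_0 plane_dir[OF assms(2)] deriv_comp_graph_0[OF assms(3)]
    by (intro sum.cong refl) (use assms(1) H_k in \<open>auto simp: axis_def\<close>)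
  finally show ?thesis by simp
qed

text \<open>In the coordinates \<open>z_grad\<close> the polar curve and the graph differ only by
  the z-derivatives of \<open>f\<close> along the curve, which have order i + 3. The local inverse
  is Lipschitz and carries the estimate back.\<close>

lemma curve_graph: "vanishes (i + 3) (\<lambda>t. norm (curve (K i) t - graph (poly (K i k1) t, t)))"
proof -
  let ?\<gamma> = "curve (K i)" and ?q = "\<lambda>t. (poly (K i k1) t, t)"
  obtain U V \<theta> where *: "open U" "0 \<in> U" "open V" "z_grad 0 \<in> V" "homeomorphism U V z_grad \<theta>" "smooth_on U z_grad" "smooth_on V \<theta>"
    by (rule smooth_near_local_inverse[OF smooth_near_z_grad[of 0]]) (use z_grad_deriv_inj in blast)+
  have sm\<theta>: "smooth_near \<theta> 0" using smooth_on_imp_near[OF *(3,7)] *(4) z_grad_0 by simp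
  have n\<gamma>: "vanishes 1 (\<lambda>t. norm (?\<gamma> t))" by (rule vanishes_norm_curve[OF K_0])
  have \<gamma>0: "(?\<gamma> \<longlongrightarrow> 0) (at 0)" using tendsto_vanishes[OF n\<gamma>] tendsto_norm_zero_iff by auto
  have na: "vanishes 1 (\<lambda>t. norm (z_grad (?\<gamma> t)))"
  proof (rule vanishes_norm_vec)
    fix p show "vanishes 1 (\<lambda>t. z_grad (?\<gamma> t) $ p)"
      by (rule vanishes_comp_differentiable[OF _ _ n\<gamma>])
        (use z_grad_0 in \<open>auto intro!: smooth_near_differentiable smooth_near_vec_nth smooth_near_z_grad\<close>)
  qed
  have comp: "vanishes 1 (poly (K i k1))" "vanishes 1 (\<lambda>t. t)"
    using vanishes_poly[of 1 "K i k1"] K_0 vanishes_power[of 1] by (auto simp: monom_1_dvd_iff')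
  have nb: "vanishes 1 (\<lambda>t. norm (plane (?q t)))"
  proof (rule vanishes_norm_vec)
    fix p show "vanishes 1 (\<lambda>t. plane (?q t) $ p)"
      by (cases "p = k1"; cases "p = k2") (use comp vanishes_0 k12 in \<open>auto simp: plane_def\<close>)
  qed
  have "vanishes (i + 3) (\<lambda>t. norm (z_grad (?\<gamma> t) - plane (?q t)))"
  proof (rule vanishes_norm_vec)
    fix p show "vanishes (i + 3) (\<lambda>t. (z_grad (?\<gamma> t) - plane (?q t)) $ p)"
    proof (cases "p \<in> {k1, k2}")
      case True
      then have "(z_grad (?\<gamma> t) - plane (?q t)) $ p = 0" for t
        using k12 by (auto simp: z_grad_def plane_def K_k2 poly_monom)
      then show ?thesis by (simp add: vanishes_0)
    next
      case False
      then have "(z_grad (?\<gamma> t) - plane (?q t)) $ p = partial [p] f (?\<gamma> t)" for t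
        by (auto simp: z_grad_def plane_def)
      then show ?thesis using grad_vanishes[of p i] False by simp
    qed
  qed
  from vanishes_lipschitz[OF sm\<theta> na nb this]
  have v: "vanishes (i + 3) (\<lambda>t. norm (\<theta> (z_grad (?\<gamma> t)) - \<theta> (plane (?q t))))" .
  have "\<forall>\<^sub>F t in at 0. ?\<gamma> t \<in> U" using topological_tendstoD[OF \<gamma>0 *(1,2)] .
  moreover have "\<forall>\<^sub>F t in at 0. graph (?q t) \<in> U \<and> graph (?q t) $ k1 = fst (?q t) \<and> graph (?q t) $ k2 = snd (?q t) \<and> (\<forall>p\<in>-{k1, k2}. partial [p] f (graph (?q t)) = 0)"
  proof -
    have "isCont ?q 0" by (intro continuous_intros)
    moreover have "?q 0 = (0, 0)" using K_0 by (simp add: poly_0_coeff_0)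
    moreover have "\<forall>\<^sub>F q in nhds (0, 0). graph q \<in> U"
      by (rule eventually_nhds_compose[OF _ smooth_near_isCont[OF smooth_near_graph]])
        (use *(1,2) graph_0 eventually_nhds_in_open in auto)
    ultimately have "\<forall>\<^sub>F t in nhds 0. graph (?q t) \<in> U \<and> graph (?q t) $ k1 = fst (?q t) \<and> graph (?q t) $ k2 = snd (?q t) \<and> (\<forall>p\<in>-{k1, k2}. partial [p] f (graph (?q t)) = 0)"
      by (intro eventually_nhds_compose[where g = ?q]) (use graph_eq in \<open>auto intro: eventually_conj\<close>)
    then show ?thesis by (rule eventually_nhds_imp_at)
  qed
  ultimately have "\<forall>\<^sub>F t in at 0. norm (?\<gamma> t - graph (?q t)) = norm (\<theta> (z_grad (?\<gamma> t)) - \<theta> (plane (?q t)))"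
  proof eventually_elim
    case (elim t)
    then have "z_grad (graph (?q t)) = plane (?q t)"
      using k12 by (auto simp: vec_eq_iff z_grad_def plane_def)
    then show ?case using homeomorphism_apply1[OF *(5)] elim by metis
  qed
  with v show ?thesis by (rule vanishes_cong)
qed

lemma comp_curve_graph:
  assumes "\<And>x. smooth_near F x"
  shows "vanishes (i + 3) (\<lambda>t. F (curve (K i) t) - F (graph (poly (K i k1) t, t)) :: real)"
proof -
  let ?\<gamma> = "curve (K i)" and ?g = "\<lambda>t. graph (poly (K i k1) t, t)"
  have n\<gamma>: "vanishes 1 (\<lambda>t. norm (?\<gamma> t))" by (rule vanishes_norm_curve[OF K_0])
  have "vanishes 1 (\<lambda>t. norm (?\<gamma> t) + norm (?\<gamma> t - ?g t))"
    by (intro vanishes_add n\<gamma> vanishes_mono[OF curve_graph]) simp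
  then have "vanishes 1 (\<lambda>t. norm (?g t))"
  proof (rule vanishes_bound, intro always_eventually allI)
    fix t show "\<bar>norm (?g t)\<bar> \<le> \<bar>norm (?\<gamma> t) + norm (?\<gamma> t - ?g t)\<bar>"
      using norm_triangle_ineq2[of "?g t" "?\<gamma> t"] by (simp add: norm_minus_commute)
  qed
  from vanishes_lipschitz[OF assms n\<gamma> this curve_graph]
  show ?thesis by (rule vanishes_bound) simp
qed

lemma psi_curve: "vanishes (i + 3) (\<lambda>t. f (curve (K i) t) - \<psi> (poly (K i k1) t, t))"
  unfolding psi_graph by (rule comp_curve_graph[OF sm])

lemma psi_x_curve: "vanishes (i + 3) (\<lambda>t. iter_deriv [(1, 0)] \<psi> (poly (K i k1) t, t))"
proof -
  have "vanishes (i + 3) (\<lambda>t. partial [k1] f (curve (K i) t) -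
      (partial [k1] f (curve (K i) t) - partial [k1] f (graph (poly (K i k1) t, t))))"
    by (intro vanishes_diff grad_vanishes[OF k12] comp_curve_graph smooth_near_partial sm)
  then have v: "vanishes (i + 3) (\<lambda>t. partial [k1] f (graph (poly (K i k1) t, t)))" by simp
  have "isCont (\<lambda>t. (poly (K i k1) t, t)) 0" by (intro continuous_intros)
  from eventually_nhds_compose[OF _ this, of "\<lambda>q. iter_deriv [(1, 0)] \<psi> q = partial [k1] f (graph q)"]
    psi_deriv1[of k1]
  have "\<forall>\<^sub>F t in nhds 0. iter_deriv [(1, 0)] \<psi> (poly (K i k1) t, t) = partial [k1] f (graph (poly (K i k1) t, t))"
    using K_0 by (simp add: dir_k poly_0_coeff_0)
  then show ?thesis by (rule vanishes_cong[OF v eventually_nhds_imp_at])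
qed

end

section \<open>Splitting off the nondegenerate variables\<close>

lemma bounded_bilinear_matrix_mult:
  "bounded_bilinear ((**) :: real ^ 'n::finite ^ 'n \<Rightarrow> real ^ 'n ^ 'n \<Rightarrow> real ^ 'n ^ 'n)"
  unfolding bilinear_conv_bounded_bilinear[symmetric] bilinear_def
  by (auto intro!: linearI simp: matrix_add_ldistrib matrix_matrix_mult_def vec_eq_iff sum.distrib sum_distrib_left algebra_simps)

lemma bounded_bilinear_matrix_vector:
  "bounded_bilinear ((*v) :: real ^ 'n::finite ^ 'n \<Rightarrow> real ^ 'n \<Rightarrow> real ^ 'n)"
  unfolding bilinear_conv_bounded_bilinear[symmetric] bilinear_def
  by (auto intro!: linearI simp: matrix_vector_mult_def vec_eq_iff sum.distrib sum_distrib_left algebra_simps)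

text \<open>The last conclusion, local injectivity of squaring, serves to transport symmetries of a matrix
  to its square root.\<close>

lemma matrix_sqrt:
  fixes T :: "'a::euclidean_space \<Rightarrow> real ^ 'n::finite ^ 'n"
  assumes "smooth_near T x0" "T x0 = mat 1"
  obtains R U where "smooth_near R x0" "R x0 = mat 1" "open U" "mat 1 \<in> U"
    "\<forall>\<^sub>F x in nhds x0. R x \<in> U \<and> R x ** R x = T x"
    "\<And>A B. A \<in> U \<Longrightarrow> B \<in> U \<Longrightarrow> A ** A = B ** B \<Longrightarrow> A = B"
proof -
  define sq :: "real ^ 'n ^ 'n \<Rightarrow> real ^ 'n ^ 'n" where "sq A = A ** A" for A
  have sm: "smooth_near sq A" for A
    unfolding sq_def by (intro smooth_near_bilinear[OF bounded_bilinear_matrix_mult] smooth_near_ident)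
  have "(sq has_derivative (\<lambda>V. mat 1 ** V + V ** mat 1)) (at (mat 1))"
    unfolding sq_def by (rule bounded_bilinear.FDERIV[OF bounded_bilinear_matrix_mult]) (rule has_derivative_ident)+
  from fun_cong[OF frechet_derivative_at[OF this], symmetric]
  \<comment> \<open>The derivative of squaring at the identity is multiplication by 2, so squaring
    is a local diffeomorphism there and its local inverse is the square root.\<close>
  have D: "frechet_derivative sq (at (mat 1)) V = V + V" for V by simp
  have inj: "V = 0" if "frechet_derivative sq (at (mat 1)) V = 0" for V
  proof -
    have "2 *\<^sub>R V = 0" using that D[of V] by (simp add: scaleR_2)
    then show ?thesis by simp
  qed
  obtain U V \<theta> where *: "open U" "mat 1 \<in> U" "open V" "sq (mat 1) \<in> V" "homeomorphism U V sq \<theta>" "smooth_on V \<theta>"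
    by (rule smooth_near_local_inverse[OF sm[of "mat 1"]]) (use inj in blast)+
  have sq1: "sq (mat 1) = mat 1" by (simp add: sq_def)
  have "smooth_near (\<lambda>x. \<theta> (T x)) x0"
    by (rule smooth_near_compose[OF _ assms(1)]) (use smooth_on_imp_near[OF *(3,6)] *(4) sq1 assms(2) in simp)
  moreover have "\<theta> (T x0) = mat 1" using homeomorphism_apply1[OF *(5,2)] sq1 assms(2) by simp
  moreover have "\<forall>\<^sub>F x in nhds x0. T x \<in> V"
    by (rule eventually_nhds_compose[OF _ smooth_near_isCont[OF assms(1)]])
      (use eventually_nhds_in_open[OF *(3)] *(4) sq1 assms(2) in simp)
  then have "\<forall>\<^sub>F x in nhds x0. \<theta> (T x) \<in> U \<and> \<theta> (T x) ** \<theta> (T x) = T x"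
  proof eventually_elim
    case (elim x)
    then show ?case using homeomorphism_apply2[OF *(5) elim] *(5) unfolding homeomorphism_def sq_def by blast
  qed
  moreover have "A = B" if "A \<in> U" "B \<in> U" "A ** A = B ** B" for A B
    using homeomorphism_apply1[OF *(5)] that unfolding sq_def by metis
  ultimately show ?thesis using that[of "\<lambda>x. \<theta> (T x)" U] *(1,2) by blast
qed

lemma inner_matrix_vector: "W \<bullet> (A *v W) = (\<Sum>p\<in>UNIV. \<Sum>r\<in>UNIV. A $ p $ r * W $ p * W $ r)"
  for W :: "real ^ 'n::finite"
  by (simp add: inner_vec_def matrix_vector_mult_def sum_distrib_left mult_ac)

lemma transpose_linear: "bounded_linear (transpose :: real ^ 'n::finite ^ 'n \<Rightarrow> real ^ 'n ^ 'n)"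
  unfolding linear_conv_bounded_linear[symmetric] by (rule linearI) (auto simp: transpose_def vec_eq_iff)

lemma transpose_inverse:
  fixes A B :: "real ^ 'n::finite ^ 'n"
  assumes "B ** A = mat 1" "transpose A = A" shows "transpose B = B"
proof -
  have "A ** B = mat 1" using assms(1) matrix_left_right_inverse by blast
  then have "transpose B ** A = mat 1" using assms(2) by (metis matrix_transpose_mul transpose_mat)
  then show ?thesis by (metis \<open>A ** B = mat 1\<close> matrix_mul_assoc matrix_mul_lid matrix_mul_rid)
qed

section \<open>Morse lemma with parameters\<close>

context corank_two
begin

definition base :: "real ^ 'n \<Rightarrow> real \<times> real" where "base k = (k $ k1, k $ k2)"

text \<open>Displacement from the point of the graph with the same (k1, k2). In this variable
  \<open>f\<close> minus the reduced function is a quadratic form with varying coefficients.\<close>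

definition fibre :: "real ^ 'n \<Rightarrow> real ^ 'n" where "fibre k = k - graph (base k)"

lemma base_linear: "bounded_linear base"
  unfolding base_def[abs_def] by (intro bounded_linear_Pair bounded_linear_vec_nth)

lemma base_0: "base 0 = (0, 0)" by (simp add: base_def)

lemma smooth_near_base: "smooth_near base k"
  using smooth_near_linear[OF base_linear smooth_near_ident] .

lemma smooth_near_graph_base: "smooth_near (\<lambda>k. graph (base k)) 0"
  by (rule smooth_near_compose[OF _ smooth_near_base]) (simp add: base_0 smooth_near_graph)

lemma smooth_near_fibre: "smooth_near fibre 0"
  unfolding fibre_def by (intro smooth_near_diff smooth_near_ident smooth_near_graph_base)

lemma fibre_0: "fibre 0 = 0" by (simp add: fibre_def base_0 graph_0)

lemma base_eventually: "\<forall>\<^sub>F q in nhds (0, 0). P q \<Longrightarrow> \<forall>\<^sub>F k in nhds 0. P (base k)"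
  by (rule eventually_nhds_compose[OF _ smooth_near_isCont[OF smooth_near_base]]) (simp add: base_0)

lemma fibre_eventually: "\<forall>\<^sub>F k in nhds 0. fibre k $ k1 = 0 \<and> fibre k $ k2 = 0"
  using base_eventually[OF graph_eq] by eventually_elim (simp add: fibre_def base_def)

lemma fibre_deriv_0: "frechet_derivative fibre (at 0) v = v - plane (base v)"
proof -
  have "((\<lambda>k. graph (base k)) has_derivative (\<lambda>v. frechet_derivative graph (at (0, 0)) (base v))) (at 0)"
    using has_derivative_compose[OF bounded_linear_imp_has_derivative[OF base_linear], of graph _ 0]
      smooth_near_has_derivative[OF smooth_near_graph] base_0 by simp
  then have "(fibre has_derivative (\<lambda>v. v - plane (base v))) (at 0)"
    unfolding fibre_def[abs_def] graph_deriv_0 by (intro has_derivative_diff has_derivative_ident)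
  from fun_cong[OF frechet_derivative_at[OF this], of v] show ?thesis by simp
qed

text \<open>Coefficients of the second-order Taylor remainder in integral form, along the segment
  from the graph to \<open>k\<close>; the weight 1 - t is the reason for half the Hessian at the
  origin.\<close>

definition S :: "'n \<Rightarrow> 'n \<Rightarrow> real ^ 'n \<Rightarrow> real" where
  "S p r k = integral {0..1} (\<lambda>t. (1 - t) * partial [p, r] f (graph (base k) + t *\<^sub>R fibre k))"

lemma S_sym: "S p r k = S r p k"
  unfolding S_def using partial_swap[OF sm, of "[]" p r "[]"] by simp

lemma S_0: "S p r 0 = H p r / 2"
proof -
  have "((\<lambda>t::real. (1 - t) * H p r) has_integral
      (\<lambda>t. (t - t\<^sup>2 / 2) * H p r) 1 - (\<lambda>t. (t - t\<^sup>2 / 2) * H p r) 0) {0..1}"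
    by (rule fundamental_theorem_of_calculus)
      (auto intro!: derivative_eq_intros simp flip: has_real_derivative_iff_has_vector_derivative)
  from integral_unique[OF this] show ?thesis by (simp add: S_def base_0 graph_0 fibre_0)
qed

lemma smooth_near_S: "smooth_near (S p r) 0"
  unfolding S_def
proof (rule smooth_near_integral[where G = "\<lambda>(k, t). (1 - t) * partial [p, r] f (graph (base k) + t *\<^sub>R fibre k)", simplified])
  fix t :: real
  have fst: "smooth_near (\<lambda>q::(real ^ 'n) \<times> real. h (fst q)) (0, t)" if "smooth_near h 0" for h :: "real ^ 'n \<Rightarrow> real ^ 'n"
    by (rule smooth_near_compose[of h]) (use that in \<open>auto intro!: smooth_near_fst smooth_near_ident\<close>)
  have "smooth_near (\<lambda>q. (1 - snd q) * partial [p, r] f (graph (base (fst q)) + snd q *\<^sub>R fibre (fst q))) (0, t)"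
    by (intro smooth_near_mult smooth_near_diff smooth_near_const smooth_near_snd smooth_near_ident
        smooth_near_compose[OF smooth_near_partial[OF sm]] smooth_near_add smooth_near_scaleR
        fst[OF smooth_near_graph_base] fst[OF smooth_near_fibre])
  then show "smooth_near (\<lambda>(k, t). (1 - t) * partial [p, r] f (graph (base k) + t *\<^sub>R fibre k)) (0, t)"
    by (simp add: case_prod_unfold)
qed

text \<open>Taylor expansion in z from the point of the graph: the linear term vanishes there, and
  the constant term is the reduced function.\<close>

lemma splitting:
  "\<forall>\<^sub>F k in nhds 0. f k = \<psi> (base k) + (\<Sum>p\<in>-{k1, k2}. \<Sum>r\<in>-{k1, k2}. S p r k * fibre k $ p * fibre k $ r)"
  using base_eventually[OF graph_eq] fibre_eventually
proof eventually_elim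
  case (elim k)
  let ?b = "graph (base k)" and ?W = "fibre k"
  have "f (?b + 1 *\<^sub>R ?W) = (\<Sum>r<2. 1 ^ r / fact r * iter_deriv (replicate r ?W) f ?b)
    + 1 ^ 2 * integral {0..1} (\<lambda>t. (1 - t) ^ (2 - 1) / fact (2 - 1) * iter_deriv (replicate 2 ?W) f (?b + (t * 1) *\<^sub>R ?W))"
    by (rule line_taylor_integral) (use sm in auto)
  then have "f k = f ?b + iter_deriv [?W] f ?b + integral {0..1} (\<lambda>t. (1 - t) * iter_deriv [?W, ?W] f (?b + t *\<^sub>R ?W))"
    by (simp add: numeral_2_eq_2 fibre_def)
  also have "iter_deriv [?W] f ?b = 0"
  proof -
    have "iter_deriv [?W] f ?b = (\<Sum>p\<in>UNIV. ?W $ p * partial [p] f ?b)"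
      using frechet_derivative_partial[OF smooth_near_differentiable[OF sm]] by simp
    also have "\<dots> = 0" by (rule sum.neutral) (use elim in auto)
    finally show ?thesis .
  qed
  also have "integral {0..1} (\<lambda>t. (1 - t) * iter_deriv [?W, ?W] f (?b + t *\<^sub>R ?W))
    = integral {0..1} (\<lambda>t. \<Sum>p\<in>-{k1, k2}. \<Sum>r\<in>-{k1, k2}. (?W $ p * ?W $ r) * ((1 - t) * partial [p, r] f (?b + t *\<^sub>R ?W)))"
  proof (rule integral_cong)
    fix t
    have "iter_deriv [?W, ?W] f (?b + t *\<^sub>R ?W) = (\<Sum>p\<in>-{k1, k2}. \<Sum>r\<in>-{k1, k2}. ?W $ p * ?W $ r * partial [p, r] f (?b + t *\<^sub>R ?W))"
      unfolding iter_deriv_2 by (intro sum.mono_neutral_cong_right) (use elim in \<open>auto intro!: sum.neutral\<close>)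
    then show "(1 - t) * iter_deriv [?W, ?W] f (?b + t *\<^sub>R ?W)
      = (\<Sum>p\<in>-{k1, k2}. \<Sum>r\<in>-{k1, k2}. (?W $ p * ?W $ r) * ((1 - t) * partial [p, r] f (?b + t *\<^sub>R ?W)))"
      by (simp add: sum_distrib_left mult_ac)
  qed
  also have "\<dots> = (\<Sum>p\<in>-{k1, k2}. \<Sum>r\<in>-{k1, k2}. (?W $ p * ?W $ r) * S p r k)"
  proof -
    have int: "(\<lambda>t. (1 - t) * partial [p, r] f (?b + t *\<^sub>R ?W)) integrable_on {0..1}" for p r
    proof (rule integrable_continuous_real, intro continuous_on_mult continuous_intros)
      have "continuous_on UNIV (partial [p, r] f)"
        using smooth_near_isCont[OF smooth_near_partial[OF sm]] by (simp add: continuous_at_imp_continuous_on)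
      then show "continuous_on {0..1} (\<lambda>t. partial [p, r] f (?b + t *\<^sub>R ?W))"
        by (rule continuous_on_compose2) (auto intro!: continuous_intros)
    qed
    show ?thesis
      by (subst integral_sum, simp, intro integrable_sum integrable_on_mult_right int, simp)
        (subst integral_sum, simp, intro integrable_on_mult_right int, simp add: S_def)
  qed
  finally show ?case by (simp add: psi_graph mult_ac)
qed

text \<open>Wanted is R with R^T M(0) R = M(k), so that Z = R W, with W the displacement
  \<open>fibre k\<close>, turns the varying form into the fixed one. R is the square root near the
  identity of T = M(0)^-1 M(k). Uniqueness of the root gives M(0) R = R^T M(0), whence R^T M(0) R =
  M(0) R^2 = M(k).\<close>

lemma morse_coordinates:
  obtains Z where "smooth_near Z 0" "Z 0 = 0" "\<And>v. frechet_derivative Z (at 0) v = v - plane (base v)"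
    "\<forall>\<^sub>F k in nhds 0. (\<Sum>p\<in>-{k1, k2}. \<Sum>r\<in>-{k1, k2}. S p r k * fibre k $ p * fibre k $ r)
       = (\<Sum>p\<in>-{k1, k2}. \<Sum>r\<in>-{k1, k2}. H p r / 2 * Z k $ p * Z k $ r)"
proof -
  define M :: "real ^ 'n \<Rightarrow> real ^ 'n ^ 'n" where
    "M k = (\<chi> p r. if p \<notin> {k1, k2} \<and> r \<notin> {k1, k2} then S p r k else if p = r then 1 else 0)" for k
  \<comment> \<open>Reflection in the two distinguished coordinates. Invariance under conjugation by
    it forces \<open>R\<close> to be block diagonal, so that near the origin the \<open>k1\<close>-
    and \<open>k2\<close>-components of \<open>Z\<close> vanish.\<close>
  define J :: "real ^ 'n ^ 'n" where "J = (\<chi> p r. if p = r then (if p \<in> {k1, k2} then - 1 else 1) else 0)"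
  have conj: "(J ** A ** J) $ p $ r = (if p \<in> {k1, k2} then - 1 else 1) * (if r \<in> {k1, k2} then - 1 else 1) * A $ p $ r" for A p r
  proof -
    have "(\<Sum>i\<in>UNIV. J $ p $ i * A $ i $ s) = (\<Sum>i\<in>UNIV. if i = p then (if p \<in> {k1, k2} then - 1 else 1) * A $ i $ s else 0)" for s
      by (intro sum.cong refl) (auto simp: J_def)
    then have "(J ** A) $ p $ s = (\<Sum>i\<in>UNIV. if i = p then (if p \<in> {k1, k2} then - 1 else 1) * A $ i $ s else 0)" for s
      by (simp add: matrix_matrix_mult_def)
    then have JA: "(J ** A) $ p $ s = (if p \<in> {k1, k2} then - 1 else 1) * A $ p $ s" for s by simp
    have "(\<Sum>i\<in>UNIV. (J ** A) $ p $ i * J $ i $ r) = (\<Sum>i\<in>UNIV. if i = r then (J ** A) $ p $ i * (if r \<in> {k1, k2} then - 1 else 1) else 0)"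
      by (intro sum.cong refl) (auto simp: J_def)
    then have "(J ** A ** J) $ p $ r = (\<Sum>i\<in>UNIV. if i = r then (J ** A) $ p $ i * (if r \<in> {k1, k2} then - 1 else 1) else 0)"
      by (simp add: matrix_matrix_mult_def[of "J ** A" J])
    then show ?thesis by (simp add: JA)
  qed
  have JMJ: "J ** M k ** J = M k" for k
    unfolding vec_eq_iff conj by (auto simp: M_def)
  have JJ: "J ** J = mat 1"
  proof -
    have "J ** mat 1 ** J = mat 1" unfolding vec_eq_iff conj by (auto simp: mat_def)
    then show ?thesis by simp
  qed
  have Msym: "transpose (M k) = M k" for k
    using S_sym by (auto simp: transpose_def M_def vec_eq_iff)
  have smM: "smooth_near M 0"
    unfolding M_def
  proof (intro smooth_near_vec_lambda)
    fix p r show "smooth_near (\<lambda>k. if p \<notin> {k1, k2} \<and> r \<notin> {k1, k2} then S p r k else if p = r then 1 else 0) 0"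
      by (cases "p \<notin> {k1, k2} \<and> r \<notin> {k1, k2}") (auto intro: smooth_near_S smooth_near_const)
  qed
  have "M 0 = (\<chi> i j. if i \<notin> {k1, k2} \<and> j \<notin> {k1, k2} then 1 / 2 * H i j else if i = j then 1 else 0)"
    by (simp add: M_def S_0 vec_eq_iff)
  from block_matrix_left_inverse[OF this] obtain N where NM: "N ** M 0 = mat 1" by auto
  then have MN: "M 0 ** N = mat 1" using matrix_left_right_inverse by blast
  have Nsym: "transpose N = N" by (rule transpose_inverse[OF NM Msym])
  have JNJ: "J ** N ** J = N"
  proof -
    have "(J ** N ** J) ** M 0 = J ** N ** (J ** M 0 ** J) ** J" using JJ by (metis matrix_mul_assoc matrix_mul_rid)
    also have "\<dots> = J ** (N ** M 0) ** J" by (simp add: JMJ matrix_mul_assoc)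
    also have "\<dots> = mat 1" by (simp add: NM JJ)
    finally have "(J ** N ** J) ** M 0 ** N = N" by simp
    then show ?thesis using MN by (metis matrix_mul_assoc matrix_mul_rid)
  qed
  define T where "T k = N ** M k" for k
  have smT: "smooth_near T 0"
    unfolding T_def by (intro smooth_near_bilinear[OF bounded_bilinear_matrix_mult] smooth_near_const smM)
  obtain R U where R: "smooth_near R 0" "R 0 = mat 1" "open U" "mat 1 \<in> U"
    "\<forall>\<^sub>F k in nhds 0. R k \<in> U \<and> R k ** R k = T k"
    "\<And>A B. A \<in> U \<Longrightarrow> B \<in> U \<Longrightarrow> A ** A = B ** B \<Longrightarrow> A = B"
    by (rule matrix_sqrt[OF smT]) (use NM in \<open>auto simp: T_def\<close>)
  have in_U: "\<forall>\<^sub>F k in nhds 0. F (R k) \<in> U" if "bounded_linear F" "F (mat 1) = mat 1" for F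
  proof -
    have "isCont (\<lambda>k. F (R k)) 0" using smooth_near_isCont[OF smooth_near_linear[OF that(1) R(1)]] .
    moreover have "\<forall>\<^sub>F A in nhds (F (R 0)). A \<in> U" using eventually_nhds_in_open[OF R(3,4)] that(2) R(2) by simp
    ultimately show ?thesis by (rule eventually_nhds_compose[rotated])
  qed
  note bl = bounded_bilinear.bounded_linear_left[OF bounded_bilinear_matrix_mult]
    bounded_bilinear.bounded_linear_right[OF bounded_bilinear_matrix_mult]
  have U1: "\<forall>\<^sub>F k in nhds 0. N ** transpose (R k) ** M 0 \<in> U"
    by (rule in_U[of "\<lambda>A. N ** transpose A ** M 0"])
      (auto intro!: bounded_linear_compose[OF bl(1)] bounded_linear_compose[OF bl(2)] transpose_linear simp: NM)
  have U2: "\<forall>\<^sub>F k in nhds 0. J ** R k ** J \<in> U"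
    by (rule in_U[of "\<lambda>A. J ** A ** J"]) (auto intro!: bounded_linear_compose[OF bl(1)] bl simp: JJ)
  define Z where "Z k = R k *v fibre k" for k
  have "\<forall>\<^sub>F k in nhds 0. (\<Sum>p\<in>-{k1, k2}. \<Sum>r\<in>-{k1, k2}. S p r k * fibre k $ p * fibre k $ r)
       = (\<Sum>p\<in>-{k1, k2}. \<Sum>r\<in>-{k1, k2}. H p r / 2 * Z k $ p * Z k $ r)"
    using R(5) U1 U2 fibre_eventually
  proof eventually_elim
    case (elim k)
    let ?R = "R k" and ?W = "fibre k"
    have T: "?R ** ?R = N ** M k" using elim(1) by (simp add: T_def)
    \<comment> \<open>The adjoint of R with respect to the form M(0) is another root of T in
      \<open>U\<close>, hence equal to R.\<close>
    have "(N ** transpose ?R ** M 0) ** (N ** transpose ?R ** M 0) = N ** transpose ?R ** (M 0 ** N) ** transpose ?R ** M 0"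
      by (simp add: matrix_mul_assoc)
    also have "\<dots> = N ** transpose (?R ** ?R) ** M 0" by (simp add: MN matrix_transpose_mul matrix_mul_assoc)
    also have "\<dots> = N ** M k ** (N ** M 0)" by (simp add: T matrix_transpose_mul Msym Nsym matrix_mul_assoc)
    also have "\<dots> = ?R ** ?R" by (simp add: NM T)
    finally have "N ** transpose ?R ** M 0 = ?R" using R(6) elim(1,2) by blast
    then have "M 0 ** ?R = transpose ?R ** M 0" by (metis MN matrix_mul_assoc matrix_mul_lid)
    then have RMR: "transpose ?R ** M 0 ** ?R = M k"
      by (metis MN T matrix_mul_assoc matrix_mul_lid)
    \<comment> \<open>The conjugate by the reflection is a root in \<open>U\<close> as well, since
      \<open>N\<close> and \<open>M k\<close> are invariant.\<close>
    have "(J ** ?R ** J) ** (J ** ?R ** J) = J ** ?R ** (J ** J) ** ?R ** J" by (simp add: matrix_mul_assoc)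
    also have "\<dots> = J ** (N ** M k) ** J" by (simp add: JJ matrix_mul_assoc flip: T)
    also have "\<dots> = J ** N ** (J ** J) ** M k ** J" by (simp add: JJ matrix_mul_assoc)
    also have "\<dots> = (J ** N ** J) ** (J ** M k ** J)" by (simp add: matrix_mul_assoc)
    also have "\<dots> = ?R ** ?R" by (simp add: JNJ JMJ T)
    finally have JRJ: "J ** ?R ** J = ?R" using R(6) elim(1,3) by blast
    have Zk: "Z k $ p = 0" if "p \<in> {k1, k2}" for p
    proof -
      have "?R $ p $ r = 0" if "r \<notin> {k1, k2}" for r
        using conj[of ?R p r] JRJ \<open>p \<in> {k1, k2}\<close> that by auto
      then have "?R $ p $ r * ?W $ r = 0" for r using elim(4) by (cases "r \<in> {k1, k2}") auto
      then show ?thesis unfolding Z_def matrix_vector_mult_def by (auto intro!: sum.neutral)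
    qed
    have "Z k \<bullet> (M 0 *v Z k) = ?W \<bullet> ((transpose ?R ** M 0 ** ?R) *v ?W)"
      unfolding Z_def
      by (metis dot_lmul_matrix matrix_vector_mul_assoc transpose_matrix_vector transpose_transpose)
    then have Q: "?W \<bullet> (M k *v ?W) = Z k \<bullet> (M 0 *v Z k)" by (simp add: RMR)
    have red: "w \<bullet> (M l *v w) = (\<Sum>p\<in>-{k1, k2}. \<Sum>r\<in>-{k1, k2}. S p r l * w $ p * w $ r)"
      if "\<And>p. p \<in> {k1, k2} \<Longrightarrow> w $ p = 0" for w l
      unfolding inner_matrix_vector
      by (intro sum.mono_neutral_cong_right) (use that in \<open>auto simp: M_def intro!: sum.neutral\<close>)
    have Wk: "?W $ p = 0" if "p \<in> {k1, k2}" for p using elim(4) that by auto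
    show ?case using Q red[OF Wk, of k] red[OF Zk, of 0] by (simp add: S_0)
  qed
  moreover have smZ: "smooth_near Z 0"
    unfolding Z_def by (intro smooth_near_bilinear[OF bounded_bilinear_matrix_vector] R smooth_near_fibre)
  moreover have "Z 0 = 0" by (simp add: Z_def fibre_0)
  moreover have "frechet_derivative Z (at 0) v = v - plane (base v)" for v
  proof -
    have "(Z has_derivative (\<lambda>v. R 0 *v frechet_derivative fibre (at 0) v + frechet_derivative R (at 0) v *v fibre 0)) (at 0)"
      unfolding Z_def[abs_def]
      by (intro bounded_bilinear.FDERIV[OF bounded_bilinear_matrix_vector] smooth_near_has_derivative R smooth_near_fibre)
    from fun_cong[OF frechet_derivative_at[OF this], of v, symmetric] show ?thesis
      by (simp add: R(2) fibre_0 fibre_deriv_0)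
  qed
  ultimately show ?thesis using that by blast
qed

lemma H_quadratic_form:
  "nondeg_quadratic_form k1 k2 (\<lambda>x. \<Sum>p\<in>-{k1, k2}. \<Sum>r\<in>-{k1, k2}. H p r / 2 * x $ p * x $ r)"
  unfolding nondeg_quadratic_form_def
proof (intro exI[of _ "\<lambda>p r. H p r / 2"] conjI allI impI ballI refl)
  show "H p q / 2 = H q p / 2" for p q using H_sym by simp
  fix u p assume u: "\<forall>p\<in>-{k1, k2}. (\<Sum>q\<in>-{k1, k2}. H p q / 2 * u q) = 0" and "p \<in> -{k1, k2}"
  then have "(\<Sum>q\<in>-{k1, k2}. H p q * u q) = 0" if "p \<notin> {k1, k2}" for p
    using that by (simp flip: sum_divide_distrib)
  then show "u p = 0" using H_nondeg \<open>p \<in> -{k1, k2}\<close> by blast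
qed

text \<open>The functions X, Y and the z-components of Z have a diagonal derivative at 0, with
  entries \<alpha>, \<beta> and 1, so they are local coordinates; the germ demanded by
  \<open>germ_reducible\<close> is their inverse.\<close>

theorem reducible_planar:
  assumes X: "smooth_near X (0, 0)" "X (0, 0) = 0" "(X has_derivative (\<lambda>h. \<alpha> * fst h)) (at (0, 0))" "\<alpha> \<noteq> 0"
    and Y: "smooth_near Y (0, 0)" "Y (0, 0) = 0" "(Y has_derivative (\<lambda>h. \<beta> * snd h)) (at (0, 0))" "\<beta> \<noteq> 0"
    and eq: "\<forall>\<^sub>F q in nhds (0, 0). \<psi> q = \<psi> (0, 0) + X q ^ 2 * Y q + c * Y q ^ m"
  shows "reducible_to_D k1 k2 (Suc m) c f"
proof -
  obtain Z where Z: "smooth_near Z 0" "Z 0 = 0" "\<And>v. frechet_derivative Z (at 0) v = v - plane (base v)"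
    "\<forall>\<^sub>F k in nhds 0. (\<Sum>p\<in>-{k1, k2}. \<Sum>r\<in>-{k1, k2}. S p r k * fibre k $ p * fibre k $ r)
       = (\<Sum>p\<in>-{k1, k2}. \<Sum>r\<in>-{k1, k2}. H p r / 2 * Z k $ p * Z k $ r)"
    using morse_coordinates by blast
  define \<Theta> :: "real ^ 'n \<Rightarrow> real ^ 'n" where
    "\<Theta> k = (\<chi> p. if p = k1 then X (base k) else if p = k2 then Y (base k) else Z k $ p)" for k
  have smb: "smooth_near (\<lambda>k. F (base k)) 0" if "smooth_near F (0, 0)" for F :: "real \<times> real \<Rightarrow> real"
    by (rule smooth_near_compose[OF _ smooth_near_base]) (use that base_0 in simp)
  have sm\<Theta>: "smooth_near \<Theta> 0"
    unfolding \<Theta>_def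
  proof (rule smooth_near_vec_lambda)
    fix p show "smooth_near (\<lambda>k. if p = k1 then X (base k) else if p = k2 then Y (base k) else Z k $ p) 0"
      by (cases "p = k1"; cases "p = k2") (use k12 in \<open>auto intro: smb X Y smooth_near_vec_nth Z\<close>)
  qed
  have \<Theta>0: "\<Theta> 0 = 0" by (simp add: \<Theta>_def vec_eq_iff base_0 X Y Z)
  have db: "frechet_derivative (\<lambda>k. F (base k)) (at 0) v = D (base v)" if "(F has_derivative D) (at (0, 0))"
    for F :: "real \<times> real \<Rightarrow> real" and D v
    using fun_cong[OF frechet_derivative_at[OF has_derivative_compose[OF bounded_linear_imp_has_derivative[OF base_linear], of F D 0]], of v]
      that base_0 by simp
  have inj: "v = 0" if v: "frechet_derivative \<Theta> (at 0) v = 0" for v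
  proof -
    have "frechet_derivative (\<lambda>k. \<Theta> k $ p) (at 0) v = 0" for p
      using frechet_derivative_nth[OF sm\<Theta>] v by (metis zero_index)
    then have e: "frechet_derivative (\<lambda>k. if p = k1 then X (base k) else if p = k2 then Y (base k) else Z k $ p) (at 0) v = 0" for p
      by (simp add: \<Theta>_def)
    have 1: "v $ k1 = 0" using e[of k1] db[OF X(3), of v] X(4) by (simp add: base_def)
    have 2: "v $ k2 = 0" using e[of k2] db[OF Y(3), of v] Y(4) k12 by (simp add: base_def)
    have "v $ p = 0" if "p \<notin> {k1, k2}" for p
      using e[of p] that frechet_derivative_nth[OF Z(1), of v p] Z(3)[of v] by (simp add: plane_def)
    then have "v $ p = 0" for p using 1 2 by (cases "p \<in> {k1, k2}") auto
    then show ?thesis by (simp add: vec_eq_iff)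
  qed
  obtain U V \<phi> where *: "open U" "0 \<in> U" "open V" "\<Theta> 0 \<in> V" "homeomorphism U V \<Theta> \<phi>" "smooth_on U \<Theta>" "smooth_on V \<phi>"
    by (rule smooth_near_local_inverse[OF sm\<Theta>]) (use inj in blast)+
  have \<phi>0: "\<phi> 0 = 0" using homeomorphism_apply1[OF *(5,2)] \<Theta>0 by simp
  have dg: "diffeo_germ \<phi>"
    unfolding diffeo_germ_def using \<phi>0 * \<Theta>0 homeomorphism_sym[of U V \<Theta> \<phi>] by auto
  have "\<forall>\<^sub>F k in nhds 0. f k = \<psi> (0, 0) + (\<Theta> k $ k1)^2 * \<Theta> k $ k2 + c * (\<Theta> k $ k2)^m
      + (\<Sum>p\<in>-{k1, k2}. \<Sum>r\<in>-{k1, k2}. H p r / 2 * \<Theta> k $ p * \<Theta> k $ r)"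
    using splitting Z(4) base_eventually[OF eq]
  proof eventually_elim
    case (elim k)
    have "(\<Sum>p\<in>-{k1, k2}. \<Sum>r\<in>-{k1, k2}. H p r / 2 * \<Theta> k $ p * \<Theta> k $ r)
      = (\<Sum>p\<in>-{k1, k2}. \<Sum>r\<in>-{k1, k2}. H p r / 2 * Z k $ p * Z k $ r)"
      by (intro sum.cong refl) (auto simp: \<Theta>_def)
    moreover have "\<Theta> k $ k1 = X (base k)" "\<Theta> k $ k2 = Y (base k)" using k12 by (auto simp: \<Theta>_def)
    ultimately show ?case using elim by simp
  qed
  then have "\<forall>\<^sub>F y in nhds 0. f (\<phi> y) = \<psi> (0, 0) + (\<Theta> (\<phi> y) $ k1)^2 * \<Theta> (\<phi> y) $ k2 + c * (\<Theta> (\<phi> y) $ k2)^m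
      + (\<Sum>p\<in>-{k1, k2}. \<Sum>r\<in>-{k1, k2}. H p r / 2 * \<Theta> (\<phi> y) $ p * \<Theta> (\<phi> y) $ r)"
    using \<phi>0 smooth_near_isCont[OF smooth_on_imp_near[OF *(3,7)], of 0] *(4) \<Theta>0
    by (intro eventually_nhds_compose[where g = \<phi>]) auto
  have TE: "\<forall>\<^sub>F y in nhds 0. \<Theta> (\<phi> y) = y"
    using homeomorphism_apply2[OF *(5)] *(3,4) \<Theta>0 unfolding eventually_nhds by metis
  note E = \<open>\<forall>\<^sub>F y in nhds 0. f (\<phi> y) = \<psi> (0, 0) + (\<Theta> (\<phi> y) $ k1)^2 * \<Theta> (\<phi> y) $ k2 + c * (\<Theta> (\<phi> y) $ k2)^m
      + (\<Sum>p\<in>-{k1, k2}. \<Sum>r\<in>-{k1, k2}. H p r / 2 * \<Theta> (\<phi> y) $ p * \<Theta> (\<phi> y) $ r)\<close>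
  from E TE have "\<forall>\<^sub>F y in nhds 0. f (\<phi> y) = \<psi> (0, 0) + (y $ k1)^2 * y $ k2 + c * (y $ k2)^m
      + (\<Sum>p\<in>-{k1, k2}. \<Sum>r\<in>-{k1, k2}. H p r / 2 * y $ p * y $ r)"
    by (rule eventually_elim2) simp
  then show ?thesis
    unfolding reducible_to_D_def germ_reducible_def using H_quadratic_form dg
    by (intro exI[of _ "\<psi> (0, 0)"] exI[of _ "\<lambda>x. \<Sum>p\<in>-{k1, k2}. \<Sum>r\<in>-{k1, k2}. H p r / 2 * x $ p * x $ r"]
        conjI exI[of _ \<phi>]) (auto elim: eventually_mono)
qed

text \<open>Only the sign of \<open>c\<close> matters, as its size is adjusted by scaling the
  variables. Hence c = 1, c = -1 and c = \<open>dcoef m\<close> are covered at once.\<close>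

theorem dcoef_reducible:
  assumes m: "m \<ge> 3" and z: "\<And>j. 3 \<le> j \<Longrightarrow> j < m \<Longrightarrow> dcoef j = 0" and c: "c * dcoef m > 0"
  shows "reducible_to_D k1 k2 (Suc m) c f"
proof -
  let ?p = "K m k1"
  have "(\<Sum>j=3..m. dcoef j / fact j * t ^ j) = dcoef m / fact m * t ^ m" for t
  proof -
    have "(\<Sum>j=3..m. dcoef j / fact j * t ^ j) = (\<Sum>j\<in>{m}. dcoef j / fact j * t ^ j)"
      by (rule sum.mono_neutral_right) (use m z in \<open>auto simp: le_less\<close>)
    then show ?thesis by simp
  qed
  then have v: "vanishes (Suc m) (\<lambda>t. f (curve (K m) t) - f 0 - dcoef m / fact m * t ^ m)"
    using polar_expansion[OF m, of m] by simp
  have "vanishes (Suc m) (\<lambda>t. (f (curve (K m) t) - f 0 - dcoef m / fact m * t ^ m) - (f (curve (K m) t) - \<psi> (poly ?p t, t)))"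
    by (intro vanishes_diff[OF v] vanishes_mono[OF psi_curve]) simp
  moreover have "\<psi> (0, 0) = f 0" by (simp add: psi_graph graph_0)
  ultimately have v0: "vanishes (Suc m) (\<lambda>t. \<psi> (poly ?p t, t) - \<psi> (0, 0) - dcoef m / fact m * t ^ m)"
    by (simp add: algebra_simps)
  have v1: "vanishes m (\<lambda>t. iter_deriv [(1, 0)] \<psi> (poly ?p t, t))"
    by (rule vanishes_mono[OF psi_x_curve]) simp
  have c': "c * (dcoef m / fact m) > 0" using c by simp
  have d: "iter_deriv [(1, 0), (1, 0)] \<psi> (0, 0) = 0" "iter_deriv [(1, 0), (1, 0), (1, 0)] \<psi> (0, 0) = 0"
    "iter_deriv [(0, 1), (1, 0), (1, 0)] \<psi> (0, 0) = 1"
    using psi_deriv2[of k1 k1] psi_deriv3[of k1 k1 k1] psi_deriv3[of k1 k1 k2] third third_swap by (simp_all add: dir_k)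
  obtain X Y \<alpha> \<beta> where "smooth_near X (0, 0)" "X (0, 0) = 0" "smooth_near Y (0, 0)" "Y (0, 0) = 0"
    "\<alpha> \<noteq> 0" "\<beta> \<noteq> 0" "(X has_derivative (\<lambda>h. \<alpha> * fst h)) (at (0, 0))" "(Y has_derivative (\<lambda>h. \<beta> * snd h)) (at (0, 0))"
    "\<forall>\<^sub>F q in nhds (0, 0). \<psi> q = \<psi> (0, 0) + X q ^ 2 * Y q + c * Y q ^ m"
    by (rule planar_normal_form[OF smooth_near_psi m c' K_0 K_1[OF k12] v0 v1 d])
  then show ?thesis by (intro reducible_planar)
qed

section \<open>The normal form determines the first nonzero coefficient\<close>

lemma curve_has_derivative:
  "(curve L has_vector_derivative (\<chi> p. poly (pderiv (L p)) t)) (at t)"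
proof -
  have e: "(\<chi> p. g p) = (\<Sum>p\<in>UNIV. g p *\<^sub>R (axis p 1 :: real ^ 'a::finite))" for g
    using basis_expansion[of "\<chi> p. g p"] by (simp add: scalar_mult_eq_scaleR)
  have "((\<lambda>t. \<Sum>p\<in>UNIV. poly (L p) t *\<^sub>R (axis p 1 :: real ^ 'a)) has_vector_derivative
      (\<Sum>p\<in>UNIV. poly (L p) t *\<^sub>R 0 + poly (pderiv (L p)) t *\<^sub>R axis p 1)) (at t)"
    by (intro has_vector_derivative_sum has_vector_derivative_scaleR has_vector_derivative_const poly_DERIV)
  then show ?thesis unfolding curve_def[abs_def] e by simp
qed

lemma smooth_near_curve: "smooth_near (curve L) t"
  unfolding curve_def[abs_def] by (intro smooth_near_vec_lambda smooth_near_poly smooth_near_ident)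

text \<open>If all coefficients up to m vanished, the gradient would have order m along the polar
  curve, contrary to \<open>not_D_form\<close>. If the first nonzero one had index j < m, then
  \<open>f\<close> would also have the normal form with exponent j, while the form with exponent m
  supplies a regular curve on which the gradient has order m - 1 \<ge> j.\<close>

theorem D_form_dcoef:
  assumes m: "m \<ge> 3" and red: "reducible_to_D k1 k2 (Suc m) c f" and c: "c \<noteq> 0"
  shows "(\<forall>j. 3 \<le> j \<and> j < m \<longrightarrow> dcoef j = 0) \<and> dcoef m \<noteq> 0"
proof -
  let ?\<gamma> = "curve (K m)"
  have "\<exists>j. 3 \<le> j \<and> j \<le> m \<and> dcoef j \<noteq> 0"
  proof (rule ccontr)
    assume "\<not> ?thesis"
    then have z: "dcoef j = 0" if "3 \<le> j" "j \<le> m" for j using that by blast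
    have v: "vanishes (Suc m) (\<lambda>t. f (?\<gamma> t) - f 0)"
      using polar_expansion[OF m, of m] z by simp
    let ?F' = "\<lambda>t. \<Sum>p\<in>UNIV. poly (pderiv (K m p)) t * partial [p] f (?\<gamma> t)"
    have "((\<lambda>t. f (?\<gamma> t) - f 0) has_real_derivative ?F' t) (at t)" for t
    proof -
      have "((\<lambda>t. f (?\<gamma> t)) has_derivative (\<lambda>s. frechet_derivative f (at (?\<gamma> t)) (s *\<^sub>R (\<chi> p. poly (pderiv (K m p)) t)))) (at t)"
        by (rule has_derivative_compose[OF curve_has_derivative[unfolded has_vector_derivative_def] smooth_near_has_derivative[OF sm]])
      moreover have "frechet_derivative f (at (?\<gamma> t)) (s *\<^sub>R (\<chi> p. poly (pderiv (K m p)) t)) = ?F' t * s" for s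
        unfolding frechet_derivative_partial[OF smooth_near_differentiable[OF sm]] by (simp add: sum_distrib_left mult_ac)
      ultimately have "((\<lambda>t. f (?\<gamma> t)) has_real_derivative ?F' t) (at t)"
        unfolding has_field_derivative_def by simp
      then show ?thesis by (auto intro!: derivative_eq_intros)
    qed
    then have "vanishes m ?F'"
      by (intro vanishes_deriv[OF _ v] always_eventually allI smooth_near_diff smooth_near_const
          smooth_near_compose[OF sm smooth_near_curve])
    moreover have g: "vanishes m (\<lambda>t. partial [p] f (?\<gamma> t))" if "p \<noteq> k2" for p
      by (rule vanishes_mono[OF grad_vanishes[OF that]]) simp
    then have "vanishes m (\<lambda>t. \<Sum>p\<in>UNIV - {k2}. poly (pderiv (K m p)) t * partial [p] f (?\<gamma> t))"
    proof (intro vanishes_sum)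
      fix p assume "p \<in> UNIV - {k2}"
      then show "vanishes m (\<lambda>t. poly (pderiv (K m p)) t * partial [p] f (?\<gamma> t))"
        using vanishes_mult[OF vanishes_isCont[OF poly_isCont] g] by simp
    qed
    ultimately have "vanishes m (\<lambda>t. ?F' t - (\<Sum>p\<in>UNIV - {k2}. poly (pderiv (K m p)) t * partial [p] f (?\<gamma> t)))"
      by (rule vanishes_diff)
    \<comment> \<open>The \<open>k2\<close>-velocity is 1, so subtracting the other products from
      the derivative of \<open>f\<close> along the curve isolates the one missing component of the
      gradient.\<close>
    moreover have "?F' t - (\<Sum>p\<in>UNIV - {k2}. poly (pderiv (K m p)) t * partial [p] f (?\<gamma> t)) = partial [k2] f (?\<gamma> t)" for t
      by (subst sum.remove[of _ k2]) (auto simp: K_k2 pderiv_monom poly_monom)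
    ultimately have g2: "vanishes m (\<lambda>t. partial [k2] f (?\<gamma> t))" by simp
    have "(\<chi> p. poly (pderiv (K m p)) 0) $ k2 = 1" by (simp add: K_k2 pderiv_monom poly_monom)
    then have "(\<chi> p. poly (pderiv (K m p)) 0) \<noteq> 0" by (metis zero_index zero_neq_one)
    moreover have "?\<gamma> 0 = 0" by (simp add: vec_eq_iff K_0 poly_0_coeff_0)
    ultimately show False
      using not_D_form[OF k12 sm red c m curve_has_derivative] g g2 by metis
  qed
  then obtain j where j: "3 \<le> j" "j \<le> m" "dcoef j \<noteq> 0" "\<And>i. 3 \<le> i \<Longrightarrow> i < j \<Longrightarrow> dcoef i = 0"
    using exists_least_iff[of "\<lambda>j. 3 \<le> j \<and> j \<le> m \<and> dcoef j \<noteq> 0"] by fastforce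
  have "j = m"
  proof (rule ccontr)
    assume "j \<noteq> m"
    then have jm: "j \<le> m - 1" using j by simp
    have "dcoef j * dcoef j > 0" using j(3) by (metis not_real_square_gt_zero)
    then have redj: "reducible_to_D k1 k2 (Suc j) (dcoef j) f" by (intro dcoef_reducible j)
    have m1: "m \<ge> 1" using m by simp
    obtain \<gamma> v where g: "(\<gamma> has_vector_derivative v) (at 0)" "\<gamma> 0 = 0" "v \<noteq> 0"
      "\<And>p. vanishes (m - 1) (\<lambda>t. partial [p] f (\<gamma> t))"
      using D_form_gradient[OF k12 red m1] by blast
    then show False
      using not_D_form[OF k12 sm redj j(3,1) g(1-3) vanishes_mono[OF g(4) jm]] by blast
  qed
  then show ?thesis using j by blast
qed

end

section \<open>The formulas for \<open>d\<^sub>4, \<dots>, d\<^sub>8\<close>\<close>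

lemma iter_deriv_replicate_commute:
  fixes F :: "'a::euclidean_space \<Rightarrow> real"
  assumes "smooth_near F x"
  shows "iter_deriv (us @ replicate k v @ [w]) F x = iter_deriv (us @ w # replicate k v) F x"
proof (induction k arbitrary: us)
  case (Suc k)
  have "iter_deriv (us @ replicate (Suc k) v @ [w]) F x = iter_deriv ((us @ [v]) @ replicate k v @ [w]) F x" by simp
  also have "\<dots> = iter_deriv ((us @ [v]) @ w # replicate k v) F x" by (rule Suc)
  also have "\<dots> = iter_deriv (us @ w # replicate (Suc k) v) F x"
    using iter_deriv_swap[OF assms, of us v w "replicate k v"] by simp
  finally show ?case .
qed simp

definition jet2 :: "(real \<times> real \<Rightarrow> real) \<Rightarrow> nat \<Rightarrow> nat \<Rightarrow> real" where
  "jet2 F j k = iter_deriv (replicate j (1, 0) @ replicate k (0, 1)) F (0, 0)"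

text \<open>Base point and increment both move with t. The remainder is a bounded derivative times
  the R-th power of the increment, so only the order of the increment enters.\<close>

lemma taylor_along:
  fixes F :: "real \<times> real \<Rightarrow> real"
  assumes sm: "smooth_near F (0, 0)" and a: "vanishes 1 (\<lambda>t. norm (a t))" and c: "vanishes m c" "m \<ge> 1" and v: "norm v \<le> 1"
  shows "vanishes (m * R) (\<lambda>t. F (a t + c t *\<^sub>R v) - (\<Sum>r<R. iter_deriv (replicate r v) F (a t) / fact r * c t ^ r))"
proof -
  obtain d where d: "d > 0" "\<And>q. dist q (0, 0) < d \<Longrightarrow> smooth_near F q"
    using smooth_near_eventually[OF sm] unfolding eventually_nhds_metric by blast
  have c1: "vanishes 1 c" by (rule vanishes_mono[OF c])
  have "\<forall>\<^sub>F t in at 0. norm (a t) + \<bar>c t\<bar> < d"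
  proof -
    have "((\<lambda>t. norm (a t) + \<bar>c t\<bar>) \<longlongrightarrow> 0 + \<bar>0\<bar>) (at 0)"
      by (intro tendsto_intros tendsto_vanishes[OF a] tendsto_vanishes[OF c1]) auto
    then show ?thesis using d(1) by (intro order_tendstoD(2)) auto
  qed
  then have "\<forall>\<^sub>F t in at 0. \<exists>s. \<bar>s\<bar> \<le> \<bar>c t\<bar> \<and> F (a t + c t *\<^sub>R v) = (\<Sum>r<R. iter_deriv (replicate r v) F (a t) / fact r * c t ^ r)
      + iter_deriv (replicate R v) F (a t + s *\<^sub>R v) / fact R * c t ^ R"
  proof eventually_elim
    case (elim t)
    have "smooth_near F (a t + s *\<^sub>R v)" if "\<bar>s\<bar> \<le> \<bar>c t\<bar>" for s
    proof (rule d(2))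
      have "norm (s *\<^sub>R v) \<le> \<bar>s\<bar> * 1" unfolding norm_scaleR by (intro mult_left_mono v) auto
      then have "norm (a t + s *\<^sub>R v) < d" using norm_triangle_ineq[of "a t" "s *\<^sub>R v"] elim that by linarith
      then show "dist (a t + s *\<^sub>R v) (0, 0) < d" by (simp add: dist_norm flip: zero_prod_def)
    qed
    then obtain s where "\<bar>s\<bar> \<le> \<bar>c t\<bar>" "F (a t + c t *\<^sub>R v) =
      (\<Sum>r<R. iter_deriv (replicate r v) F (a t) / fact r * c t ^ r) + iter_deriv (replicate R v) F (a t + s *\<^sub>R v) / fact R * c t ^ R"
      by (rule directional_taylor)
    then show ?case by blast
  qed
  \<comment> \<open>The intermediate point is known to exist only for small t; the conditional form
    permits a choice for all t.\<close>
  then have ex: "\<forall>t. \<exists>s. (\<exists>s. \<bar>s\<bar> \<le> \<bar>c t\<bar> \<and> F (a t + c t *\<^sub>R v) = (\<Sum>r<R. iter_deriv (replicate r v) F (a t) / fact r * c t ^ r)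
      + iter_deriv (replicate R v) F (a t + s *\<^sub>R v) / fact R * c t ^ R) \<longrightarrow>
      \<bar>s\<bar> \<le> \<bar>c t\<bar> \<and> F (a t + c t *\<^sub>R v) = (\<Sum>r<R. iter_deriv (replicate r v) F (a t) / fact r * c t ^ r)
      + iter_deriv (replicate R v) F (a t + s *\<^sub>R v) / fact R * c t ^ R" (is "\<forall>t. \<exists>s. ?E t \<longrightarrow> ?P t s") by blast
  from choice[OF ex] obtain s where s: "\<And>t. ?E t \<Longrightarrow> ?P t (s t)" by blast
  have ev: "\<forall>\<^sub>F t in at 0. ?P t (s t)"
    using \<open>\<forall>\<^sub>F t in at 0. ?E t\<close> by eventually_elim (rule s)
  \<comment> \<open>The fallback value 0 keeps the bound on the displacement valid for every
    t.\<close>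
  define \<xi> where "\<xi> t = a t + (if \<bar>s t\<bar> \<le> \<bar>c t\<bar> then s t else 0) *\<^sub>R v" for t
  have "vanishes 1 (\<lambda>t. norm (\<xi> t))"
  proof (rule vanishes_bound)
    show "vanishes 1 (\<lambda>t. norm (a t) + \<bar>c t\<bar>)"
      by (intro vanishes_add a vanishes_bound[OF c1]) auto
    show "\<forall>\<^sub>F t in at 0. \<bar>norm (\<xi> t)\<bar> \<le> \<bar>norm (a t) + \<bar>c t\<bar>\<bar>"
    proof (intro always_eventually allI)
      fix t
      let ?s = "if \<bar>s t\<bar> \<le> \<bar>c t\<bar> then s t else 0"
      have "norm (?s *\<^sub>R v) \<le> \<bar>?s\<bar> * 1" unfolding norm_scaleR by (intro mult_left_mono v) auto
      also have "\<bar>?s\<bar> * 1 \<le> \<bar>c t\<bar>" by auto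
      finally have "norm (?s *\<^sub>R v) \<le> \<bar>c t\<bar>" .
      then have "norm (\<xi> t) \<le> norm (a t) + \<bar>c t\<bar>"
        unfolding \<xi>_def using norm_triangle_ineq[of "a t" "?s *\<^sub>R v"] by linarith
      then show "\<bar>norm (\<xi> t)\<bar> \<le> \<bar>norm (a t) + \<bar>c t\<bar>\<bar>" by simp
    qed
  qed
  then have b: "vanishes 0 (\<lambda>t. iter_deriv (replicate R v) F (\<xi> t))"
    by (rule vanishes_comp_isCont[rotated]) (use smooth_near_isCont[OF smooth_near_iter_deriv[OF sm]] in \<open>simp add: zero_prod_def\<close>)
  have "vanishes (m * n) (\<lambda>t. c t ^ n)" for n
  proof (induction n)
    case (Suc n) then show ?case using vanishes_mult[OF c(1) Suc] by simp
  qed (simp add: vanishes_const)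
  from vanishes_cmult[OF vanishes_mult[OF b this[of R]], of "1 / fact R"]
  have "vanishes (m * R) (\<lambda>t. 1 / fact R * (iter_deriv (replicate R v) F (\<xi> t) * c t ^ R))" by simp
  then show ?thesis
    by (rule vanishes_cong) (use ev in \<open>eventually_elim, simp add: \<xi>_def\<close>)
qed

text \<open>The coefficient of t^7 is the last one needed for d_8, so everything is taken modulo
  t^8; as x has order 2, its powers from the fourth on drop out.\<close>

lemma planar_taylor:
  fixes F :: "real \<times> real \<Rightarrow> real"
  assumes sm: "smooth_near F (0, 0)" and x: "vanishes 2 x"
  shows "vanishes 8 (\<lambda>t. F (x t, t) - (\<Sum>k<8. \<Sum>j<4. jet2 F j k / (fact j * fact k) * (t ^ k * x t ^ j)))"
proof -
  have vt: "vanishes 1 (\<lambda>t. t)" using vanishes_power[of 1] by simp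
  have n1: "norm (0::real, 1::real) \<le> 1" "norm (1::real, 0::real) \<le> 1" by (simp_all add: norm_Pair)
  have "vanishes 1 (\<lambda>t. norm (x t, 0::real))"
    by (rule vanishes_bound[OF vanishes_mono[OF x]]) (simp_all add: norm_Pair)
  from taylor_along[OF sm this vt _ n1(1), of 8]
  have 1: "vanishes 8 (\<lambda>t. F (x t, t) - (\<Sum>k<8. iter_deriv (replicate k (0, 1)) F (x t, 0) / fact k * t ^ k))" by simp
  have "vanishes 8 (\<lambda>t. iter_deriv (replicate k (0, 1)) F (x t, 0) - (\<Sum>j<4. jet2 F j k / fact j * x t ^ j))" for k
  proof -
    have z: "vanishes 1 (\<lambda>t. norm (0::real, 0::real))" by (simp add: vanishes_0 flip: zero_prod_def)
    have "vanishes (2 * 4) (\<lambda>t. iter_deriv (replicate k (0, 1)) F ((0, 0) + x t *\<^sub>R (1, 0)) -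
       (\<Sum>j<4. iter_deriv (replicate j (1, 0)) (iter_deriv (replicate k (0, 1)) F) (0, 0) / fact j * x t ^ j))"
      by (rule taylor_along[OF smooth_near_iter_deriv[OF sm] z x _ n1(2)]) simp
    then show ?thesis by (simp add: jet2_def iter_deriv_append)
  qed
  then have "vanishes 8 (\<lambda>t. t ^ k * (iter_deriv (replicate k (0, 1)) F (x t, 0) - (\<Sum>j<4. jet2 F j k / fact j * x t ^ j)))" for k
    by (rule vanishes_mono[OF vanishes_mult[OF vanishes_power]]) simp
  then have "vanishes 8 (\<lambda>t. \<Sum>k<8. 1 / fact k * (t ^ k * (iter_deriv (replicate k (0, 1)) F (x t, 0) - (\<Sum>j<4. jet2 F j k / fact j * x t ^ j))))"
    by (intro vanishes_sum vanishes_cmult)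
  from vanishes_add[OF 1 this] show ?thesis
    by (rule vanishes_cong) (simp add: algebra_simps sum_subtractf sum_distrib_left)
qed

definition jet_poly :: "(nat \<Rightarrow> nat \<Rightarrow> real) \<Rightarrow> real poly \<Rightarrow> real poly" where
  "jet_poly A p = (\<Sum>k<8. \<Sum>j<4. smult (A j k / (fact j * fact k)) (monom 1 k * p ^ j))"

lemma coeff_jet_poly:
  "coeff (jet_poly A p) m = (\<Sum>k<8. \<Sum>j<4. A j k / (fact j * fact k) * (if m < k then 0 else coeff (p ^ j) (m - k)))"
  by (simp add: jet_poly_def coeff_sum coeff_monom_mult cong: if_cong)

lemma coeff_square_small:
  fixes p :: "real poly"
  assumes "coeff p 0 = 0" "coeff p 1 = 0"
  shows "coeff (p ^ 2) 0 = 0" "coeff (p ^ 2) 1 = 0" "coeff (p ^ 2) 2 = 0" "coeff (p ^ 2) 3 = 0"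
    "coeff (p ^ 2) 4 = coeff p 2 ^ 2" "coeff (p ^ 2) 5 = 2 * coeff p 2 * coeff p 3"
    "coeff (p ^ 2) 6 = 2 * coeff p 2 * coeff p 4 + coeff p 3 ^ 2"
    "coeff (p ^ 2) 7 = 2 * coeff p 2 * coeff p 5 + 2 * coeff p 3 * coeff p 4"
  using assms by (simp_all add: power2_eq_square coeff_mult eval_nat_numeral)

lemma coeff_cube_small:
  fixes p :: "real poly"
  assumes "coeff p 0 = 0" "coeff p 1 = 0"
  shows "coeff (p ^ 3) 0 = 0" "coeff (p ^ 3) 1 = 0" "coeff (p ^ 3) 2 = 0" "coeff (p ^ 3) 3 = 0"
    "coeff (p ^ 3) 4 = 0" "coeff (p ^ 3) 5 = 0" "coeff (p ^ 3) 6 = coeff p 2 ^ 3"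
    "coeff (p ^ 3) 7 = 3 * coeff p 2 ^ 2 * coeff p 3"
proof -
  have "coeff (p ^ 3) n = (\<Sum>i\<le>n. coeff p i * coeff (p ^ 2) (n - i))" for n
    by (simp add: power3_eq_cube power2_eq_square mult.assoc coeff_mult[of p])
  then show "coeff (p ^ 3) 0 = 0" "coeff (p ^ 3) 1 = 0" "coeff (p ^ 3) 2 = 0" "coeff (p ^ 3) 3 = 0"
    "coeff (p ^ 3) 4 = 0" "coeff (p ^ 3) 5 = 0" "coeff (p ^ 3) 6 = coeff p 2 ^ 3"
    "coeff (p ^ 3) 7 = 3 * coeff p 2 ^ 2 * coeff p 3"
    using assms coeff_square_small[OF assms] by (simp_all add: eval_nat_numeral)
qed

text \<open>Stated for an arbitrary array \<open>A\<close> because it serves twice: for the reduced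
  function, and with the first index shifted for its derivative in x.\<close>

lemma coeff_jet_poly_small:
  fixes p :: "real poly"
  assumes p: "coeff p 0 = 0" "coeff p 1 = 0"
  defines "b \<equiv> coeff p"
  shows "coeff (jet_poly A p) 3 = A 0 3 / 6 + A 1 0 * b 3 + A 1 1 * b 2"
    "coeff (jet_poly A p) 4 = A 0 4 / 24 + A 1 0 * b 4 + A 1 1 * b 3 + A 1 2 / 2 * b 2 + A 2 0 / 2 * b 2 ^ 2"
    "coeff (jet_poly A p) 5 = A 0 5 / 120 + A 1 0 * b 5 + A 1 1 * b 4 + A 1 2 / 2 * b 3 + A 1 3 / 6 * b 2
      + A 2 0 * b 2 * b 3 + A 2 1 / 2 * b 2 ^ 2"
    "coeff (jet_poly A p) 6 = A 0 6 / 720 + A 1 0 * b 6 + A 1 1 * b 5 + A 1 2 / 2 * b 4 + A 1 3 / 6 * b 3 + A 1 4 / 24 * b 2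
      + A 2 0 / 2 * (2 * b 2 * b 4 + b 3 ^ 2) + A 2 1 * b 2 * b 3 + A 2 2 / 4 * b 2 ^ 2 + A 3 0 / 6 * b 2 ^ 3"
    "coeff (jet_poly A p) 7 = A 0 7 / 5040 + A 1 0 * b 7 + A 1 1 * b 6 + A 1 2 / 2 * b 5 + A 1 3 / 6 * b 4 + A 1 4 / 24 * b 3
      + A 1 5 / 120 * b 2 + A 2 0 * (b 2 * b 5 + b 3 * b 4) + A 2 1 / 2 * (2 * b 2 * b 4 + b 3 ^ 2) + A 2 2 / 2 * b 2 * b 3
      + A 2 3 / 12 * b 2 ^ 2 + A 3 0 / 2 * b 2 ^ 2 * b 3 + A 3 1 / 6 * b 2 ^ 3"
proof -
  have s: "{..<8::nat} = {0, 1, 2, 3, 4, 5, 6, 7}" "{..<4::nat} = {0, 1, 2, 3}" by auto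
  note v = p coeff_square_small[OF p] coeff_cube_small[OF p]
  note e = coeff_jet_poly s b_def fact_numeral
  show "coeff (jet_poly A p) 3 = A 0 3 / 6 + A 1 0 * b 3 + A 1 1 * b 2" using v by (simp add: e)
  show "coeff (jet_poly A p) 4 = A 0 4 / 24 + A 1 0 * b 4 + A 1 1 * b 3 + A 1 2 / 2 * b 2 + A 2 0 / 2 * b 2 ^ 2"
    using v by (simp add: e)
  show "coeff (jet_poly A p) 5 = A 0 5 / 120 + A 1 0 * b 5 + A 1 1 * b 4 + A 1 2 / 2 * b 3 + A 1 3 / 6 * b 2
      + A 2 0 * b 2 * b 3 + A 2 1 / 2 * b 2 ^ 2" using v by (simp add: e)
  show "coeff (jet_poly A p) 6 = A 0 6 / 720 + A 1 0 * b 6 + A 1 1 * b 5 + A 1 2 / 2 * b 4 + A 1 3 / 6 * b 3 + A 1 4 / 24 * b 2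
      + A 2 0 / 2 * (2 * b 2 * b 4 + b 3 ^ 2) + A 2 1 * b 2 * b 3 + A 2 2 / 4 * b 2 ^ 2 + A 3 0 / 6 * b 2 ^ 3"
    using v by (simp add: e algebra_simps)
  show "coeff (jet_poly A p) 7 = A 0 7 / 5040 + A 1 0 * b 7 + A 1 1 * b 6 + A 1 2 / 2 * b 5 + A 1 3 / 6 * b 4 + A 1 4 / 24 * b 3
      + A 1 5 / 120 * b 2 + A 2 0 * (b 2 * b 5 + b 3 * b 4) + A 2 1 / 2 * (2 * b 2 * b 4 + b 3 ^ 2) + A 2 2 / 2 * b 2 * b 3
      + A 2 3 / 12 * b 2 ^ 2 + A 3 0 / 2 * b 2 ^ 2 * b 3 + A 3 1 / 6 * b 2 ^ 3"
    using v by (simp add: e field_simps)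
qed

section \<open>Comparison of coefficients for the reduced function\<close>

context corank_two
begin

abbreviation "a \<equiv> a_coeff k1 k2 f"

lemma a_jet2: "a j k = jet2 \<psi> j k"
  by (simp add: a_coeff_def jet2_def)

lemma a_psi_x: "jet2 (iter_deriv [(1, 0)] \<psi>) j k = a (Suc j) k"
proof -
  have "jet2 (iter_deriv [(1, 0)] \<psi>) j k = iter_deriv (replicate j (1, 0) @ replicate k (0, 1) @ [(1, 0)]) \<psi> (0, 0)"
    by (simp add: jet2_def iter_deriv_append)
  also have "\<dots> = iter_deriv (replicate j (1, 0) @ (1, 0) # replicate k (0, 1)) \<psi> (0, 0)"
    by (rule iter_deriv_replicate_commute[OF smooth_near_psi])
  also have "replicate j (1, 0) @ (1, 0) # replicate k (0, 1) = replicate (Suc j) (1, 0) @ replicate k (0 :: real, 1 :: real)"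
    by (simp add: replicate_app_Cons_same)
  finally show ?thesis by (simp add: a_coeff_def)
qed

lemma a_values: "a 1 0 = 0" "a 1 1 = 0" "a 1 2 = 0" "a 2 0 = 0" "a 2 1 = 1" "a 3 0 = 0"
proof -
  show "a 1 0 = 0"
    using eventually_nhds_x_imp_x[OF psi_deriv1[of k1]] by (simp add: a_coeff_def dir_k graph_0 partial1_zero)
  show "a 1 1 = 0" "a 2 0 = 0"
    using psi_deriv2[of k2 k1] psi_deriv2[of k1 k1] by (simp_all add: a_coeff_def dir_k numeral_2_eq_2)
  show "a 1 2 = 0" "a 2 1 = 1" "a 3 0 = 0"
    using psi_deriv3[of k2 k2 k1] psi_deriv3[of k2 k1 k1] psi_deriv3[of k1 k1 k1] third
    by (simp_all add: a_coeff_def dir_k numeral_2_eq_2 numeral_3_eq_3)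
qed

text \<open>The x-derivative of the reduced function vanishes modulo t^8 along the curve. Its
  degrees 3 and 4 determine the coefficients b2 and b3 of x(t), and these suffice, because b4 enters
  degree 7 with the factor a_{1,3}/6 + b2 = 0. The square in d_8 is - 5040 b3^2 / 2 with 24 b3 = 2
  a_{1,3} a_{2,2} - a_{1,4}.\<close>

theorem dcoef_formulas:
  "dcoef 3 = a 0 3" "dcoef 4 = a 0 4" "dcoef 5 = a 0 5 - 5/3 * (a 1 3)^2"
  "dcoef 6 = a 0 6 - 5 * a 1 3 * a 1 4 + 5 * (a 1 3)^2 * a 2 2"
  "dcoef 7 = a 0 7 - 7 * a 1 3 * a 1 5 + 35/3 * (a 1 3)^2 * a 2 3 - 35/9 * (a 1 3)^3 * a 3 1
     - 35/8 * (a 1 4 - 2 * a 1 3 * a 2 2)^2"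
proof -
  \<comment> \<open>Stage 5 gives exactly the order 5 + 3 = 8 in \<open>psi_curve\<close> and
    \<open>psi_x_curve\<close>.\<close>
  define p where "p = K 5 k1"
  have p0: "coeff p 0 = 0" "coeff p 1 = 0" using K_0 K_1[OF k12] by (auto simp: p_def)
  have vp: "vanishes 2 (poly p)"
    by (rule vanishes_poly) (use p0 in \<open>auto simp: monom_1_dvd_iff' less_2_cases_iff\<close>)
  have pj: "poly (jet_poly A p) t = (\<Sum>k<8. \<Sum>j<4. A j k / (fact j * fact k) * (t ^ k * poly p t ^ j))" for A t
    by (simp add: jet_poly_def poly_sum poly_monom)
  have "vanishes 8 (\<lambda>t. f (curve (K 5) t) - f 0 - (\<Sum>j=3..7. dcoef j / fact j * t ^ j))"
    using polar_expansion[of 7 5] by simp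
  from vanishes_diff[OF vanishes_diff[OF this vanishes_mono[OF psi_curve[of 5], of 8]] planar_taylor[OF smooth_near_psi vp]]
  have "vanishes 8 (\<lambda>t. poly (jet_poly a p) t - f 0 - (\<Sum>j=3..7. dcoef j / fact j * t ^ j))"
    unfolding pj a_jet2[symmetric] p_def[symmetric] by (simp add: algebra_simps)
  then have "vanishes 8 (poly (jet_poly a p - [:f 0:] - (\<Sum>j=3..7. monom (dcoef j / fact j) j)))"
    by (rule vanishes_cong) (simp add: poly_sum poly_monom)
  then have c: "coeff (jet_poly a p - [:f 0:] - (\<Sum>j=3..7. monom (dcoef j / fact j) j)) m = 0" if "m < 8" for m
    by (rule vanishes_poly_coeff[OF _ that])
  have D: "dcoef m = fact m * coeff (jet_poly a p) m" if "3 \<le> m" "m \<le> 7" for m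
  proof -
    have "coeff (jet_poly a p) m = dcoef m / fact m"
      using c[of m] that by (cases m) (auto simp: coeff_sum)
    then show ?thesis by simp
  qed
  have sx: "smooth_near (iter_deriv [(1, 0)] \<psi>) (0, 0)" by (rule smooth_near_iter_deriv[OF smooth_near_psi])
  from vanishes_diff[OF vanishes_mono[OF psi_x_curve[of 5], of 8] planar_taylor[OF sx vp]]
  have "vanishes 8 (poly (jet_poly (\<lambda>j k. a (Suc j) k) p))"
    unfolding p_def[symmetric] a_psi_x
    by (intro vanishes_cong[of 8 _ "poly (jet_poly (\<lambda>j k. a (Suc j) k) p)"]) (auto simp: pj)
  then have X: "coeff (jet_poly (\<lambda>j k. a (Suc j) k) p) m = 0" if "m < 8" for m
    by (rule vanishes_poly_coeff[OF _ that])
  have suc: "Suc 0 = 1" "Suc 1 = 2" "Suc 2 = 3" by simp_all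
  note C1 = coeff_jet_poly_small[OF p0, of "\<lambda>j k. a (Suc j) k", unfolded suc a_values]
  have b2: "coeff p 2 = - a 1 3 / 6"
    using C1(1) X[of 3] by simp
  have b3: "coeff p 3 = - a 1 4 / 24 + a 1 3 * a 2 2 / 12"
    using C1(2) X[of 4] b2 by (simp add: algebra_simps)
  note C = coeff_jet_poly_small[OF p0, of a, unfolded a_values b2 b3]
  show "dcoef 3 = a 0 3" "dcoef 4 = a 0 4"
    using D[of 3] D[of 4] by (simp_all add: C fact_numeral)
  show "dcoef 5 = a 0 5 - 5/3 * (a 1 3)^2"
    using D[of 5] by (simp add: C fact_numeral power2_eq_square)
  show "dcoef 6 = a 0 6 - 5 * a 1 3 * a 1 4 + 5 * (a 1 3)^2 * a 2 2"
    using D[of 6] by (simp add: C fact_numeral power2_eq_square algebra_simps)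
  show "dcoef 7 = a 0 7 - 7 * a 1 3 * a 1 5 + 35/3 * (a 1 3)^2 * a 2 3 - 35/9 * (a 1 3)^3 * a 3 1
     - 35/8 * (a 1 4 - 2 * a 1 3 * a 2 2)^2"
    using D[of 7] by (simp add: C fact_numeral power2_eq_square power3_eq_cube algebra_simps)
qed

end

theorem mainTheorem5:
  fixes k1 k2 :: "'n::finite"
  assumes "k1 \<noteq> k2"
  shows "\<exists>P :: nat \<Rightarrow> 'n jet_var rat_mpoly.
    (\<forall>\<mu>\<ge>4. free_term (P \<mu>) = 0 \<and> mpoly_vars (P \<mu>) \<subseteq> admissible_vars k1 k2 \<mu>) \<and>
    (\<forall>f :: real^'n \<Rightarrow> real.
      smooth_on UNIV f \<and> critical_point f 0 \<and>
      hessian_kernel f 0 = span {axis k1 1, axis k2 1} \<and>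
      partial [k1, k1, k1] f 0 = 0 \<and> partial [k1, k2, k2] f 0 = 0 \<and> partial [k1, k1, k2] f 0 = 1
      \<longrightarrow>
      (\<exists>d :: nat \<Rightarrow> real.
        (\<forall>\<mu>\<ge>4. d \<mu> = partial (replicate (\<mu> - 1) k2) f 0 + mpoly_eval (jet_value k1 k2 f) (P \<mu>)) \<and>
        (let a = a_coeff k1 k2 f in
          d 4 = a 0 3 \<and>
          d 5 = a 0 4 \<and>
          d 6 = a 0 5 - 5/3 * (a 1 3)^2 \<and>
          d 7 = a 0 6 - 5 * a 1 3 * a 1 4 + 5 * (a 1 3)^2 * a 2 2 \<and>
          d 8 = a 0 7 - 7 * a 1 3 * a 1 5 + 35/3 * (a 1 3)^2 * a 2 3 - 35/9 * (a 1 3)^3 * a 3 1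
                - 35/8 * (a 1 4 - 2 * a 1 3 * a 2 2)^2) \<and>
        (\<forall>\<mu>\<ge>4. D_plus k1 k2 \<mu> f \<or> D_minus k1 k2 \<mu> f \<longleftrightarrow> (\<forall>i\<in>{4..<\<mu>}. d i = 0) \<and> d \<mu> \<noteq> 0) \<and>
        (\<forall>\<mu>\<ge>4. (\<forall>i\<in>{4..<\<mu>}. d i = 0) \<and> d \<mu> \<noteq> 0 \<longrightarrow>
           reducible_to_D k1 k2 \<mu> (d \<mu>) f \<and>
           (d \<mu> > 0 \<longrightarrow> D_plus k1 k2 \<mu> f) \<and>
           (d \<mu> < 0 \<longrightarrow> D_minus k1 k2 \<mu> f))))"
proof -
  \<comment> \<open>The polynomials are fixed before \<open>f\<close>, as they may depend only on
    \<mu> and on the index type. For \<mu> = 4 there is no correction to the pure derivative, hence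
    the zero polynomial.\<close>
  have "\<exists>P. free_term P = 0 \<and> mpoly_vars P \<subseteq> admissible_vars k1 k2 \<mu> \<and>
      (\<forall>\<rho>. mpoly_eval \<rho> P = (if \<mu> = 4 then 0 else d_rest k1 k2 (\<mu> - 1) \<rho>))" if "\<mu> \<ge> 4" for \<mu>
  proof (cases "\<mu> = 4")
    case True
    then show ?thesis by (intro exI[of _ 0]) (simp add: free_term_def mpoly_vars_def mpoly_eval_0)
  next
    case False
    then have "\<mu> - 1 \<ge> 4" "Suc (\<mu> - 1) = \<mu>" using that by auto
    then obtain P where P: "mpoly_vars P \<subseteq> admissible_vars k1 k2 \<mu>" "\<And>\<rho>. mpoly_eval \<rho> P = d_rest k1 k2 (\<mu> - 1) \<rho>"
      using ratpoly_imp_mpoly[OF ratpoly_d_rest[OF assms]] by metis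
    then have "free_term P = 0" using mpoly_eval_zero[of P] by (simp add: d_rest_zero)
    then show ?thesis using P False by auto
  qed
  then obtain P where P: "\<And>\<mu>. \<mu> \<ge> 4 \<Longrightarrow> free_term (P \<mu>) = 0" "\<And>\<mu>. \<mu> \<ge> 4 \<Longrightarrow> mpoly_vars (P \<mu>) \<subseteq> admissible_vars k1 k2 \<mu>"
    "\<And>\<mu> \<rho>. \<mu> \<ge> 4 \<Longrightarrow> mpoly_eval \<rho> (P \<mu>) = (if \<mu> = 4 then 0 else d_rest k1 k2 (\<mu> - 1) \<rho>)"
    by metis
  show ?thesis
  proof (intro exI[of _ P] conjI allI impI)
    fix f :: "real ^ 'n \<Rightarrow> real"
    assume f: "smooth_on UNIV f \<and> critical_point f 0 \<and>
      hessian_kernel f 0 = span {axis k1 1, axis k2 1} \<and>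
      partial [k1, k1, k1] f 0 = 0 \<and> partial [k1, k2, k2] f 0 = 0 \<and> partial [k1, k1, k2] f 0 = 1"
    interpret corank_two k1 k2 f using assms f by unfold_locales auto
    define d where "d \<mu> = dcoef (\<mu> - 1)" for \<mu>
    have zero: "(\<forall>i\<in>{4..<\<mu>}. d i = 0) \<longleftrightarrow> (\<forall>j. 3 \<le> j \<and> j < \<mu> - 1 \<longrightarrow> dcoef j = 0)" if "\<mu> \<ge> 4" for \<mu>
    proof
      assume l: "\<forall>i\<in>{4..<\<mu>}. d i = 0"
      have "dcoef j = 0" if "3 \<le> j" "j < \<mu> - 1" for j
        using bspec[OF l, of "Suc j"] that by (simp add: d_def)
      then show "\<forall>j. 3 \<le> j \<and> j < \<mu> - 1 \<longrightarrow> dcoef j = 0" by blast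
    next
      assume "\<forall>j. 3 \<le> j \<and> j < \<mu> - 1 \<longrightarrow> dcoef j = 0"
      moreover have "3 \<le> i - 1 \<and> i - 1 < \<mu> - 1" if "i \<in> {4..<\<mu>}" for i using that by auto
      ultimately show "\<forall>i\<in>{4..<\<mu>}. d i = 0" unfolding d_def by blast
    qed
    have red: "reducible_to_D k1 k2 \<mu> c f" if "\<mu> \<ge> 4" "\<forall>i\<in>{4..<\<mu>}. d i = 0" "c * d \<mu> > 0" for \<mu> c
    proof -
      have "reducible_to_D k1 k2 (Suc (\<mu> - 1)) c f"
        by (rule dcoef_reducible) (use that zero[OF that(1)] in \<open>auto simp: d_def\<close>)
      then show ?thesis using that(1) by simp
    qed
    have conv: "(\<forall>i\<in>{4..<\<mu>}. d i = 0) \<and> d \<mu> \<noteq> 0" if "\<mu> \<ge> 4" "reducible_to_D k1 k2 \<mu> c f" "c \<noteq> 0" for \<mu> c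
      using D_form_dcoef[of "\<mu> - 1" c] that zero[OF that(1)] by (simp add: d_def)
    have plus: "D_plus k1 k2 \<mu> f" if "\<mu> \<ge> 4" "\<forall>i\<in>{4..<\<mu>}. d i = 0" "d \<mu> > 0" for \<mu>
      unfolding D_plus_def using red[of \<mu> 1] that critical by simp
    have minus: "D_minus k1 k2 \<mu> f" if "\<mu> \<ge> 4" "\<forall>i\<in>{4..<\<mu>}. d i = 0" "d \<mu> < 0" for \<mu>
      unfolding D_minus_def using red[of \<mu> "- 1"] that critical by simp
    show "\<exists>d :: nat \<Rightarrow> real.
        (\<forall>\<mu>\<ge>4. d \<mu> = partial (replicate (\<mu> - 1) k2) f 0 + mpoly_eval (jet_value k1 k2 f) (P \<mu>)) \<and>
        (let a = a_coeff k1 k2 f in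
          d 4 = a 0 3 \<and>
          d 5 = a 0 4 \<and>
          d 6 = a 0 5 - 5/3 * (a 1 3)^2 \<and>
          d 7 = a 0 6 - 5 * a 1 3 * a 1 4 + 5 * (a 1 3)^2 * a 2 2 \<and>
          d 8 = a 0 7 - 7 * a 1 3 * a 1 5 + 35/3 * (a 1 3)^2 * a 2 3 - 35/9 * (a 1 3)^3 * a 3 1
                - 35/8 * (a 1 4 - 2 * a 1 3 * a 2 2)^2) \<and>
        (\<forall>\<mu>\<ge>4. D_plus k1 k2 \<mu> f \<or> D_minus k1 k2 \<mu> f \<longleftrightarrow> (\<forall>i\<in>{4..<\<mu>}. d i = 0) \<and> d \<mu> \<noteq> 0) \<and>
        (\<forall>\<mu>\<ge>4. (\<forall>i\<in>{4..<\<mu>}. d i = 0) \<and> d \<mu> \<noteq> 0 \<longrightarrow>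
           reducible_to_D k1 k2 \<mu> (d \<mu>) f \<and>
           (d \<mu> > 0 \<longrightarrow> D_plus k1 k2 \<mu> f) \<and>
           (d \<mu> < 0 \<longrightarrow> D_minus k1 k2 \<mu> f))"
    proof (intro exI[of _ d] conjI allI impI)
      fix \<mu> :: nat assume \<mu>: "\<mu> \<ge> 4"
      then show "d \<mu> = partial (replicate (\<mu> - 1) k2) f 0 + mpoly_eval (jet_value k1 k2 f) (P \<mu>)"
        by (auto simp: d_def dcoef_def P(3))
      show "D_plus k1 k2 \<mu> f \<or> D_minus k1 k2 \<mu> f \<longleftrightarrow> (\<forall>i\<in>{4..<\<mu>}. d i = 0) \<and> d \<mu> \<noteq> 0"
      proof
        assume "D_plus k1 k2 \<mu> f \<or> D_minus k1 k2 \<mu> f"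
        then show "(\<forall>i\<in>{4..<\<mu>}. d i = 0) \<and> d \<mu> \<noteq> 0"
          using conv[OF \<mu>, of 1] conv[OF \<mu>, of "- 1"] unfolding D_plus_def D_minus_def by auto
      next
        assume "(\<forall>i\<in>{4..<\<mu>}. d i = 0) \<and> d \<mu> \<noteq> 0"
        then show "D_plus k1 k2 \<mu> f \<or> D_minus k1 k2 \<mu> f" using plus[OF \<mu>] minus[OF \<mu>] by (meson linorder_neqE)
      qed
    next
      show "let a = a_coeff k1 k2 f in
          d 4 = a 0 3 \<and>
          d 5 = a 0 4 \<and>
          d 6 = a 0 5 - 5/3 * (a 1 3)^2 \<and>
          d 7 = a 0 6 - 5 * a 1 3 * a 1 4 + 5 * (a 1 3)^2 * a 2 2 \<and>
          d 8 = a 0 7 - 7 * a 1 3 * a 1 5 + 35/3 * (a 1 3)^2 * a 2 3 - 35/9 * (a 1 3)^3 * a 3 1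
                - 35/8 * (a 1 4 - 2 * a 1 3 * a 2 2)^2"
        unfolding Let_def d_def using dcoef_formulas by simp
    next
      fix \<mu> :: nat assume \<mu>: "\<mu> \<ge> 4" "(\<forall>i\<in>{4..<\<mu>}. d i = 0) \<and> d \<mu> \<noteq> 0"
      then have "d \<mu> * d \<mu> > 0" by (metis not_real_square_gt_zero)
      then show "reducible_to_D k1 k2 \<mu> (d \<mu>) f" using red \<mu> by blast
      show "D_plus k1 k2 \<mu> f" if "d \<mu> > 0" using plus \<mu> that by blast
      show "D_minus k1 k2 \<mu> f" if "d \<mu> < 0" using minus \<mu> that by blast
    qed
  qed (use P in auto)
qed

end
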